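(* Let $p$ be a prime, let $\ell$ be a positive integer and let $m_1,m_2,\dots,m_\ell$ be nonnegative integers. Define the function $g$ on isomorphism classes of $p$-groups of type $S$ by $$g(G)=|G[p]|^{m_1}|G[p^2]|^{m_2}\cdots|G[p^\ell]|^{m_\ell}.$$ Then $$M^S_0(g)=M^S_1(g)\,p^{m_1+2m_2+\cdots+\ell m_\ell}.$$
   Context: A $p$-group of type $S$ is a finite abelian $p$-group $G$ endowed with a non-degenerate, bilinear, alternating pairing $\beta:G\times G\to\mathbb Q/\mathbb Z$; isomorphisms of groups of type $S$ are group isomorphisms preserving the pairings. Every such group has the form $H\times H$, and conversely each $H\times H$ carries a unique type-$S$ structure up to isomorphism. $\mathrm{Aut}^S(G)$ denotes the group of automorphisms of $G$ preserving the pairing (its order does not depend on the choice of pairing). $G[p^k]$ is the subgroup of elements of $G$ killed by $p^k$. For a nonnegative real $u$ and a complex-valued function $g$ on isomorphism classes of $p$-groups of type $S$, the $u$-average is $$M^S_u(g)=\frac{\sum_{n\ge 0}p^{-nu}\sum_{G(p^n)}\frac{|G|\,g(G)}{|\mathrm{Aut}^S(G)|}}{\prod_{j\ge1}(1-p^{-2u-2j+1})^{-1}},$$ where $\sum_{G(p^n)}$ runs over isomorphism classes of $p$-groups of type $S$ of order $p^n$ (empty for $n$ odd), whenever the numerator converges. *)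

theory Defs
  imports "HOL-Algebra.Coset" "HOL-Algebra.Bij" "HOL-Analysis.Infinite_Products"
    "HOL-Computational_Algebra.Primes"
begin

definition rat_group :: "rat monoid"
  where "rat_group = \<lparr>carrier = UNIV, monoid.mult = (+), one = 0\<rparr>"

definition rat_mod_int :: "rat set monoid"
  where "rat_mod_int = rat_group Mod \<int>"

lemma comm_group_rat_group: "comm_group rat_group"
proof (rule comm_groupI)
  fix x assume "x \<in> carrier rat_group"
  then show "\<exists>y\<in>carrier rat_group. y \<otimes>\<^bsub>rat_group\<^esub> x = \<one>\<^bsub>rat_group\<^esub>"
    by (auto simp: rat_group_def intro: exI[of _ "- x"])
qed (simp_all add: rat_group_def)

lemma comm_group_rat_mod_int: "comm_group rat_mod_int"
proof -
  interpret comm_group rat_group by (rule comm_group_rat_group)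
  have inv: "inv\<^bsub>rat_group\<^esub> x = - x" for x
    by (rule inv_equality) (simp_all add: rat_group_def)
  have "subgroup \<int> rat_group"
  proof (rule subgroupI)
    show "\<int> \<subseteq> carrier rat_group" by (simp add: rat_group_def)
    show "(\<int> :: rat set) \<noteq> {}" using Ints_0 by blast
  qed (simp_all add: inv, simp add: rat_group_def)
  then show ?thesis
    unfolding rat_mod_int_def by (rule abelian_FactGroup)
qed

text \<open>The group operation is written multiplicatively; values of the pairing are cosets of
  \<open>\<int>\<close> in the rationals.\<close>

record 'a type_S = "'a monoid" +
  pairing :: "'a \<Rightarrow> 'a \<Rightarrow> rat set"

locale p_group_type_S = comm_group G
  for p :: nat and G :: "('a, 'b) type_S_scheme" (structure) +
  assumes finite_carrier: "finite (carrier G)"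
    and order_power: "\<exists>n. order G = p ^ n"
    and pairing_hom_right: "x \<in> carrier G \<Longrightarrow> (\<lambda>y. pairing G x y) \<in> hom G rat_mod_int"
    and pairing_hom_left: "y \<in> carrier G \<Longrightarrow> (\<lambda>x. pairing G x y) \<in> hom G rat_mod_int"
    and pairing_alternating: "x \<in> carrier G \<Longrightarrow> pairing G x x = \<one>\<^bsub>rat_mod_int\<^esub>"
    and pairing_nondegenerate:
      "\<lbrakk>x \<in> carrier G; \<And>y. y \<in> carrier G \<Longrightarrow> pairing G x y = \<one>\<^bsub>rat_mod_int\<^esub>\<rbrakk> \<Longrightarrow> x = \<one>"

definition iso_S :: "('a, 'c) type_S_scheme \<Rightarrow> ('b, 'd) type_S_scheme \<Rightarrow> ('a \<Rightarrow> 'b) set"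
  where "iso_S G H = {h \<in> iso G H.
    \<forall>x\<in>carrier G. \<forall>y\<in>carrier G. pairing H (h x) (h y) = pairing G x y}"

text \<open>As in \<^const>\<open>auto\<close>, automorphisms are extensional functions, so that they can be counted.\<close>

definition auto_S :: "('a, 'b) type_S_scheme \<Rightarrow> ('a \<Rightarrow> 'a) set"
  where "auto_S G = {h \<in> auto G.
    \<forall>x\<in>carrier G. \<forall>y\<in>carrier G. pairing G (h x) (h y) = pairing G x y}"

definition torsion :: "('a, 'b) monoid_scheme \<Rightarrow> nat \<Rightarrow> 'a set"
  where "torsion G k = {x \<in> carrier G. x [^]\<^bsub>G\<^esub> k = \<one>\<^bsub>G\<^esub>}"

text \<open>Every finite group is isomorphic to one whose carrier is a set of natural numbers, so
  isomorphism classes of type-S groups are formed among those with elements of type \<^typ>\<open>nat\<close>.\<close>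

definition groups_S :: "nat \<Rightarrow> nat \<Rightarrow> nat type_S set"
  where "groups_S p n = {G. p_group_type_S p G \<and> order G = p ^ n}"

definition iso_rel_S :: "nat \<Rightarrow> nat \<Rightarrow> (nat type_S \<times> nat type_S) set"
  where "iso_rel_S p n =
    {(G, H). G \<in> groups_S p n \<and> H \<in> groups_S p n \<and> iso_S G H \<noteq> {}}"

definition iso_classes_S :: "nat \<Rightarrow> nat \<Rightarrow> nat type_S set set"
  where "iso_classes_S p n = groups_S p n // iso_rel_S p n"

lemma equiv_iso_rel_S: "equiv (groups_S p n) (iso_rel_S p n)"
proof (rule equivI)
  show "iso_rel_S p n \<subseteq> groups_S p n \<times> groups_S p n"
    by (auto simp: iso_rel_S_def)
  show "refl_on (groups_S p n) (iso_rel_S p n)"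
  proof (rule refl_onI)
    fix G :: "nat type_S"
    assume "G \<in> groups_S p n"
    moreover have "(\<lambda>x. x) \<in> iso_S G G"
      by (simp add: iso_S_def iso_set_refl)
    ultimately show "(G, G) \<in> iso_rel_S p n"
      by (auto simp: iso_rel_S_def)
  qed
  show "sym (iso_rel_S p n)"
  proof (rule symI)
    fix G H assume "(G, H) \<in> iso_rel_S p n"
    then obtain h where G: "G \<in> groups_S p n" and H: "H \<in> groups_S p n" and h: "h \<in> iso_S G H"
      by (auto simp: iso_rel_S_def)
    interpret p_group_type_S p G using G by (simp add: groups_S_def)
    let ?k = "inv_into (carrier G) h"
    have im: "h ` carrier G = carrier H" and iso: "h \<in> iso G H"
      using h by (auto simp: iso_S_def iso_iff)
    have "pairing G (?k x) (?k y) = pairing H x y"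
      if "x \<in> carrier H" "y \<in> carrier H" for x y
    proof -
      have k: "?k x \<in> carrier G" "?k y \<in> carrier G" "h (?k x) = x" "h (?k y) = y"
        using that by (simp_all flip: im add: inv_into_into f_inv_into_f)
      then have "pairing H (h (?k x)) (h (?k y)) = pairing G (?k x) (?k y)"
        using h unfolding iso_S_def by blast
      with k show ?thesis by simp
    qed
    then have "?k \<in> iso_S H G"
      using iso_set_sym[OF iso] by (simp add: iso_S_def)
    with G H show "(H, G) \<in> iso_rel_S p n"
      by (auto simp: iso_rel_S_def)
  qed
  show "trans (iso_rel_S p n)"
  proof (rule transI)
    fix G H K assume "(G, H) \<in> iso_rel_S p n" "(H, K) \<in> iso_rel_S p n"
    then obtain h k where GK: "G \<in> groups_S p n" "K \<in> groups_S p n"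
      and hk: "h \<in> iso_S G H" "k \<in> iso_S H K"
      by (auto simp: iso_rel_S_def)
    have "h x \<in> carrier H" if "x \<in> carrier G" for x
      using hk that by (auto simp: iso_S_def iso_iff)
    then have "k \<circ> h \<in> iso_S G K"
      using hk iso_set_trans[of h G H k K] by (simp add: iso_S_def)
    with GK show "(G, K) \<in> iso_rel_S p n"
      by (auto simp: iso_rel_S_def)
  qed
qed

text \<open>For \<open>g\<close> invariant under isomorphisms of type-S groups, the summand does not depend on the
  representative picked from the class.\<close>

definition avg_term_S :: "nat \<Rightarrow> real \<Rightarrow> (nat type_S \<Rightarrow> complex) \<Rightarrow> nat \<Rightarrow> complex"
  where "avg_term_S p u g n = complex_of_real (real p powr (- (real n * u))) *
    (\<Sum>C\<in>iso_classes_S p n. let G = (SOME G. G \<in> C)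
       in of_nat (order G) * g G / of_nat (card (auto_S G)))"

text \<open>The product over \<open>j \<ge> 1\<close> is indexed by \<open>j = Suc i\<close>. The value is meaningful only if
  \<^term>\<open>summable (avg_term_S p u g)\<close>.\<close>

definition M_S :: "nat \<Rightarrow> real \<Rightarrow> (nat type_S \<Rightarrow> complex) \<Rightarrow> complex"
  where "M_S p u g = (\<Sum>n. avg_term_S p u g n) /
    complex_of_real (\<Prod>i. inverse (1 - real p powr (- 2 * u - 2 * real (Suc i) + 1)))"

end

theory Submission
  imports Defs "HOL-Algebra.Multiplicative_Group"
    "HOL-Algebra.Sylow" "HOL-Computational_Algebra.Polynomial"
begin

text \<open>Choosing a generating \<open>r\<close>-tuple of a type-S group turns sums over isomorphism classes, weighted by
  the number of generating tuples divided by the number of automorphisms, into sums over alternating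
  \<open>r \<times> r\<close> matrices with entries in \<open>\<rat>\<^sub>p / \<int>\<^sub>p\<close>. The group \<open>p G\<close> carries the pairing
  \<open>(p x, p y) \<mapsto> \<beta> (p x, y)\<close>, and passing from \<open>G\<close> to \<open>p G\<close> multiplies the matrix by \<open>p\<close>. Counting for
  every \<open>r\<close> gives a triangular system for the total mass of the groups \<open>G\<close> of rank \<open>k\<close> lying over a
  group \<open>p G\<close> of rank \<open>j\<close>; with \<open>q = 1 / p\<close> the solution is
  \<open>q ^ (k (k + 1) / 2) / (q\<^sup>2; q\<^sup>2)\<close> with subscript \<open>(k - j) / 2\<close> if \<open>k - j\<close> is even, and \<open>0\<close> otherwise.
  Iterating this, the numerators of the two averages become, up to an explicit factor, the sums of one
  and the same function \<open>q ^ (n (n - 1) / 2 - M n) P (q ^ n) / (q; q)\<^sub>n\<close>, \<open>P\<close> a polynomial of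
  degree at most \<open>M\<close>, over the even \<open>n\<close> (for \<open>u = 0\<close>) and over the odd \<open>n\<close> (for \<open>u = 1\<close>). Its
  alternating sum vanishes, because \<open>\<Sum>n. (- 1) ^ n q ^ (n (n - 1) / 2 - M n) / (q; q)\<^sub>n\<close> equals the
  infinite product of the factors \<open>1 - q ^ (i - M)\<close>, \<open>i \<ge> 0\<close>.\<close>

text \<open>The weights suit the passage from G to p G because |G[p^(j+1)]| = |G[p]| |(p G)[p^j]|:
  one step costs a power of p that depends on the rank alone. Behind the solution of the triangular
  system stands the identity (t^2; q^2) = (t; q) (-t; q) of infinite products:
  \<open>parity_sum\<close> multiplies a power series by 1 / (t^2; q^2), \<open>qwt\<close> has the
  series (-t; q), and so its image is 1 / (t; q). After \<open>l\<close> steps all weights are 1 and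
  the recursion refers to itself; the sums at that level come from a fixed point equation, and their
  convergence needs an argument of its own. The two averages differ by the factor p^(n (1 - u)). At
  rank k this leaves q^((k + u) (k + u - 1) / 2), the same expression at the shifted rank k + u. For
  u = 1 the shift also rewrites q^(- M k) as q^M q^(- M (k + 1)); the factors q^M of all levels
  multiply to the inverse of the power of p in the theorem. The remaining factor 1 - q is the ratio
  of the denominators of the two averages.\<close>

hide_const (open) Polynomial.order
hide_fact (open) Polynomial.order_def

section \<open>A q-series identity\<close>

text \<open>\<open>qfac q n\<close> is \<open>(q; q)\<^sub>n\<close>.\<close>

definition qfac :: "real \<Rightarrow> nat \<Rightarrow> real"
  where "qfac q n = (\<Prod>i<n. 1 - q ^ Suc i)"

text \<open>In terms of \<open>a\<close> and \<open>n\<close> the weight is \<open>1 / (q\<^sup>2; q\<^sup>2)\<^sub>k\<close> with \<open>k = (n - a) / 2\<close>: the mass of the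
  groups of rank \<open>n\<close> over one of rank \<open>a\<close>, up to a factor depending on \<open>n\<close> only.\<close>

definition parity_sum :: "real \<Rightarrow> (nat \<Rightarrow> real) \<Rightarrow> nat \<Rightarrow> real"
  where "parity_sum q c n = (\<Sum>a | a \<le> n \<and> even (n - a). c a / qfac (q\<^sup>2) ((n - a) div 2))"

text \<open>By Euler, these are the coefficients of f(t), the infinite product of the factors 1 + t
  q^i with i >= 0.\<close>

definition qwt :: "real \<Rightarrow> nat \<Rightarrow> real"
  where "qwt q a = q ^ (a choose 2) / qfac q a"

lemma qfac_0 [simp]: "qfac q 0 = 1"
  by (simp add: qfac_def)

lemma qfac_Suc: "qfac q (Suc n) = (1 - q ^ Suc n) * qfac q n"
  by (simp add: qfac_def)

lemma choose_two_Suc: "Suc n choose 2 = (n choose 2) + n"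
  by (simp add: numeral_2_eq_2)

lemma qwt_0 [simp]: "qwt q 0 = 1"
  by (simp add: qwt_def numeral_2_eq_2)

lemma parity_sum_add: "parity_sum q (\<lambda>a. c a + d a) n = parity_sum q c n + parity_sum q d n"
  by (simp add: parity_sum_def add_divide_distrib sum.distrib)

lemma parity_sum_diff: "parity_sum q (\<lambda>a. c a - d a) n = parity_sum q c n - parity_sum q d n"
  by (simp add: parity_sum_def diff_divide_distrib sum_subtractf)

lemma parity_sum_scale: "parity_sum q (\<lambda>a. x * c a) n = x * parity_sum q c n"
  by (simp add: parity_sum_def sum_distrib_left)

lemma parity_sum_sum: "parity_sum q (\<lambda>a. \<Sum>j\<in>J. c j a) n = (\<Sum>j\<in>J. parity_sum q (c j) n)"
  unfolding parity_sum_def by (subst sum.swap) (simp add: sum_divide_distrib)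

lemma parity_sum_0 [simp]: "parity_sum q c 0 = c 0"
proof -
  have "{a::nat. a \<le> 0 \<and> even (0 - a)} = {0}" by auto
  then show ?thesis by (simp add: parity_sum_def)
qed

text \<open>Multiplication by a power series in t^2 commutes with multiplication by t, and
  \<open>case_nat 0 c\<close> is the coefficient sequence of t times the series of
  \<open>c\<close>.\<close>

lemma parity_sum_shift:
  "parity_sum q (case_nat 0 c) n = case_nat 0 (parity_sum q c) n"
proof (cases n)
  case (Suc m)
  have "parity_sum q (case_nat 0 c) (Suc m) =
      (\<Sum>a \<in> Suc ` {a. a \<le> m \<and> even (m - a)}. case_nat 0 c a / qfac (q\<^sup>2) ((Suc m - a) div 2))"
    unfolding parity_sum_def
  proof (rule sum.mono_neutral_right)
    show "Suc ` {a. a \<le> m \<and> even (m - a)} \<subseteq> {a. a \<le> Suc m \<and> even (Suc m - a)}" by auto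
    show "\<forall>i\<in>{a. a \<le> Suc m \<and> even (Suc m - a)} - Suc ` {a. a \<le> m \<and> even (m - a)}.
       (case i of 0 \<Rightarrow> 0 | Suc x \<Rightarrow> c x) / qfac (q\<^sup>2) ((Suc m - i) div 2) = 0"
    proof
      fix i assume "i\<in>{a. a \<le> Suc m \<and> even (Suc m - a)} - Suc ` {a. a \<le> m \<and> even (m - a)}"
      then have "i = 0" by (cases i) auto
      then show "(case i of 0 \<Rightarrow> 0 | Suc x \<Rightarrow> c x) / qfac (q\<^sup>2) ((Suc m - i) div 2) = 0" by simp
    qed
  qed auto
  also have "\<dots> = parity_sum q c m"
    by (simp add: sum.reindex parity_sum_def)
  finally show ?thesis using Suc by simp
qed simp

locale q_param =
  fixes q :: real
  assumes q_pos: "0 < q" and q_less_1: "q < 1"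
begin

lemma pow_less_1: "n > 0 \<Longrightarrow> q ^ n < 1"
  using q_pos q_less_1 by (simp add: power_less_one_iff)

lemma qfac_pos: "qfac q n > 0"
  unfolding qfac_def by (rule prod_pos) (simp add: pow_less_1 del: power_Suc)

lemma qfac_nz [simp]: "qfac q n \<noteq> 0"
  using qfac_pos[of n] by simp

lemma qfac_sq_pos: "qfac (q\<^sup>2) n > 0"
  unfolding qfac_def
  by (rule prod_pos) (simp add: pow_less_1 flip: power_mult del: power_Suc)

lemma qfac_sq_nz [simp]: "qfac (q\<^sup>2) n \<noteq> 0"
  using qfac_sq_pos[of n] by simp

lemma parity_sum_mono:
  "(\<And>a. a \<le> n \<Longrightarrow> c a \<le> d a) \<Longrightarrow> parity_sum q c n \<le> parity_sum q d n"
  unfolding parity_sum_def by (intro sum_mono divide_right_mono) (auto intro: less_imp_le qfac_sq_pos)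

lemma qwt_pos: "qwt q a > 0"
  using q_pos qfac_pos by (simp add: qwt_def)

text \<open>The functional equation f(t) - f(q t) = t f(q t) for the series f of \<open>qwt\<close>,
  read off at t^a.\<close>

lemma one_minus_qwt: "(1 - q ^ a) * qwt q a = case_nat 0 (\<lambda>b. q ^ b * qwt q b) a"
proof (cases a)
  case (Suc b)
  have "1 - q ^ Suc b \<noteq> 0" using pow_less_1[of "Suc b"] by simp
  then show ?thesis
    using Suc by (simp add: qwt_def qfac_Suc choose_two_Suc power_add del: power_Suc)
qed simp

text \<open>Coefficient form of (-t; q) / (t^2; q^2) = 1 / (t; q). The proof stays with finite sums
  and derives the recurrence (1 - q^n) R(n) = R(n - 1), which characterises 1 / (q; q) with
  subscript n.\<close>

lemma parity_sum_qwt: "parity_sum q (qwt q) n = 1 / qfac q n"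
proof -
  let ?R = "parity_sum q (qwt q)" and ?Q = "parity_sum q (\<lambda>a. q ^ a * qwt q a)"
  have A: "parity_sum q (\<lambda>a. (1 - q ^ a) * qwt q a) (Suc n) = ?Q n" for n
    by (simp add: one_minus_qwt parity_sum_shift)
  have A': "parity_sum q (\<lambda>a. (1 - q ^ a) * qwt q a) n = ?R n - ?Q n" for n
    by (simp add: left_diff_distrib parity_sum_diff)
  have R1: "?R (Suc n) = ?Q (Suc n) + ?Q n" for n using A[of n] A'[of "Suc n"] by linarith
  \<comment> \<open>The factor 1 - q^(n + 2 - a) kills the term a = n + 2 and elsewhere cancels the
    last factor of the denominator, which becomes the one belonging to n.\<close>
  have B: "(\<Sum>a | a \<le> Suc (Suc n) \<and> even (Suc (Suc n) - a).
      q ^ a * (1 - q ^ (Suc (Suc n) - a)) * qwt q a / qfac (q\<^sup>2) ((Suc (Suc n) - a) div 2)) = ?Q n"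
    (is "(\<Sum>a\<in>?A. ?f a) = _") for n
  proof -
    have "(\<Sum>a\<in>?A. ?f a) = (\<Sum>a | a \<le> n \<and> even (n - a). ?f a)"
    proof (rule sum.mono_neutral_right)
      show "\<forall>i\<in>?A - {a. a \<le> n \<and> even (n - a)}. ?f i = 0"
      proof
        fix i assume i: "i \<in> ?A - {a. a \<le> n \<and> even (n - a)}"
        have "i = Suc (Suc n)"
        proof (rule ccontr)
          assume "i \<noteq> Suc (Suc n)"
          moreover have "i \<noteq> Suc n" using i by auto
          ultimately have "i \<le> n" using i by auto
          with i show False by (auto simp: Suc_diff_le)
        qed
        then show "?f i = 0" by simp
      qed
    qed (auto simp: Suc_diff_le)
    also have "\<dots> = ?Q n"
      unfolding parity_sum_def
    proof (rule sum.cong)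
      fix a assume "a \<in> {a. a \<le> n \<and> even (n - a)}"
      then have "even (n - a)" and "a \<le> n" by blast+
      then obtain k where k: "n - a = 2 * k" "a \<le> n" by (blast elim: evenE)
      then have e: "Suc (Suc n) - a = 2 * Suc k" by simp
      have "1 - (q\<^sup>2) ^ Suc k \<noteq> 0"
        using pow_less_1[of "2 * Suc k"] by (simp flip: power_mult del: power_Suc)
      then show "?f a = q ^ a * qwt q a / qfac (q\<^sup>2) ((n - a) div 2)"
        unfolding e k(1) by (simp add: qfac_Suc power_mult del: power_Suc mult_Suc_right)
    qed simp
    finally show ?thesis .
  qed
  have R2: "(1 - q ^ Suc (Suc n)) * ?R (Suc (Suc n)) = ?R (Suc n)" for n
  proof -
    let ?N = "Suc (Suc n)"
    \<comment> \<open>The first part is summed by \<open>A\<close>, the second by \<open>B\<close>;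
      together they give the right side of \<open>R1\<close>.\<close>
    have split: "(1 - q ^ ?N) = (1 - q ^ a) + q ^ a * (1 - q ^ (?N - a))" if "a \<le> ?N" for a
      using that by (simp add: right_diff_distrib flip: power_add)
    have "(1 - q ^ ?N) * ?R ?N =
       (\<Sum>a | a \<le> ?N \<and> even (?N - a). (1 - q ^ ?N) * qwt q a / qfac (q\<^sup>2) ((?N - a) div 2))"
      by (simp add: parity_sum_def sum_distrib_left)
    also have "\<dots> = (\<Sum>a | a \<le> ?N \<and> even (?N - a). (1 - q ^ a) * qwt q a / qfac (q\<^sup>2) ((?N - a) div 2)
         + q ^ a * (1 - q ^ (?N - a)) * qwt q a / qfac (q\<^sup>2) ((?N - a) div 2))"
    proof (rule sum.cong[OF refl])
      fix a assume "a \<in> {a. a \<le> ?N \<and> even (?N - a)}"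
      then have "a \<le> ?N" by simp
      then show "(1 - q ^ ?N) * qwt q a / qfac (q\<^sup>2) ((?N - a) div 2) =
        (1 - q ^ a) * qwt q a / qfac (q\<^sup>2) ((?N - a) div 2)
         + q ^ a * (1 - q ^ (?N - a)) * qwt q a / qfac (q\<^sup>2) ((?N - a) div 2)"
        by (subst split[of a]) (simp_all add: add_divide_distrib distrib_right del: power_Suc)
    qed
    also have "\<dots> = ?Q (Suc n) + ?Q n"
      unfolding sum.distrib B using A[of "Suc n"] by (simp add: parity_sum_def)
    finally show ?thesis using R1 by simp
  qed
  \<comment> \<open>\<open>R2\<close> only links indices from 1 upwards, so the value at 1 is
    computed by hand.\<close>
  have R_1: "?R 1 = 1 / (1 - q)"
  proof -
    have "{a::nat. a \<le> 1 \<and> even (1 - a)} = {1}" by (auto simp: le_Suc_eq)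
    then show ?thesis by (simp add: parity_sum_def qwt_def qfac_def numeral_2_eq_2)
  qed
  show ?thesis
  proof (induction n)
    case 0 then show ?case by simp
  next
    case (Suc n)
    show ?case
    proof (cases n)
      case 0 then show ?thesis using R_1 by (simp add: qfac_def)
    next
      case (Suc m)
      have "1 - q ^ Suc n \<noteq> 0" using pow_less_1[of "Suc n"] by simp
      then have "?R (Suc n) = ?R n / (1 - q ^ Suc n)"
        using R2[of m] Suc by (simp add: field_simps del: power_Suc)
      then show ?thesis using Suc.IH by (simp add: qfac_Suc del: power_Suc)
    qed
  qed
qed

text \<open>Coefficient form of f(t / q^(M+1)) = (1 + t / q^(M+1)) f(t / q^M) for the series f of
  \<open>qwt\<close>. It drives both inductions on \<open>M\<close> below.\<close>

lemma inverse_pow_qwt: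
  "inverse q ^ (Suc M * a) * qwt q a = inverse q ^ (M * a) * qwt q a
    + inverse q ^ Suc M * case_nat 0 (\<lambda>b. inverse q ^ (M * b) * qwt q b) a"
proof (cases a)
  case (Suc b)
  have "q \<noteq> 0" using q_pos by simp
  have nz: "1 - q ^ Suc b \<noteq> 0" using pow_less_1[of "Suc b"] by simp
  have i: "inverse q ^ n = 1 / q ^ n" for n by (simp add: field_simps power_inverse)
  have "qwt q (Suc b) * (1 - q ^ Suc b) = q ^ b * qwt q b"
    using one_minus_qwt[of "Suc b"] by (simp add: mult.commute)
  then have w: "qwt q (Suc b) = q ^ Suc b * qwt q (Suc b) + q ^ b * qwt q b"
    by (simp add: algebra_simps)
  have e: "inverse q ^ (Suc M * Suc b) = inverse q ^ (M * Suc b) * inverse q ^ Suc b"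
    by (metis mult_Suc add.commute power_add)
  have c: "inverse q ^ k * q ^ k = 1" for k using \<open>q \<noteq> 0\<close> by (simp flip: power_mult_distrib)
  have "inverse q ^ (Suc M * Suc b) * qwt q (Suc b) =
     inverse q ^ (M * Suc b) * inverse q ^ Suc b * (q ^ Suc b * qwt q (Suc b) + q ^ b * qwt q b)"
    by (subst e, subst w) simp
  also have "\<dots> = inverse q ^ (M * Suc b) * ((inverse q ^ Suc b * q ^ Suc b) * qwt q (Suc b)
     + inverse q * (inverse q ^ b * q ^ b) * qwt q b)"
    by (simp add: algebra_simps)
  also have "\<dots> = inverse q ^ (M * Suc b) * (qwt q (Suc b) + inverse q * qwt q b)"
    unfolding c by simp
  also have "\<dots> = inverse q ^ (M * Suc b) * qwt q (Suc b) + inverse q ^ Suc M * (inverse q ^ (M * b) * qwt q b)"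
    by (simp add: algebra_simps power_add)
  finally show ?thesis using Suc by simp
qed simp

text \<open>Raising \<open>M\<close> by one adds a shifted copy of the sequence. Shifting n to n - 1
  turns the denominator (q; q) at n - 1 into the one at n at the cost of a factor 1 - q^n, which
  raises the degree in q^n by one.\<close>

lemma parity_sum_inverse_pow:
  "\<exists>P. degree P \<le> M \<and>
    (\<forall>n. parity_sum q (\<lambda>a. inverse q ^ (M * a) * qwt q a) n = poly P (q ^ n) / qfac q n)"
proof (induction M)
  case 0
  show ?case by (rule exI[of _ 1]) (simp add: parity_sum_qwt)
next
  case (Suc M)
  then obtain P where P: "degree P \<le> M"
    "\<And>n. parity_sum q (\<lambda>a. inverse q ^ (M * a) * qwt q a) n = poly P (q ^ n) / qfac q n" by blast
  \<comment> \<open>At the argument q^n, the factor \<open>[:1, -1:]\<close> is 1 - q^n, and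
    composing with X / q replaces q^n by q^(n-1).\<close>
  let ?P = "P + smult (inverse q ^ Suc M) ([:1, -1:] * pcompose P [:0, inverse q:])"
  have "degree (pcompose P [:0, inverse q:]) \<le> M"
    using P(1) q_pos by (simp add: degree_pcompose)
  then have "degree ([:1, -1:] * pcompose P [:0, inverse q:]) \<le> Suc M"
    by (intro order.trans[OF degree_mult_le]) simp
  then have "degree ?P \<le> Suc M"
    using P(1) by (intro degree_add_le) auto
  moreover have "parity_sum q (\<lambda>a. inverse q ^ (Suc M * a) * qwt q a) n = poly ?P (q ^ n) / qfac q n" for n
  proof -
    have "parity_sum q (\<lambda>a. inverse q ^ (Suc M * a) * qwt q a) n =
      poly P (q ^ n) / qfac q n + inverse q ^ Suc M * case_nat 0 (\<lambda>n. poly P (q ^ n) / qfac q n) n"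
      unfolding inverse_pow_qwt parity_sum_add parity_sum_scale parity_sum_shift P(2) ..
    also have "case_nat 0 (\<lambda>n. poly P (q ^ n) / qfac q n) n =
      (1 - q ^ n) * poly P (inverse q * q ^ n) / qfac q n"
    proof (cases n)
      case (Suc m)
      then have "inverse q * q ^ n = q ^ m" using q_pos by simp
      moreover have "1 - q ^ Suc m \<noteq> 0" using pow_less_1[of "Suc m"] by simp
      ultimately show ?thesis using Suc by (simp add: qfac_Suc del: power_Suc)
    qed simp
    finally show ?thesis
      by (simp add: poly_pcompose add_divide_distrib diff_divide_distrib algebra_simps)
  qed
  ultimately show ?case by blast
qed

lemma inverse_pow_mult_pow:
  assumes "j \<le> M"
  shows "inverse q ^ (M * a) * (q ^ a) ^ j = inverse q ^ ((M - j) * a)"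
proof -
  have "M * a = (M - j) * a + a * j"
    using assms by (metis add_mult_distrib le_add_diff_inverse2 mult.commute)
  then have "inverse q ^ (M * a) = inverse q ^ ((M - j) * a) * inverse q ^ (a * j)"
    by (simp add: power_add)
  then show ?thesis
    using q_pos by (simp add: power_mult[symmetric] flip: power_mult_distrib)
qed

lemma poly_as_sum_le: "degree P \<le> M \<Longrightarrow> poly P x = (\<Sum>j\<le>M. coeff P j * x ^ j)" for P :: "real poly"
  unfolding poly_altdef
  by (rule sum.mono_neutral_left) (auto simp: coeff_eq_0)

text \<open>The closure property behind the induction over levels. The bound deg P <= M ensures that
  each monomial of P leaves a natural exponent M - j, to which \<open>parity_sum_inverse_pow\<close>
  applies.\<close>

lemma parity_sum_poly:
  assumes "degree P \<le> M"
  shows "\<exists>P'. degree P' \<le> M \<and> (\<forall>n. parity_sum q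
    (\<lambda>a. inverse q ^ (M * a) * qwt q a * poly P (q ^ a)) n = poly P' (q ^ n) / qfac q n)"
proof -
  obtain R where R: "\<And>j. degree (R j) \<le> j"
    "\<And>j n. parity_sum q (\<lambda>a. inverse q ^ (j * a) * qwt q a) n = poly (R j) (q ^ n) / qfac q n"
    using parity_sum_inverse_pow by metis
  let ?P = "\<Sum>j\<le>M. smult (coeff P j) (R (M - j))"
  have e: "inverse q ^ (M * a) * qwt q a * poly P (q ^ a) =
      (\<Sum>j\<le>M. coeff P j * (inverse q ^ ((M - j) * a) * qwt q a))" for a
    unfolding poly_as_sum_le[OF assms] sum_distrib_left
    by (rule sum.cong[OF refl], subst inverse_pow_mult_pow[symmetric]) (simp_all add: ac_simps)
  have "degree ?P \<le> M"
  proof (rule degree_sum_le)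
    fix j show "degree (smult (coeff P j) (R (M - j))) \<le> M"
      using R(1)[of "M - j"] degree_smult_le[of "coeff P j" "R (M - j)"] by linarith
  qed simp
  moreover have "parity_sum q (\<lambda>a. inverse q ^ (M * a) * qwt q a * poly P (q ^ a)) n =
      poly ?P (q ^ n) / qfac q n" for n
    unfolding e parity_sum_sum parity_sum_scale R(2)
    by (simp add: poly_sum sum_divide_distrib)
  ultimately show ?thesis by blast
qed

lemma summable_inverse_pow_qwt: "summable (\<lambda>n. inverse q ^ (M * n) * qwt q n)"
proof -
  let ?f = "\<lambda>n. inverse q ^ (M * n) * qwt q n"
  have ratio: "?f (Suc n) = inverse q ^ M * q ^ n / (1 - q ^ Suc n) * ?f n" for n
    by (simp add: qwt_def qfac_Suc choose_two_Suc power_add)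
  have "(\<lambda>n. inverse q ^ M * q ^ n / (1 - q ^ Suc n)) \<longlonglongrightarrow> inverse q ^ M * 0 / (1 - 0)"
    using q_pos q_less_1 by (intro tendsto_intros LIMSEQ_Suc) auto
  then have "eventually (\<lambda>n. inverse q ^ M * q ^ n / (1 - q ^ Suc n) < 1/2) sequentially"
    by (rule order_tendstoD) simp
  then obtain N where N: "\<And>n. n \<ge> N \<Longrightarrow> inverse q ^ M * q ^ n / (1 - q ^ Suc n) < 1/2"
    by (auto simp: eventually_sequentially)
  have pos: "?f n > 0" for n using qwt_pos q_pos by simp
  show ?thesis
  proof (rule summable_ratio_test[of "1/2" N])
    fix n assume "n \<ge> N"
    then have "?f (Suc n) \<le> 1/2 * ?f n"
      unfolding ratio using N[of n] pos[of n] by (intro mult_right_mono) auto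
    then show "norm (?f (Suc n)) \<le> 1/2 * norm (?f n)" using pos[of n] pos[of "Suc n"] by simp
  qed simp
qed

text \<open>No infinite product is formed: for M = 0 the partial sums have a closed form tending to
  0, and \<open>inverse_pow_qwt\<close> writes the series for M + 1 as a combination of the series
  for M and its shift.\<close>

lemma alternating_sum_inverse_pow: "(\<lambda>n. (- 1) ^ n * (inverse q ^ (M * n) * qwt q n)) sums 0"
proof (induction M)
  case 0
  have "(\<Sum>n<Suc N. (- 1) ^ n * qwt q n) = (- 1) ^ N * (q ^ N * qwt q N)" for N
  proof (induction N)
    case (Suc N)
    have "(\<Sum>n<Suc (Suc N). (- 1) ^ n * qwt q n)
      = (- 1) ^ N * (q ^ N * qwt q N) + (- 1) ^ Suc N * qwt q (Suc N)"
      using Suc by simp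
    also have "q ^ N * qwt q N = (1 - q ^ Suc N) * qwt q (Suc N)"
      using one_minus_qwt[of "Suc N"] by simp
    finally show ?case by (simp add: algebra_simps)
  qed simp
  moreover have "(\<lambda>N. (- 1) ^ N * (q ^ N * qwt q N)) \<longlonglongrightarrow> 0"
  proof (rule tendsto_rabs_zero_cancel)
    have "(\<lambda>N. q ^ N * qwt q N) \<longlonglongrightarrow> 0 * 0"
      using summable_LIMSEQ_zero[OF summable_inverse_pow_qwt[of 0]] q_pos q_less_1
      by (intro tendsto_mult LIMSEQ_realpow_zero) auto
    then show "(\<lambda>N. \<bar>(- 1) ^ N * (q ^ N * qwt q N)\<bar>) \<longlonglongrightarrow> 0"
      using q_pos qwt_pos by (simp add: abs_mult less_imp_le)
  qed
  ultimately have "(\<lambda>N. \<Sum>n<Suc N. (- 1) ^ n * qwt q n) \<longlonglongrightarrow> 0"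
    by (simp del: sum.lessThan_Suc)
  then have "(\<lambda>N. \<Sum>n<N. (- 1) ^ n * qwt q n) \<longlonglongrightarrow> 0"
    by (subst (asm) filterlim_sequentially_Suc)
  then show ?case by (simp add: sums_def)
next
  case (Suc M)
  let ?g = "\<lambda>b. inverse q ^ (M * b) * qwt q b"
  have "(\<lambda>n. (- 1) ^ Suc n * ?g n) sums 0"
    using sums_minus[OF Suc] by simp
  then have "(\<lambda>n. (- 1) ^ Suc n * case_nat 0 ?g (Suc n)) sums 0" by simp
  then have "(\<lambda>n. (- 1) ^ n * case_nat 0 ?g n) sums 0"
    by (subst (asm) sums_Suc_iff) simp
  from sums_add[OF Suc sums_mult[OF this, of "inverse q ^ Suc M"]]
  show ?case unfolding inverse_pow_qwt by (simp add: algebra_simps)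
qed

lemma alternating_sum_poly:
  assumes "degree P \<le> M"
  shows "summable (\<lambda>n. \<bar>inverse q ^ (M * n) * qwt q n * poly P (q ^ n)\<bar>)"
    and "(\<lambda>n. (- 1) ^ n * (inverse q ^ (M * n) * qwt q n * poly P (q ^ n))) sums 0"
proof -
  have e: "inverse q ^ (M * a) * qwt q a * poly P (q ^ a) =
      (\<Sum>j\<le>M. coeff P j * (inverse q ^ ((M - j) * a) * qwt q a))" for a
    unfolding poly_as_sum_le[OF assms] sum_distrib_left
    by (rule sum.cong[OF refl], subst inverse_pow_mult_pow[symmetric]) (simp_all add: ac_simps)
  show "(\<lambda>n. (- 1) ^ n * (inverse q ^ (M * n) * qwt q n * poly P (q ^ n))) sums 0"
  proof -
    have "(\<lambda>n. \<Sum>j\<le>M. coeff P j * ((- 1) ^ n * (inverse q ^ ((M - j) * n) * qwt q n))) sums (\<Sum>j\<le>M. coeff P j * 0)"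
      by (intro sums_sum sums_mult alternating_sum_inverse_pow)
    then show ?thesis unfolding e by (simp add: sum_distrib_left mult.left_commute)
  qed
  show "summable (\<lambda>n. \<bar>inverse q ^ (M * n) * qwt q n * poly P (q ^ n)\<bar>)"
    unfolding e
  proof (rule summable_comparison_test')
    show "summable (\<lambda>n. \<Sum>j\<le>M. \<bar>coeff P j\<bar> * (inverse q ^ ((M - j) * n) * qwt q n))"
      by (intro summable_sum summable_mult summable_inverse_pow_qwt)
    show "norm \<bar>\<Sum>j\<le>M. coeff P j * (inverse q ^ ((M - j) * n) * qwt q n)\<bar>
      \<le> (\<Sum>j\<le>M. \<bar>coeff P j\<bar> * (inverse q ^ ((M - j) * n) * qwt q n))" for n
      using q_pos qwt_pos[of n] by (auto intro!: order.trans[OF sum_abs] sum_mono simp: abs_mult)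
  qed
qed

end

section \<open>Inversion of the triangular system\<close>

lemma choose_two_add: "(k + a) choose 2 = (k choose 2) + (a choose 2) + k * a"
  by (induction a) (simp_all add: choose_two_Suc numeral_2_eq_2)

context q_param
begin

text \<open>Up to a factor in r alone, the powers of q then depend on r - k only, so that the left
  side of the system becomes a convolution with \<open>qwt\<close>.\<close>

lemma triangular_exponent:
  assumes "k \<le> r"
  shows "inverse q ^ (k * r) * q ^ (Suc k choose 2) = inverse q ^ (r choose 2) * q ^ ((r - k) choose 2)"
proof -
  define a where "a = r - k"
  have r: "r = k + a" using assms by (simp add: a_def)
  have "2 * (k choose 2) + k = k * k" by (induction k) (simp_all add: choose_two_Suc)
  then have "(r choose 2) + (Suc k choose 2) = (a choose 2) + k * r"
    unfolding r choose_two_add choose_two_Suc by (simp add: algebra_simps)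
  then have "q ^ (r choose 2) * q ^ (Suc k choose 2) = q ^ (a choose 2) * q ^ (k * r)"
    by (simp flip: power_add)
  then show ?thesis using q_pos by (simp add: power_inverse field_simps a_def)
qed

text \<open>Forward substitution: the diagonal coefficient q^(- r^2) is nonzero.\<close>

lemma triangular_unique:
  fixes D :: "nat \<Rightarrow> real"
  assumes "\<And>r. (\<Sum>k\<le>r. inverse q ^ (k * r) * D k / qfac q (r - k)) = 0"
  shows "D k = 0"
proof (induction k rule: less_induct)
  case (less r)
  have "(\<Sum>k\<le>r. inverse q ^ (k * r) * D k / qfac q (r - k)) = inverse q ^ (r * r) * D r / qfac q (r - r)
      + (\<Sum>k\<in>{..r} - {r}. inverse q ^ (k * r) * D k / qfac q (r - k))"
    by (rule sum.remove) auto
  also have "(\<Sum>k\<in>{..r} - {r}. inverse q ^ (k * r) * D k / qfac q (r - k)) = 0"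
    using less by (intro sum.neutral) auto
  finally show ?case using assms[of r] q_pos by simp
qed

text \<open>The claimed solution is substituted. After swapping the sums, the inner sum for a fixed
  j is \<open>parity_sum_qwt\<close> at r - j, which yields the right side; uniqueness does the
  rest.\<close>

lemma triangular_solve:
  fixes X Y :: "nat \<Rightarrow> real"
  assumes "\<And>r. (\<Sum>k\<le>r. inverse q ^ (k * r) * Y k / qfac q (r - k)) =
    inverse q ^ (r choose 2) * (\<Sum>j\<le>r. X j / qfac q (r - j))"
  shows "Y k = q ^ (Suc k choose 2) * parity_sum q X k"
proof -
  define Y' where "Y' k = q ^ (Suc k choose 2) * parity_sum q X k" for k
  have "(\<Sum>k\<le>r. inverse q ^ (k * r) * Y' k / qfac q (r - k)) =
    inverse q ^ (r choose 2) * (\<Sum>j\<le>r. X j / qfac q (r - j))" for r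
  proof -
    have "(\<Sum>k\<le>r. inverse q ^ (k * r) * Y' k / qfac q (r - k)) =
      (\<Sum>k\<le>r. inverse q ^ (r choose 2) * (qwt q (r - k) * parity_sum q X k))"
    proof (rule sum.cong[OF refl])
      fix k assume "k \<in> {..r}"
      then have "inverse q ^ (k * r) * Y' k / qfac q (r - k) =
        inverse q ^ (r choose 2) * q ^ ((r - k) choose 2) * parity_sum q X k / qfac q (r - k)"
        unfolding Y'_def mult.assoc[symmetric] by (subst triangular_exponent) auto
      then show "inverse q ^ (k * r) * Y' k / qfac q (r - k) =
        inverse q ^ (r choose 2) * (qwt q (r - k) * parity_sum q X k)"
        by (simp add: qwt_def)
    qed
    also have "\<dots> = inverse q ^ (r choose 2) * (\<Sum>k\<le>r. qwt q (r - k) * parity_sum q X k)"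
      by (simp add: sum_distrib_left)
    also have "(\<Sum>k\<le>r. qwt q (r - k) * parity_sum q X k) =
      (\<Sum>k\<le>r. \<Sum>j | j \<le> k \<and> even (k - j). qwt q (r - k) * (X j / qfac (q\<^sup>2) ((k - j) div 2)))"
      by (simp add: parity_sum_def sum_distrib_left)
    also have "\<dots> = (\<Sum>j\<le>r. \<Sum>k | j \<le> k \<and> k \<le> r \<and> even (k - j).
        qwt q (r - k) * (X j / qfac (q\<^sup>2) ((k - j) div 2)))"
      by (subst sum.Sigma, simp, simp, subst sum.Sigma, simp, simp,
        rule sum.reindex_bij_witness[of _ "\<lambda>(j, k). (k, j)" "\<lambda>(k, j). (j, k)"]) auto
    also have "\<dots> = (\<Sum>j\<le>r. X j * parity_sum q (qwt q) (r - j))"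
    proof (rule sum.cong[OF refl])
      fix j assume "j \<in> {..r}"
      then have j: "j \<le> r" by simp
      show "(\<Sum>k | j \<le> k \<and> k \<le> r \<and> even (k - j). qwt q (r - k) * (X j / qfac (q\<^sup>2) ((k - j) div 2)))
        = X j * parity_sum q (qwt q) (r - j)"
        unfolding parity_sum_def sum_distrib_left
        by (rule sum.reindex_bij_witness[of _ "\<lambda>a. r - a" "\<lambda>k. r - k"]) (use j in auto)
    qed
    finally show ?thesis by (simp add: parity_sum_qwt)
  qed
  with assms have "(\<Sum>k\<le>r. inverse q ^ (k * r) * (Y k - Y' k) / qfac q (r - k)) = 0" for r
    by (simp add: right_diff_distrib diff_divide_distrib sum_subtractf)
  from triangular_unique[OF this, of k] show ?thesis by (simp add: Y'_def)
qed

end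

section \<open>Iterated sums over ranks\<close>

text \<open>Tonelli for a nonnegative array. Because the entries with n < k vanish, triangular and
  square partial sums agree, and comparing partial sums in both directions suffices.\<close>

lemma sums_triangular_swap:
  fixes a :: "nat \<Rightarrow> nat \<Rightarrow> real"
  assumes nonneg: "\<And>n k. a n k \<ge> 0" and tri: "\<And>n k. n < k \<Longrightarrow> a n k = 0"
    and col: "\<And>k. (\<lambda>n. a n k) sums b k" and b: "b sums s"
  shows "(\<lambda>n. \<Sum>k\<le>n. a n k) sums s"
proof -
  have b_nonneg: "b k \<ge> 0" for k using sums_le[OF _ sums_zero col] nonneg by blast
  have part: "(\<Sum>n<B. \<Sum>k\<le>n. a n k) = (\<Sum>k<B. \<Sum>n<B. a n k)" for B
  proof -
    have "(\<Sum>n<B. \<Sum>k\<le>n. a n k) = (\<Sum>n<B. \<Sum>k<B. a n k)"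
      by (intro sum.cong[OF refl] sum.mono_neutral_left) (auto simp: tri)
    then show ?thesis by (subst sum.swap)
  qed
  have le: "(\<Sum>n<B. \<Sum>k\<le>n. a n k) \<le> s" for B
  proof -
    have "(\<Sum>k<B. \<Sum>n<B. a n k) \<le> (\<Sum>k<B. b k)"
      by (intro sum_mono) (metis col nonneg sum_le_suminf sums_iff finite_lessThan)
    also have "\<dots> \<le> s"
      using b b_nonneg by (metis sum_le_suminf sums_iff finite_lessThan)
    finally show ?thesis using part by simp
  qed
  have rows: "(\<Sum>k\<le>n. a n k) \<ge> 0" for n by (intro sum_nonneg nonneg)
  have "summable (\<lambda>n. \<Sum>k\<le>n. a n k)"
    by (rule summableI_nonneg_bounded[OF rows le])
  then obtain s' where s': "(\<lambda>n. \<Sum>k\<le>n. a n k) sums s'" by (auto simp: summable_def)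
  have "s' \<le> s" using s' le unfolding sums_def by (meson LIMSEQ_le_const2)
  moreover have "(\<Sum>k<K. b k) \<le> s'" for K
  proof (rule LIMSEQ_le_const2)
    show "(\<lambda>B. \<Sum>k<K. \<Sum>n<B. a n k) \<longlonglongrightarrow> (\<Sum>k<K. b k)"
      using col by (intro tendsto_sum) (simp add: sums_def)
    have "(\<Sum>k<K. \<Sum>n<B. a n k) \<le> s'" if "B \<ge> K" for B
    proof -
      have "(\<Sum>k<K. \<Sum>n<B. a n k) \<le> (\<Sum>k<B. \<Sum>n<B. a n k)"
        using that by (intro sum_mono2) (auto intro: sum_nonneg nonneg)
      also have "\<dots> \<le> s'"
        using sum_le_suminf[OF sums_summable[OF s'] finite_lessThan, of B] rows sums_unique[OF s']
        unfolding part[symmetric] by simp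
      finally show ?thesis .
    qed
    then show "\<exists>N. \<forall>B\<ge>N. (\<Sum>k<K. \<Sum>n<B. a n k) \<le> s'" by blast
  qed
  then have "s \<le> s'" using b unfolding sums_def by (meson LIMSEQ_le_const2)
  ultimately show ?thesis using s' by simp
qed

lemma parity_sum_cong:
  "(\<And>a. a \<le> n \<Longrightarrow> even (n - a) \<Longrightarrow> c a = d a) \<Longrightarrow> parity_sum q c n = parity_sum q d n"
  unfolding parity_sum_def by (rule sum.cong) auto

text \<open>For e = 1 the sum on the right runs over odd indices only, so it does not see the entry
  of \<open>c\<close> at 0, which the shift replaces by 0.\<close>

lemma parity_sum_offset:
  assumes "even k" "e \<le> 1"
  shows "parity_sum q (\<lambda>j. c (j + e)) k = parity_sum q c (k + e)"
proof (cases "e = 0")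
  case False
  then have e: "e = 1" using assms by simp
  have "parity_sum q c (k + e) = parity_sum q (case_nat 0 (\<lambda>j. c (j + e))) (k + e)"
    using assms(1) e by (intro parity_sum_cong) (auto split: nat.split)
  then show ?thesis using e parity_sum_shift[of q _ "k + e"] by simp
qed simp

lemma sums_parity_sum:
  assumes "\<And>j. j \<le> k \<Longrightarrow> even (k - j) \<Longrightarrow> (\<lambda>n. f n j) sums s j"
  shows "(\<lambda>n. parity_sum q (f n) k) sums parity_sum q s k"
  unfolding parity_sum_def by (intro sums_sum sums_divide) (use assms in auto)

text \<open>\<open>X i n k\<close> is the mass of the groups of order \<open>p ^ n\<close> and rank \<open>k\<close>, each weighted by the product of
  the \<open>|G[p ^ (j - i)]| ^ m\<^sub>j\<close> over \<open>i < j \<le> l\<close>, and \<open>M i\<close> is the sum of the \<open>m\<^sub>j\<close> over \<open>i < j \<le> l\<close>.\<close>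

locale rank_recursion = q_param +
  fixes X :: "nat \<Rightarrow> nat \<Rightarrow> nat \<Rightarrow> real" and M :: "nat \<Rightarrow> nat" and l :: nat
  assumes nonneg: "X i n k \<ge> 0"
    and rec: "X i (n + k) k =
      inverse q ^ (M i * k) * q ^ (Suc k choose 2) * parity_sum q (X (Suc i) n) k"
    and small: "n < k \<Longrightarrow> X i n k = 0"
    and init: "X i n 0 = (if n = 0 then 1 else 0)"
    and antimono: "M (Suc i) \<le> M i"
    and M_zero: "i \<ge> l \<Longrightarrow> M i = 0"
    and X_const: "i \<ge> l \<Longrightarrow> X i = X l"
begin

text \<open>The recursion preserves the parity of the rank, and for k > 0 it lowers n, until n <
  k.\<close>

lemma odd_rank: "odd k \<Longrightarrow> X i n k = 0"
proof (induction n arbitrary: i k rule: less_induct)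
  case (less n)
  show ?case
  proof (cases "n < k")
    case False
    moreover have "k > 0" using less.prems by (cases k) auto
    ultimately have n: "n = (n - k) + k" "n - k < n" by auto
    have "parity_sum q (X (Suc i) (n - k)) k = parity_sum q (\<lambda>_. 0) k"
      using less n(2) by (intro parity_sum_cong) auto
    then show ?thesis by (subst n(1)) (simp add: rec parity_sum_def)
  qed (simp add: small)
qed

text \<open>The parameter \<open>e \<in> {0, 1}\<close> is the \<open>u\<close> of the average: the groups of order \<open>p ^ n\<close> enter with the
  factor \<open>p ^ (n * (1 - u))\<close>. Shifting the rank by \<open>e\<close> makes the two cases \<open>e = 0\<close> and \<open>e = 1\<close> the even
  and the odd part of one sum.\<close>

definition z :: "nat \<Rightarrow> real" where "z e = inverse q ^ (1 - e)"

text \<open>1 - q makes the value at rank 0 of level \<open>l\<close> equal to 1 also for e = 1;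
  each level above it contributes q^(M i) when q^(- M k) is rewritten in terms of k + e.\<close>

definition C :: "nat \<Rightarrow> nat \<Rightarrow> real" where "C e i = ((1 - q) * q ^ (\<Sum>i'\<in>{i..<l}. M i')) ^ e"

lemma z_pos: "z e > 0"
  using q_pos by (simp add: z_def)

text \<open>Here the two averages become one function: the power of p left by \<open>u\<close> and
  the factor from the recursion combine to an expression in k + e.\<close>

lemma z_pow:
  assumes "e \<le> 1"
  shows "z e ^ k * q ^ (Suc k choose 2) = q ^ ((k + e) choose 2)"
proof -
  have "inverse q ^ k * q ^ k = 1" using q_pos by (simp flip: power_mult_distrib)
  with assms show ?thesis
    by (cases e) (auto simp: z_def choose_two_Suc power_add)
qed

lemma zrec:
  "z e ^ (n + k) * X i (n + k) k = z e ^ k * q ^ (Suc k choose 2) * inverse q ^ (M i * k)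
    * parity_sum q (\<lambda>j. z e ^ n * X (Suc i) n j) k"
  by (simp add: rec power_add parity_sum_scale)

text \<open>The candidate for the sums at level \<open>l\<close> solves their fixed point equation;
  this is \<open>parity_sum_qwt\<close> at k + e.\<close>

lemma parity_sum_qwt_offset:
  assumes "even k" "e \<le> 1"
  shows "z e ^ k * q ^ (Suc k choose 2) * parity_sum q (\<lambda>j. (1 - q) ^ e * qwt q (j + e)) k
    = (1 - q) ^ e * qwt q (k + e)"
  unfolding parity_sum_scale parity_sum_offset[OF assms] parity_sum_qwt z_pow[OF assms(2)]
  by (simp add: qwt_def)

text \<open>At level \<open>l\<close> the column k occurs on both sides of the recursion (term j =
  k), so its convergence does not follow from smaller columns. But the partial sum up to
  \<open>B\<close> only needs partial sums up to \<open>B - k\<close>, and induction on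
  \<open>B\<close> bounds it by the expected limit.\<close>

lemma base_partial:
  assumes e: "e \<le> 1"
  shows "even k \<Longrightarrow> (\<Sum>n<B. z e ^ n * X l n k) \<le> (1 - q) ^ e * qwt q (k + e)"
proof (induction B arbitrary: k rule: less_induct)
  case (less B)
  have zk: "z e ^ k > 0" using z_pos by simp
  have rhs: "(1 - q) ^ e * qwt q (k + e) \<ge> 0" for k
    using q_less_1 qwt_pos[of "k + e"] by (simp add: less_imp_le)
  show ?case
  proof (cases "k = 0 \<or> B \<le> k")
    case True
    then show ?thesis
    proof
      assume k: "k = 0"
      have one: "(1 - q) ^ e * qwt q e = 1"
        using q_less_1 e by (cases e) (auto simp: qwt_def qfac_def numeral_2_eq_2)
      have "(\<Sum>n<B. z e ^ n * X l n k) \<le> (\<Sum>n<B. if n = 0 then 1 else 0)"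
        using k by (intro sum_mono) (simp add: init)
      also have "\<dots> \<le> 1" by (simp add: sum.delta')
      finally show ?thesis using one k by simp
    next
      assume "B \<le> k"
      then have "(\<Sum>n<B. z e ^ n * X l n k) = 0" by (intro sum.neutral) (auto simp: small)
      then show ?thesis using rhs[of k] by simp
    qed
  next
    case False
    then have B: "B = (B - k) + k" "B - k < B" by auto
    have "(\<Sum>n<B. z e ^ n * X l n k) = (\<Sum>n<B - k. z e ^ (n + k) * X l (n + k) k)"
    proof (rule sum.mono_neutral_cong_right[where g = "\<lambda>n. z e ^ n * X l n k" and S = "{k..<B}", THEN trans])
      show "(\<Sum>n\<in>{k..<B}. z e ^ n * X l n k) = (\<Sum>n<B - k. z e ^ (n + k) * X l (n + k) k)"
        using sum.shift_bounds_nat_ivl[of "\<lambda>n. z e ^ n * X l n k" 0 k "B - k"] B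
        by (simp add: atLeast0LessThan)
    qed (auto simp: small)
    also have "\<dots> = (\<Sum>n<B - k. z e ^ k * q ^ (Suc k choose 2)
        * parity_sum q (\<lambda>j. z e ^ n * X l n j) k)"
      by (simp only: zrec M_zero[OF order_refl] X_const[of "Suc l", simplified]) simp
    also have "\<dots> = z e ^ k * q ^ (Suc k choose 2) *
        parity_sum q (\<lambda>j. \<Sum>n<B - k. z e ^ n * X l n j) k"
      by (simp add: sum_distrib_left parity_sum_sum)
    also have "\<dots> \<le> z e ^ k * q ^ (Suc k choose 2) *
        parity_sum q (\<lambda>j. (1 - q) ^ e * qwt q (j + e)) k"
    proof (rule mult_left_mono)
      \<comment> \<open>The induction hypothesis covers even j only; as k is even, no other j
        contributes.\<close>
      have "parity_sum q (\<lambda>j. if even j then \<Sum>n<B - k. z e ^ n * X l n j else 0) k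
        \<le> parity_sum q (\<lambda>j. (1 - q) ^ e * qwt q (j + e)) k"
        using less.IH[OF B(2)] rhs by (intro parity_sum_mono) auto
      also have "parity_sum q (\<lambda>j. if even j then \<Sum>n<B - k. z e ^ n * X l n j else 0) k =
        parity_sum q (\<lambda>j. \<Sum>n<B - k. z e ^ n * X l n j) k"
        using less.prems by (intro parity_sum_cong) auto
      finally show "parity_sum q (\<lambda>j. \<Sum>n<B - k. z e ^ n * X l n j) k
        \<le> parity_sum q (\<lambda>j. (1 - q) ^ e * qwt q (j + e)) k" .
      show "z e ^ k * q ^ (Suc k choose 2) \<ge> 0" using zk q_pos by simp
    qed
    also have "\<dots> = (1 - q) ^ e * qwt q (k + e)"
      by (rule parity_sum_qwt_offset[OF less.prems e])
    finally show ?thesis .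
  qed
qed

lemma rec_sums:
  assumes "\<And>j. j \<le> k \<Longrightarrow> even (k - j) \<Longrightarrow> (\<lambda>n. z e ^ n * X (Suc i) n j) sums s j"
  shows "(\<lambda>n. z e ^ n * X i n k) sums
    (z e ^ k * q ^ (Suc k choose 2) * inverse q ^ (M i * k) * parity_sum q s k)"
proof -
  have "(\<lambda>n. z e ^ (n + k) * X i (n + k) k) sums
    (z e ^ k * q ^ (Suc k choose 2) * inverse q ^ (M i * k) * parity_sum q s k)"
    unfolding zrec by (intro sums_mult sums_parity_sum assms)
  then have "(\<lambda>n. z e ^ n * X i n k) sums
    (z e ^ k * q ^ (Suc k choose 2) * inverse q ^ (M i * k) * parity_sum q s k
      + (\<Sum>n<k. z e ^ n * X i n k))"
    by (subst (asm) sums_iff_shift)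
  moreover have "(\<Sum>n<k. z e ^ n * X i n k) = 0"
    by (intro sum.neutral) (simp add: small)
  ultimately show ?thesis by simp
qed

text \<open>The sums and the candidate satisfy the same fixed point equation. By induction on k
  their difference at k is \<open>c\<close> times itself, with c < 1 for k > 0.\<close>

lemma base_sums:
  assumes e: "e \<le> 1"
  shows "even k \<Longrightarrow> (\<lambda>n. z e ^ n * X l n k) sums ((1 - q) ^ e * qwt q (k + e))"
proof -
  have summ: "summable (\<lambda>n. z e ^ n * X l n k)" if "even k" for k
    using base_partial[OF e that] z_pos nonneg
    by (intro summableI_nonneg_bounded) (auto intro!: mult_nonneg_nonneg simp: less_imp_le)
  define x where "x k = (\<Sum>n. z e ^ n * X l n k)" for k
  define x' where "x' k = (1 - q) ^ e * qwt q (k + e)" for k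
  have x: "(\<lambda>n. z e ^ n * X l n k) sums x k" if "even k" for k
    using summ[OF that] unfolding x_def by (rule summable_sums)
  have fix_x: "x k = z e ^ k * q ^ (Suc k choose 2) * parity_sum q x k" if "even k" for k
  proof -
    have "(\<lambda>n. z e ^ n * X l n k) sums
      (z e ^ k * q ^ (Suc k choose 2) * inverse q ^ (M l * k) * parity_sum q x k)"
      using x that X_const[of "Suc l"] by (intro rec_sums) auto
    then show ?thesis using x[OF that] sums_unique2 by (fastforce simp: M_zero)
  qed
  have fix_x': "x' k = z e ^ k * q ^ (Suc k choose 2) * parity_sum q x' k" if "even k" for k
    unfolding x'_def by (rule parity_sum_qwt_offset[OF that e, symmetric])
  have "x k = x' k" if "even k" for k
    using that
  proof (induction k rule: less_induct)
    case (less k)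
    show ?case
    proof (cases "k = 0")
      case True
      have "(\<lambda>n. z e ^ n * X l n 0) sums 1"
        using sums_single[of 0 "\<lambda>_. 1::real"] by (simp add: init if_distrib cong: if_cong)
      moreover have "x' 0 = 1"
        using q_less_1 e by (cases e) (auto simp: x'_def qwt_def qfac_def numeral_2_eq_2)
      ultimately show ?thesis using x[of 0] True sums_unique2 by force
    next
      case False
      then have "k \<ge> 2" using less.prems by (cases "k = 1") auto
      define c where "c = z e ^ k * q ^ (Suc k choose 2)"
      have "(k + e) choose 2 > 0" using \<open>k \<ge> 2\<close> by simp
      then have "c < 1" unfolding c_def z_pow[OF e] by (rule pow_less_1)
      have eq: "x k - x' k = c * parity_sum q (\<lambda>j. x j - x' j) k"
        using fix_x[OF less.prems] fix_x'[OF less.prems]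
        by (simp add: parity_sum_diff c_def right_diff_distrib)
      have "parity_sum q (\<lambda>j. x j - x' j) k = (\<Sum>a\<in>{k}. (x a - x' a) / qfac (q\<^sup>2) ((k - a) div 2))"
        unfolding parity_sum_def
      proof (rule sum.mono_neutral_right)
        show "\<forall>i\<in>{a. a \<le> k \<and> even (k - a)} - {k}. (x i - x' i) / qfac (q\<^sup>2) ((k - i) div 2) = 0"
        proof
          fix i assume "i \<in> {a. a \<le> k \<and> even (k - a)} - {k}"
          then have "i < k" "even i" using less.prems by auto
          then show "(x i - x' i) / qfac (q\<^sup>2) ((k - i) div 2) = 0" using less.IH by simp
        qed
      qed auto
      with eq have "(1 - c) * (x k - x' k) = 0" by (simp add: left_diff_distrib)
      then show ?thesis using \<open>c < 1\<close> by simp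
    qed
  qed
  then show "even k \<Longrightarrow> (\<lambda>n. z e ^ n * X l n k) sums ((1 - q) ^ e * qwt q (k + e))"
    using x x'_def by fastforce
qed

text \<open>The induction runs downwards from \<open>l\<close>. What matters is that a single
  polynomial serves all k and both e: e enters only through k + e and the constant
  \<open>C e i\<close>.\<close>

lemma level_sums:
  assumes "i \<le> l"
  shows "\<exists>P. degree P \<le> M i \<and> (\<forall>e\<le>1. \<forall>k. even k \<longrightarrow> (\<lambda>n. z e ^ n * X i n k) sums
    (C e i * (inverse q ^ (M i * (k + e)) * qwt q (k + e) * poly P (q ^ (k + e)))))"
  using assms
proof (induction i rule: inc_induct)
  case base
  show ?case
    by (rule exI[of _ 1]) (use base_sums M_zero[of l] in \<open>simp add: C_def\<close>)
next
  case (step i)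
  then obtain P where P: "degree P \<le> M (Suc i)" and S: "\<And>e k. e \<le> 1 \<Longrightarrow> even k \<Longrightarrow>
    (\<lambda>n. z e ^ n * X (Suc i) n k) sums
    (C e (Suc i) * (inverse q ^ (M (Suc i) * (k + e)) * qwt q (k + e) * poly P (q ^ (k + e))))"
    by blast
  obtain P' where P': "degree P' \<le> M (Suc i)" "\<And>n. parity_sum q
    (\<lambda>a. inverse q ^ (M (Suc i) * a) * qwt q a * poly P (q ^ a)) n = poly P' (q ^ n) / qfac q n"
    using parity_sum_poly[OF P] by blast
  have "(\<lambda>n. z e ^ n * X i n k) sums
    (C e i * (inverse q ^ (M i * (k + e)) * qwt q (k + e) * poly P' (q ^ (k + e))))"
    if e: "e \<le> 1" and k: "even k" for e k
  proof -
    have "(\<lambda>n. z e ^ n * X i n k) sums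
      (z e ^ k * q ^ (Suc k choose 2) * inverse q ^ (M i * k) * parity_sum q
        (\<lambda>k. C e (Suc i) * (inverse q ^ (M (Suc i) * (k + e)) * qwt q (k + e) * poly P (q ^ (k + e)))) k)"
      using k by (intro rec_sums S[OF e]) auto
    also have "parity_sum q (\<lambda>k. C e (Suc i) *
        (inverse q ^ (M (Suc i) * (k + e)) * qwt q (k + e) * poly P (q ^ (k + e)))) k =
      C e (Suc i) * (poly P' (q ^ (k + e)) / qfac q (k + e))"
      unfolding parity_sum_scale P'(2)[symmetric]
      by (subst parity_sum_offset[OF k e]) simp
    also have "z e ^ k * q ^ (Suc k choose 2) * inverse q ^ (M i * k) *
        (C e (Suc i) * (poly P' (q ^ (k + e)) / qfac q (k + e))) =
      C e (Suc i) * inverse q ^ (M i * k) * qwt q (k + e) * poly P' (q ^ (k + e))"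
      unfolding z_pow[OF e] by (simp add: qwt_def)
    \<comment> \<open>Passing from k to k + e in the exponent costs q^(e M i), the new factor in
      \<open>C e i\<close>.\<close>
    also have "C e (Suc i) * inverse q ^ (M i * k) = C e i * inverse q ^ (M i * (k + e))"
    proof -
      have "q ^ M i * inverse q ^ M i = 1" using q_pos by (simp flip: power_mult_distrib)
      moreover have "(\<Sum>i'\<in>{i..<l}. M i') = M i + (\<Sum>i'\<in>{Suc i..<l}. M i')"
        using step.hyps by (simp add: sum.atLeast_Suc_lessThan)
      moreover have "e = 0 \<or> e = 1" using e by auto
      moreover have "q ^ sum M {Suc i..<l} = q ^ (M i + sum M {Suc i..<l}) * inverse q ^ M i"
        using \<open>q ^ M i * inverse q ^ M i = 1\<close> by (simp add: power_add mult.commute[of _ "inverse q ^ M i"] flip: mult.assoc)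
      ultimately show ?thesis by (auto simp: C_def power_add)
    qed
    finally show ?thesis by (simp add: mult.assoc)
  qed
  then show ?case using P' antimono[of i] by (intro exI[of _ P']) auto
qed

theorem average_sums:
  "\<exists>E. (\<lambda>n. inverse q ^ n * (\<Sum>k\<le>n. X 0 n k)) sums E
    \<and> (\<lambda>n. \<Sum>k\<le>n. X 0 n k) sums ((1 - q) * q ^ (\<Sum>i<l. M i) * E)"
proof -
  obtain P where P: "degree P \<le> M 0" and S: "\<And>e k. e \<le> 1 \<Longrightarrow> even k \<Longrightarrow>
    (\<lambda>n. z e ^ n * X 0 n k) sums
    (C e 0 * (inverse q ^ (M 0 * (k + e)) * qwt q (k + e) * poly P (q ^ (k + e))))"
    using level_sums[of 0] by blast
  define G where "G n = inverse q ^ (M 0 * n) * qwt q n * poly P (q ^ n)" for n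
  have abs: "summable (\<lambda>n. \<bar>G n\<bar>)" and alt: "(\<lambda>n. (- 1) ^ n * G n) sums 0"
    using alternating_sum_poly[OF P] by (simp_all add: G_def)
  have "summable G" using abs by (rule summable_rabs_cancel)
  \<comment> \<open>Since k is even, \<open>D 0\<close> carries the even part of \<open>G\<close>
    and \<open>D 1\<close> its odd part, indexed by the rank.\<close>
  define D where "D e k = (if even k then G (k + e) else 0)" for e k
  have D_sum: "summable (D e)" for e
  proof (rule summable_comparison_test')
    show "summable (\<lambda>k. \<bar>G (k + e)\<bar>)" using abs by (subst summable_iff_shift)
    show "norm (D e k) \<le> \<bar>G (k + e)\<bar>" for k by (simp add: D_def)
  qed
  have tot: "(\<lambda>n. z e ^ n * (\<Sum>k\<le>n. X 0 n k)) sums (C e 0 * suminf (D e))" if e: "e \<le> 1" for e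
    unfolding sum_distrib_left
  proof (rule sums_triangular_swap)
    show "z e ^ n * X 0 n k \<ge> 0" for n k using z_pos nonneg by (simp add: less_imp_le)
    show "(\<lambda>n. z e ^ n * X 0 n k) sums (C e 0 * D e k)" for k
      using S[OF e] odd_rank[of k 0] by (cases "even k") (simp_all add: D_def G_def)
    show "(\<lambda>k. C e 0 * D e k) sums (C e 0 * suminf (D e))"
      by (intro sums_mult summable_sums D_sum)
  qed (simp add: small)
  \<comment> \<open>Moving \<open>D 1\<close> by one place puts its values at odd positions;
    subtracting it from \<open>D 0\<close> gives the alternating series of \<open>G\<close>.\<close>
  have "(\<lambda>n. case n of 0 \<Rightarrow> 0 | Suc m \<Rightarrow> D 1 m) sums suminf (D 1)"
    using summable_sums[OF D_sum[of 1]]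
      sums_Suc_iff[of "\<lambda>n. case n of 0 \<Rightarrow> 0 | Suc m \<Rightarrow> D 1 m" "suminf (D 1)"] by simp
  then have "(\<lambda>n. D 0 n - (case n of 0 \<Rightarrow> 0 | Suc m \<Rightarrow> D 1 m)) sums (suminf (D 0) - suminf (D 1))"
    by (intro sums_diff summable_sums D_sum)
  moreover have "(\<lambda>n. D 0 n - (case n of 0 \<Rightarrow> 0 | Suc m \<Rightarrow> D 1 m)) = (\<lambda>n. (- 1) ^ n * G n)"
    by (rule ext) (auto simp: D_def split: nat.split)
  ultimately have "suminf (D 0) = suminf (D 1)" using alt sums_unique2 by force
  with tot[of 0] tot[of 1] show ?thesis
    by (auto simp: z_def C_def atLeast0LessThan)
qed

end

section \<open>Pairings and generating tuples\<close>

definition qz :: "rat \<Rightarrow> rat set"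
  where "qz x = \<int> #>\<^bsub>rat_group\<^esub> x"

lemma normal_Ints: "\<int> \<lhd> rat_group"
proof -
  interpret comm_group rat_group by (rule comm_group_rat_group)
  have inv: "inv\<^bsub>rat_group\<^esub> x = - x" for x
    by (rule inv_equality) (simp_all add: rat_group_def)
  have "subgroup \<int> rat_group"
  proof (rule subgroupI)
    show "\<int> \<subseteq> carrier rat_group" by (simp add: rat_group_def)
    show "(\<int> :: rat set) \<noteq> {}" using Ints_0 by blast
  qed (simp_all add: inv, simp add: rat_group_def)
  then show ?thesis by (rule subgroup_imp_normal)
qed

lemma qz_eq_Collect: "qz x = {z. z - x \<in> \<int>}"
proof -
  have "qz x = (\<lambda>h. h + x) ` \<int>"
    by (auto simp: qz_def r_coset_def rat_group_def)
  also have "\<dots> = {z. z - x \<in> \<int>}"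
    by (auto simp: image_iff algebra_simps) (metis add.commute diff_add_cancel)
  finally show ?thesis .
qed

lemma carrier_rat_mod_int: "carrier rat_mod_int = range qz"
  by (auto simp: rat_mod_int_def FactGroup_def RCOSETS_def qz_def rat_group_def)

lemma qz_in_carrier [simp]: "qz x \<in> carrier rat_mod_int"
  by (simp add: carrier_rat_mod_int)

lemma one_rat_mod_int: "\<one>\<^bsub>rat_mod_int\<^esub> = qz 0"
  by (simp add: qz_eq_Collect rat_mod_int_def FactGroup_def)

lemma qz_add: "qz x \<otimes>\<^bsub>rat_mod_int\<^esub> qz y = qz (x + y)"
proof -
  have "qz x <#>\<^bsub>rat_group\<^esub> qz y = qz (x \<otimes>\<^bsub>rat_group\<^esub> y)"
    unfolding qz_def by (rule normal.rcos_sum[OF normal_Ints]) (simp_all add: rat_group_def)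
  then show ?thesis by (simp add: rat_mod_int_def FactGroup_def rat_group_def)
qed

lemma qz_eq_iff: "qz x = qz y \<longleftrightarrow> x - y \<in> \<int>"
proof
  assume "qz x = qz y"
  moreover have "x \<in> qz x" by (simp add: qz_eq_Collect)
  ultimately show "x - y \<in> \<int>" by (simp add: qz_eq_Collect)
next
  assume "x - y \<in> \<int>"
  then have "z - x \<in> \<int> \<longleftrightarrow> z - y \<in> \<int>" for z
    by (metis Ints_add Ints_diff add_diff_cancel_left' diff_add_cancel diff_diff_eq2)
  then show "qz x = qz y" by (simp add: qz_eq_Collect)
qed

interpretation QZ: comm_group rat_mod_int by (rule comm_group_rat_mod_int)

lemma qz_pow: "qz x [^]\<^bsub>rat_mod_int\<^esub> (n::nat) = qz (of_nat n * x)"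
  by (induction n) (simp_all add: one_rat_mod_int qz_add distrib_right add.commute)

definition frac_qz :: "nat \<Rightarrow> int \<Rightarrow> rat set"
  where "frac_qz d z = qz (of_int z / of_nat d)"

lemma frac_qz_in_carrier [simp]: "frac_qz d z \<in> carrier rat_mod_int"
  by (simp add: frac_qz_def)

lemma frac_qz_add: "frac_qz d (z + w) = frac_qz d z \<otimes>\<^bsub>rat_mod_int\<^esub> frac_qz d w"
  by (simp add: frac_qz_def qz_add add_divide_distrib)

lemma frac_qz_0: "frac_qz d 0 = \<one>\<^bsub>rat_mod_int\<^esub>"
  by (simp add: frac_qz_def one_rat_mod_int)

lemma frac_qz_eq_iff:
  assumes "d > 0"
  shows "frac_qz d z = frac_qz d w \<longleftrightarrow> int d dvd z - w"
proof -
  have "frac_qz d z = frac_qz d w \<longleftrightarrow> (of_int (z - w) / of_nat d :: rat) \<in> \<int>"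
    by (simp add: frac_qz_def qz_eq_iff diff_divide_distrib)
  also have "\<dots> \<longleftrightarrow> (\<exists>k. (of_int (z - w) :: rat) = of_int (int d * k))"
    using assms by (auto simp: Ints_def field_simps)
  also have "\<dots> \<longleftrightarrow> int d dvd z - w"
    unfolding of_int_eq_iff by (auto simp: dvd_def)
  finally show ?thesis .
qed

lemma frac_qz_eq_one_iff: "d > 0 \<Longrightarrow> frac_qz d z = \<one>\<^bsub>rat_mod_int\<^esub> \<longleftrightarrow> int d dvd z"
  using frac_qz_eq_iff[of d z 0] by (simp add: frac_qz_0)

lemma frac_qz_mod: "d > 0 \<Longrightarrow> frac_qz d (z mod int d) = frac_qz d z"
  by (simp add: frac_qz_eq_iff mod_eq_dvd_iff[symmetric])

lemma pow_one_imp_frac_qz: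
  assumes "v \<in> carrier rat_mod_int" "v [^]\<^bsub>rat_mod_int\<^esub> d = \<one>\<^bsub>rat_mod_int\<^esub>" "d > 0"
  obtains z where "0 \<le> z" "z < int d" "v = frac_qz d z"
proof -
  from assms(1) obtain x where x: "v = qz x" by (auto simp: carrier_rat_mod_int)
  with assms(2) have "of_nat d * x \<in> \<int>"
    by (simp add: qz_pow one_rat_mod_int qz_eq_iff)
  then obtain w where "of_nat d * x = of_int w" by (auto elim: Ints_cases)
  with assms(3) have "x = of_int w / of_nat d" by (simp add: field_simps)
  with x have "v = frac_qz d (w mod int d)"
    using assms(3) by (simp add: frac_qz_mod) (simp add: frac_qz_def)
  with assms(3) show ?thesis by (intro that[of "w mod int d"]) auto
qed

context p_group_type_S
begin

lemma pairing_closed [simp]: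
  "x \<in> carrier G \<Longrightarrow> y \<in> carrier G \<Longrightarrow> pairing G x y \<in> carrier rat_mod_int"
  using pairing_hom_right by (auto simp: hom_def)

lemma pairing_mult_right: "x \<in> carrier G \<Longrightarrow> y \<in> carrier G \<Longrightarrow> z \<in> carrier G \<Longrightarrow>
    pairing G x (y \<otimes> z) = pairing G x y \<otimes>\<^bsub>rat_mod_int\<^esub> pairing G x z"
  using pairing_hom_right by (auto simp: hom_def)

lemma pairing_mult_left: "x \<in> carrier G \<Longrightarrow> y \<in> carrier G \<Longrightarrow> z \<in> carrier G \<Longrightarrow>
    pairing G (x \<otimes> y) z = pairing G x z \<otimes>\<^bsub>rat_mod_int\<^esub> pairing G y z"
  using pairing_hom_left by (auto simp: hom_def)

lemma pairing_group_hom_right: "x \<in> carrier G \<Longrightarrow> group_hom G rat_mod_int (pairing G x)"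
  using pairing_hom_right by unfold_locales (simp add: eta_contract_eq)

lemma pairing_group_hom_left: "y \<in> carrier G \<Longrightarrow> group_hom G rat_mod_int (\<lambda>x. pairing G x y)"
  using pairing_hom_left by unfold_locales

lemma pairing_one_right [simp]: "x \<in> carrier G \<Longrightarrow> pairing G x \<one> = \<one>\<^bsub>rat_mod_int\<^esub>"
  using group_hom.hom_one[OF pairing_group_hom_right] by blast

lemma pairing_one_left [simp]: "x \<in> carrier G \<Longrightarrow> pairing G \<one> x = \<one>\<^bsub>rat_mod_int\<^esub>"
  using group_hom.hom_one[OF pairing_group_hom_left] by blast

lemma pairing_inv_right:
  "x \<in> carrier G \<Longrightarrow> y \<in> carrier G \<Longrightarrow> pairing G x (inv y) = inv\<^bsub>rat_mod_int\<^esub> pairing G x y"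
  using group_hom.hom_inv[OF pairing_group_hom_right] by blast

lemma pairing_inv_left:
  "x \<in> carrier G \<Longrightarrow> y \<in> carrier G \<Longrightarrow> pairing G (inv x) y = inv\<^bsub>rat_mod_int\<^esub> pairing G x y"
  using group_hom.hom_inv[OF pairing_group_hom_left] by blast

lemma pairing_pow_left: "x \<in> carrier G \<Longrightarrow> y \<in> carrier G \<Longrightarrow>
    pairing G (x [^] (n::nat)) y = pairing G x y [^]\<^bsub>rat_mod_int\<^esub> n"
  using group_hom.hom_nat_pow[OF pairing_group_hom_left] by blast

lemma pairing_pow_right: "x \<in> carrier G \<Longrightarrow> y \<in> carrier G \<Longrightarrow>
    pairing G x (y [^] (n::nat)) = pairing G x y [^]\<^bsub>rat_mod_int\<^esub> n"
  using group_hom.hom_nat_pow[OF pairing_group_hom_right] by blast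

lemma pairing_swap:
  assumes "x \<in> carrier G" "y \<in> carrier G"
  shows "pairing G y x = inv\<^bsub>rat_mod_int\<^esub> pairing G x y"
proof -
  have "pairing G (x \<otimes> y) (x \<otimes> y) = pairing G x (x \<otimes> y) \<otimes>\<^bsub>rat_mod_int\<^esub> pairing G y (x \<otimes> y)"
    using assms by (simp add: pairing_mult_left)
  also have "\<dots> = pairing G x y \<otimes>\<^bsub>rat_mod_int\<^esub> pairing G y x"
    using assms by (simp add: pairing_mult_right pairing_alternating)
  finally have "pairing G y x \<otimes>\<^bsub>rat_mod_int\<^esub> pairing G x y = \<one>\<^bsub>rat_mod_int\<^esub>"
    using assms by (simp add: pairing_alternating QZ.m_comm)
  then show ?thesis using assms by (metis QZ.inv_equality pairing_closed)
qed

end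

section \<open>Generating tuples with a given matrix of pairings\<close>

definition gens :: "nat \<Rightarrow> ('a, 'b) monoid_scheme \<Rightarrow> (nat \<Rightarrow> 'a) set"
  where "gens r G = {x \<in> {..<r} \<rightarrow>\<^sub>E carrier G. generate G (x ` {..<r}) = carrier G}"

text \<open>The matrix is recorded in units of 1 / d and only above the diagonal; alternation and
  skew symmetry fix the other entries.\<close>

definition framed :: "nat \<Rightarrow> nat \<Rightarrow> ('a, 'b) type_S_scheme \<Rightarrow> (nat \<Rightarrow> 'a) \<Rightarrow> (nat \<times> nat \<Rightarrow> int) \<Rightarrow> bool"
  where "framed d r G x b \<longleftrightarrow> x \<in> gens r G \<and>
    (\<forall>j<r. \<forall>i<j. pairing G (x i) (x j) = frac_qz d (b (i, j)))"

lemma gensD: "x \<in> gens r G \<Longrightarrow> i < r \<Longrightarrow> x i \<in> carrier G"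
  by (auto simp: gens_def)

lemma gens_generate: "x \<in> gens r G \<Longrightarrow> generate G (x ` {..<r}) = carrier G"
  by (simp add: gens_def)

lemma framed_pairing_eq:
  assumes G: "p_group_type_S p G" and H: "p_group_type_S p H"
    and x: "framed d r G x b" and y: "framed d r H y b" and ij: "i < r" "j < r"
  shows "pairing G (x i) (x j) = pairing H (y i) (y j)"
proof -
  interpret G: p_group_type_S p G by fact
  interpret H: p_group_type_S p H by fact
  have c: "x i \<in> carrier G" "x j \<in> carrier G" "y i \<in> carrier H" "y j \<in> carrier H"
    using x y ij by (auto simp: framed_def intro: gensD)
  consider "i < j" | "i = j" | "j < i" by linarith
  then show ?thesis
  proof cases
    case 1 then show ?thesis using x y ij by (simp add: framed_def)
  next
    case 2 then show ?thesis using c by (simp add: G.pairing_alternating H.pairing_alternating)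
  next
    case 3
    then have "pairing G (x j) (x i) = pairing H (y j) (y i)" using x y ij by (simp add: framed_def)
    then show ?thesis using c G.pairing_swap[of "x j" "x i"] H.pairing_swap[of "y j" "y i"] by simp
  qed
qed

text \<open>The subgroup \<open>R\<close> of the direct product generated by the pairs (x i, y i) is
  the graph of the isomorphism. By bilinearity the two pairings agree on \<open>R\<close>, and
  nondegeneracy on either side makes \<open>R\<close> a graph in both directions.\<close>

lemma iso_S_of_gens:
  assumes G: "p_group_type_S p G" and H: "p_group_type_S p H"
    and x: "x \<in> gens r G" and y: "y \<in> gens r H"
    and eq: "\<And>i j. i < r \<Longrightarrow> j < r \<Longrightarrow> pairing G (x i) (x j) = pairing H (y i) (y j)"
  shows "\<exists>\<phi>\<in>iso_S G H. \<forall>i<r. \<phi> (x i) = y i"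
proof -
  interpret G: p_group_type_S p G by fact
  interpret H: p_group_type_S p H by fact
  let ?GH = "G \<times>\<times> H"
  interpret GH: group ?GH by (rule DirProd_group) unfold_locales
  define S where "S = (\<lambda>i. (x i, y i)) ` {..<r}"
  define R where "R = generate ?GH S"
  have S: "S \<subseteq> carrier ?GH" using x y by (auto simp: S_def intro: gensD)
  have R: "subgroup R ?GH" unfolding R_def by (rule GH.generate_is_subgroup[OF S])
  have Rc: "fst w \<in> carrier G" "snd w \<in> carrier H" if "w \<in> R" for w
    using subgroup.subset[OF R] that by auto
  have S_pair: "pairing G (fst w) (x j) = pairing H (snd w) (y j)" if "w \<in> R" "j < r" for w j
    using that(1) unfolding R_def
  proof (induction rule: generate.induct)
    case one then show ?case using gensD[OF x that(2)] gensD[OF y that(2)] by simp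
  next
    case (incl h) then show ?case using eq that(2) by (auto simp: S_def)
  next
    case (inv h)
    then obtain i where i: "i < r" "h = (x i, y i)" by (auto simp: S_def)
    then have "inv\<^bsub>?GH\<^esub> h = (inv\<^bsub>G\<^esub> x i, inv\<^bsub>H\<^esub> y i)"
      using gensD[OF x] gensD[OF y] by (simp add: inv_DirProd[OF G.is_group H.is_group])
    then show ?case using eq[OF i(1) that(2)] i gensD[OF x] gensD[OF y] that(2)
      by (simp add: G.pairing_inv_left H.pairing_inv_left)
  next
    case (eng h1 h2)
    then have "h1 \<in> R" "h2 \<in> R" by (auto simp: R_def)
    then show ?case using eng.IH Rc gensD[OF x that(2)] gensD[OF y that(2)]
      by (simp add: mult_DirProd' G.pairing_mult_left H.pairing_mult_left)
  qed
  have R_pair: "pairing G (fst v) (fst w) = pairing H (snd v) (snd w)" if v: "v \<in> R" and w: "w \<in> R" for v w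
    using w unfolding R_def
  proof (induction rule: generate.induct)
    case one then show ?case using Rc[OF v] by simp
  next
    case (incl h) then show ?case using S_pair[OF v] by (auto simp: S_def)
  next
    case (inv h)
    then obtain i where i: "i < r" "h = (x i, y i)" by (auto simp: S_def)
    then have "inv\<^bsub>?GH\<^esub> h = (inv\<^bsub>G\<^esub> x i, inv\<^bsub>H\<^esub> y i)"
      using gensD[OF x] gensD[OF y] by (simp add: inv_DirProd[OF G.is_group H.is_group])
    then show ?case using S_pair[OF v i(1)] i gensD[OF x] gensD[OF y] Rc[OF v]
      by (simp add: G.pairing_inv_right H.pairing_inv_right)
  next
    case (eng h1 h2)
    then have "h1 \<in> R" "h2 \<in> R" by (auto simp: R_def)
    then show ?case using eng.IH Rc Rc[OF v]
      by (simp add: mult_DirProd' G.pairing_mult_right H.pairing_mult_right)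
  qed
  have fst_R: "fst ` R = carrier G"
  proof -
    interpret f: group_hom ?GH G fst
      by unfold_locales (auto simp: hom_def mult_DirProd')
    have "fst ` R = generate G (fst ` S)" unfolding R_def by (rule f.generate_img[OF S, symmetric])
    also have "fst ` S = x ` {..<r}" by (auto simp: S_def image_image)
    finally show ?thesis using gens_generate[OF x] by simp
  qed
  have snd_R: "snd ` R = carrier H"
  proof -
    interpret f: group_hom ?GH H snd
      by unfold_locales (auto simp: hom_def mult_DirProd')
    have "snd ` R = generate H (snd ` S)" unfolding R_def by (rule f.generate_img[OF S, symmetric])
    also have "snd ` S = y ` {..<r}" by (auto simp: S_def image_image)
    finally show ?thesis using gens_generate[OF y] by simp
  qed
  have one: "fst w = \<one>\<^bsub>G\<^esub> \<longleftrightarrow> snd w = \<one>\<^bsub>H\<^esub>" if w: "w \<in> R" for w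
  proof
    assume *: "fst w = \<one>\<^bsub>G\<^esub>"
    show "snd w = \<one>\<^bsub>H\<^esub>"
    proof (rule H.pairing_nondegenerate)
      fix h assume "h \<in> carrier H"
      then obtain v where v: "v \<in> R" "h = snd v" using snd_R by (metis imageE)
      then show "pairing H (snd w) h = \<one>\<^bsub>rat_mod_int\<^esub>"
        using R_pair[OF w v(1)] * Rc[OF v(1)] by simp
    qed (use Rc w in auto)
  next
    assume *: "snd w = \<one>\<^bsub>H\<^esub>"
    show "fst w = \<one>\<^bsub>G\<^esub>"
    proof (rule G.pairing_nondegenerate)
      fix h assume "h \<in> carrier G"
      then obtain v where v: "v \<in> R" "h = fst v" using fst_R by (metis imageE)
      then show "pairing G (fst w) h = \<one>\<^bsub>rat_mod_int\<^esub>"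
        using R_pair[OF w v(1)] * Rc[OF v(1)] by simp
    qed (use Rc w in auto)
  qed
  have uniq: "h = h'" if "(g, h) \<in> R" "(g, h') \<in> R" for g h h'
  proof -
    have c: "g \<in> carrier G" "h \<in> carrier H" "h' \<in> carrier H" using Rc that by force+
    have "(g, h) \<otimes>\<^bsub>?GH\<^esub> inv\<^bsub>?GH\<^esub> (g, h') \<in> R"
      using R that by (simp add: subgroup.m_closed subgroup.m_inv_closed)
    then have "(g \<otimes>\<^bsub>G\<^esub> inv\<^bsub>G\<^esub> g, h \<otimes>\<^bsub>H\<^esub> inv\<^bsub>H\<^esub> h') \<in> R"
      using c by (simp add: inv_DirProd[OF G.is_group H.is_group])
    from one[OF this] c have "h \<otimes>\<^bsub>H\<^esub> inv\<^bsub>H\<^esub> h' = \<one>\<^bsub>H\<^esub>" by simp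
    then show ?thesis using c by (metis H.inv_closed H.inv_equality H.inv_inv)
  qed
  define \<phi> where "\<phi> g = (THE h. (g, h) \<in> R)" for g
  have \<phi>: "\<phi> g = h" if "(g, h) \<in> R" for g h
    unfolding \<phi>_def using that uniq by blast
  have \<phi>R: "(g, \<phi> g) \<in> R" if "g \<in> carrier G" for g
    using that fst_R \<phi> by (metis imageE prod.collapse)
  have hom: "\<phi> \<in> hom G H"
  proof (rule homI)
    fix g assume "g \<in> carrier G" then show "\<phi> g \<in> carrier H" using Rc \<phi>R by force
  next
    fix g h assume gh: "g \<in> carrier G" "h \<in> carrier G"
    have "(g, \<phi> g) \<otimes>\<^bsub>?GH\<^esub> (h, \<phi> h) \<in> R"
      by (rule subgroup.m_closed[OF R \<phi>R[OF gh(1)] \<phi>R[OF gh(2)]])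
    then show "\<phi> (g \<otimes>\<^bsub>G\<^esub> h) = \<phi> g \<otimes>\<^bsub>H\<^esub> \<phi> h" by (intro \<phi>) simp
  qed
  interpret \<phi>: group_hom G H \<phi> by unfold_locales (rule hom)
  have "\<phi> \<in> iso G H"
  proof (subst \<phi>.iso_iff, intro conjI ballI impI subsetI)
    fix h assume "h \<in> carrier H"
    then obtain v where "v \<in> R" "h = snd v" using snd_R by (metis imageE)
    then have "\<phi> (fst v) = h" "fst v \<in> carrier G" using \<phi>[of "fst v" h] Rc by auto
    then show "h \<in> \<phi> ` carrier G" by blast
  next
    fix g assume "g \<in> carrier G" "\<phi> g = \<one>\<^bsub>H\<^esub>"
    then show "g = \<one>\<^bsub>G\<^esub>" using one[OF \<phi>R[of g]] by simp
  qed
  moreover have "pairing H (\<phi> g) (\<phi> h) = pairing G g h" if "g \<in> carrier G" "h \<in> carrier G" for g h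
    using R_pair[OF \<phi>R \<phi>R] that by simp
  ultimately have "\<phi> \<in> iso_S G H" by (simp add: iso_S_def)
  moreover have "\<phi> (x i) = y i" if "i < r" for i
    using that by (intro \<phi>) (auto simp: R_def S_def intro!: generate.incl)
  ultimately show ?thesis by blast
qed

lemma hom_eq_on_gens:
  assumes "group G" "group H" "\<phi> \<in> hom G H" "\<psi> \<in> hom G H" "x \<in> gens r G"
    and "\<And>i. i < r \<Longrightarrow> \<phi> (x i) = \<psi> (x i)" and "g \<in> carrier G"
  shows "\<phi> g = \<psi> g"
proof -
  interpret a: group_hom G H \<phi> using assms by (simp add: group_hom_def group_hom_axioms_def)
  interpret b: group_hom G H \<psi> using assms by (simp add: group_hom_def group_hom_axioms_def)
  have sub: "x ` {..<r} \<subseteq> carrier G" using assms(5) by (auto intro: gensD)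
  have "g \<in> generate G (x ` {..<r})" using assms(5,7) gens_generate by blast
  then show ?thesis
  proof (induction rule: generate.induct)
    case (inv h) then show ?case using sub assms(6) by (auto simp: a.hom_inv b.hom_inv subset_iff)
  next
    case (eng h1 h2)
    then show ?case using group.generate_in_carrier[OF assms(1) sub] by simp
  qed (use assms(6) in auto)
qed

lemma gens_image:
  assumes "group G" "group H" "\<phi> \<in> hom G H" "\<phi> ` carrier G = carrier H" "x \<in> gens r G"
  shows "(\<lambda>i\<in>{..<r}. \<phi> (x i)) \<in> gens r H"
proof -
  interpret a: group_hom G H \<phi> using assms by (simp add: group_hom_def group_hom_axioms_def)
  have sub: "x ` {..<r} \<subseteq> carrier G" using assms(5) by (auto intro: gensD)
  have "(\<lambda>i\<in>{..<r}. \<phi> (x i)) ` {..<r} = \<phi> ` (x ` {..<r})" by auto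
  then have "generate H ((\<lambda>i\<in>{..<r}. \<phi> (x i)) ` {..<r}) = \<phi> ` generate G (x ` {..<r})"
    using a.generate_img[OF sub] by simp
  also have "\<dots> = carrier H"
    using assms(4,5) gens_generate[of x r G] by simp
  finally show ?thesis using gensD[OF assms(5)] by (auto simp: gens_def)
qed

text \<open>Automorphisms act simply transitively on the frames with a fixed matrix: freely because
  a frame generates, transitively by \<open>iso_S_of_gens\<close>.\<close>

lemma card_framed:
  assumes G: "p_group_type_S p G" and x: "framed d r G x b"
  shows "card {y. framed d r G y b} = card (auto_S G)"
proof -
  interpret G: p_group_type_S p G by fact
  have xg: "x \<in> gens r G" using x by (simp add: framed_def)
  have "bij_betw (\<lambda>\<phi>. \<lambda>i\<in>{..<r}. \<phi> (x i)) (auto_S G) {y. framed d r G y b}"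
  proof (intro bij_betwI' ballI)
    fix \<phi> \<psi> assume a: "\<phi> \<in> auto_S G" "\<psi> \<in> auto_S G"
    show "((\<lambda>i\<in>{..<r}. \<phi> (x i)) = (\<lambda>i\<in>{..<r}. \<psi> (x i))) = (\<phi> = \<psi>)"
    proof
      assume eq: "(\<lambda>i\<in>{..<r}. \<phi> (x i)) = (\<lambda>i\<in>{..<r}. \<psi> (x i))"
      have "\<phi> g = \<psi> g" if "g \<in> carrier G" for g
      proof (rule hom_eq_on_gens[OF G.is_group G.is_group _ _ xg _ that])
        show "\<phi> \<in> hom G G" "\<psi> \<in> hom G G" using a by (auto simp: auto_S_def auto_def)
        show "\<phi> (x i) = \<psi> (x i)" if "i < r" for i
          using fun_cong[OF eq, of i] that by simp
      qed
      moreover have "\<phi> \<in> extensional (carrier G)" "\<psi> \<in> extensional (carrier G)"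
        using a by (auto simp: auto_S_def auto_def Bij_def)
      ultimately show "\<phi> = \<psi>" by (metis extensionalityI)
    qed simp
  next
    fix \<phi> assume a: "\<phi> \<in> auto_S G"
    then have "\<phi> \<in> hom G G" "\<phi> ` carrier G = carrier G"
      by (auto simp: auto_S_def auto_def Bij_def bij_betw_def)
    from gens_image[OF G.is_group G.is_group this xg]
    show "(\<lambda>i\<in>{..<r}. \<phi> (x i)) \<in> {y. framed d r G y b}"
      using a x gensD[OF xg] by (auto simp: framed_def auto_S_def)
  next
    fix y assume "y \<in> {y. framed d r G y b}"
    then have y: "framed d r G y b" by simp
    then have yg: "y \<in> gens r G" by (simp add: framed_def)
    obtain \<phi> where \<phi>: "\<phi> \<in> iso_S G G" "\<And>i. i < r \<Longrightarrow> \<phi> (x i) = y i"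
      using iso_S_of_gens[OF G G xg yg framed_pairing_eq[OF G G x y]] by blast
    let ?\<phi> = "restrict \<phi> (carrier G)"
    have "?\<phi> \<in> auto_S G"
      using \<phi>(1) by (auto simp: iso_S_def auto_S_def auto_def iso_def hom_def Bij_def Pi_iff
        cong: bij_betw_cong)
    moreover have "y = (\<lambda>i\<in>{..<r}. ?\<phi> (x i))"
      using yg \<phi>(2) gensD[OF xg] by (auto simp: gens_def PiE_def extensional_def)
    ultimately show "\<exists>\<phi>\<in>auto_S G. y = (\<lambda>i\<in>{..<r}. \<phi> (x i))" by blast
  qed
  then show ?thesis by (simp add: bij_betw_same_card)
qed

section \<open>Counting generating tuples\<close>

lemma subset_generate: "A \<subseteq> generate G A"
  by (auto intro: generate.incl)

context comm_group
begin

text \<open>The elements h g^j with j < p exhaust the new subgroup, so its order is at most p times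
  that of H; both orders are powers of p and the inclusion is strict, so it is at least
  that.\<close>

lemma card_generate_insert:
  assumes p: "prime (p::nat)" and G: "finite (carrier G)" "order G = p ^ n"
    and H: "subgroup H G" and g: "g \<in> carrier G" "g \<notin> H" "g [^] p \<in> H"
  shows "card (generate G (insert g H)) = p * card H"
proof -
  have HG: "H \<subseteq> carrier G" by (rule subgroup.subset[OF H])
  have fin: "finite H" using HG G finite_subset by blast
  let ?K = "(\<lambda>(h, j). h \<otimes> g [^] (j::nat)) ` (H \<times> {..<p})"
  let ?L = "generate G (insert g H)"
  have L: "subgroup ?L G" using g HG by (intro generate_is_subgroup) auto
  have "subgroup {h \<otimes> g [^] (j::int) | h j. h \<in> H} G"
  proof (rule subgroupI)
    show "{h \<otimes> g [^] (j::int) | h j. h \<in> H} \<subseteq> carrier G" using HG g by auto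
    show "{h \<otimes> g [^] (j::int) | h j. h \<in> H} \<noteq> {}" using subgroup.one_closed[OF H] by auto
  next
    fix a assume "a \<in> {h \<otimes> g [^] (j::int) | h j. h \<in> H}"
    then obtain h j where "a = h \<otimes> g [^] (j::int)" "h \<in> H" by auto
    then have "inv a = inv h \<otimes> g [^] (- j)" "inv h \<in> H"
      using HG g subgroup.m_inv_closed[OF H] by (auto simp: inv_mult int_pow_neg)
    then show "inv a \<in> {h \<otimes> g [^] (j::int) | h j. h \<in> H}" by blast
  next
    fix a b assume "a \<in> {h \<otimes> g [^] (j::int) | h j. h \<in> H}" "b \<in> {h \<otimes> g [^] (j::int) | h j. h \<in> H}"
    then obtain h j h' j' where "a = h \<otimes> g [^] (j::int)" "h \<in> H" "b = h' \<otimes> g [^] (j'::int)" "h' \<in> H" by auto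
    moreover from this have "h \<in> carrier G" "h' \<in> carrier G" using HG by auto
    ultimately have "a \<otimes> b = (h \<otimes> h') \<otimes> g [^] (j + j')" "h \<otimes> h' \<in> H"
      using g subgroup.m_closed[OF H] by (auto simp: int_pow_mult m_ac)
    then show "a \<otimes> b \<in> {h \<otimes> g [^] (j::int) | h j. h \<in> H}" by blast
  qed
  then have "?L \<subseteq> {h \<otimes> g [^] (j::int) | h j. h \<in> H}"
  proof (rule generate_subgroup_incl[rotated], intro subsetI)
    fix a assume "a \<in> insert g H"
    then have "a = \<one> \<otimes> g [^] (1::int) \<or> a \<in> H \<and> a = a \<otimes> g [^] (0::int)" using g HG by auto
    then show "a \<in> {h \<otimes> g [^] (j::int) | h j. h \<in> H}" using subgroup.one_closed[OF H] by blast
  qed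
  also have "\<dots> \<subseteq> ?K"
  proof
    fix a assume "a \<in> {h \<otimes> g [^] (j::int) | h j. h \<in> H}"
    then obtain h j where a: "a = h \<otimes> g [^] (j::int)" "h \<in> H" by auto
    define i where "i = nat (j mod int p)"
    have i: "int i = j mod int p" "i < p" using prime_gt_0_nat[OF p] by (auto simp: i_def nat_less_iff)
    have "g [^] j = g [^] (int p * (j div int p) + int i)" using i by simp
    also have "\<dots> = (g [^] p) [^] (j div int p) \<otimes> g [^] i"
      using g by (simp add: int_pow_mult int_pow_pow[symmetric] int_pow_int)
    finally have "a = (h \<otimes> (g [^] p) [^] (j div int p)) \<otimes> g [^] i"
      using a g HG by (auto simp: m_assoc)
    moreover have "h \<otimes> (g [^] p) [^] (j div int p) \<in> H"
      using a g H by (intro subgroup.m_closed[OF H] subgroup_int_pow_closed) auto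
    ultimately show "a \<in> ?K" using i by force
  qed
  finally have "card ?L \<le> card ?K" using fin by (intro card_mono) auto
  also have "\<dots> \<le> card (H \<times> {..<p})" by (rule card_image_le) (use fin in auto)
  finally have le: "card ?L \<le> p * card H" by (simp add: card_cartesian_product mult.commute)
  have dvd: "\<exists>i. card K = p ^ i" if "subgroup K G" for K
    using lagrange[OF that] G divides_primepow_nat[OF p] by (metis dvd_triv_right)
  obtain i j where ij: "card H = p ^ i" "card ?L = p ^ j" using dvd[OF H] dvd[OF L] by blast
  have "finite ?L" using subgroup.subset[OF L] G finite_subset by blast
  moreover have "H \<subset> ?L" using g subset_generate[of "insert g H"] by auto
  ultimately have "card H < card ?L" by (rule psubset_card_mono)
  then have "i < j" using ij prime_gt_1_nat[OF p] by simp
  then have "p * card H \<le> card ?L"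
    using ij prime_gt_1_nat[OF p] power_increasing[of "Suc i" j p] by simp
  with le show ?thesis by simp
qed

lemma generate_Un_generate:
  assumes "A \<subseteq> carrier G" "B \<subseteq> carrier G"
  shows "generate G (generate G A \<union> B) = generate G (A \<union> B)"
proof
  have "subgroup (generate G (A \<union> B)) G" using assms by (intro generate_is_subgroup) auto
  moreover have "generate G A \<union> B \<subseteq> generate G (A \<union> B)"
    using mono_generate[of A "A \<union> B"] subset_generate[of "A \<union> B"] by blast
  ultimately show "generate G (generate G A \<union> B) \<subseteq> generate G (A \<union> B)"
    by (rule generate_subgroup_incl[rotated])
  show "generate G (A \<union> B) \<subseteq> generate G (generate G A \<union> B)"
    using subset_generate[of A] by (intro mono_generate) auto
qed

lemma generate_subgroup_eq: "subgroup H G \<Longrightarrow> generate G H = H"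
  using generate_subgroup_incl[of H H] subset_generate[of H] by auto

text \<open>G / H is a vector space of dimension k over the field with p elements, and spanning
  r-tuples are counted. The version relative to H allows an induction on r: a first vector in H
  leaves k unchanged, any other lowers it by one.\<close>

lemma card_relative_gens:
  assumes p: "prime (p::nat)" and G: "finite (carrier G)" "order G = p ^ n"
  shows "subgroup H G \<Longrightarrow> (\<And>x. x \<in> carrier G \<Longrightarrow> x [^] p \<in> H) \<Longrightarrow> order G = p ^ k * card H \<Longrightarrow>
    real (card {x \<in> {..<r} \<rightarrow>\<^sub>E carrier G. generate G (H \<union> x ` {..<r}) = carrier G}) =
      real (order G) ^ r * (\<Prod>i<k. 1 - real p ^ i / real p ^ r)"
proof (induction r arbitrary: H k)
  case 0
  have fin: "finite H" using subgroup.subset[OF 0(1)] G finite_subset by blast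
  show ?case
  proof (cases k)
    case 0
    then have "H = carrier G"
      using \<open>order G = p ^ k * card H\<close> subgroup.subset[OF \<open>subgroup H G\<close>] G
      by (intro card_subset_eq) (auto simp: order_def)
    then show ?thesis using 0 generate_subgroup_eq[OF \<open>subgroup H G\<close>] by simp
  next
    case (Suc k')
    have "H \<noteq> carrier G"
    proof
      assume "H = carrier G"
      then have "order G = card H" by (simp add: order_def)
      then have "p ^ k * card H = card H" using \<open>order G = p ^ k * card H\<close> by metis
      moreover have "card H > 0"
        using fin subgroup.one_closed[OF \<open>subgroup H G\<close>] by (auto simp: card_gt_0_iff)
      moreover have "p ^ k > 1" using Suc prime_gt_1_nat[OF p] by (intro one_less_power) auto
      ultimately show False by auto
    qed
    then show ?thesis using generate_subgroup_eq[OF \<open>subgroup H G\<close>] Suc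
      by (simp add: prod.lessThan_Suc_shift del: prod.lessThan_Suc)
  qed
next
  case (Suc r)
  have HG: "H \<subseteq> carrier G" by (rule subgroup.subset[OF Suc.prems(1)])
  have finH: "finite H" using HG G finite_subset by blast
  let ?S = "\<lambda>(r::nat) H. {x \<in> {..<r} \<rightarrow>\<^sub>E carrier G. generate G (H \<union> x ` {..<r}) = carrier G}"
  let ?Q = "\<lambda>r k. (\<Prod>i<k. 1 - real p ^ i / real p ^ r)"
  have finS: "finite (?S r K)" for r :: nat and K
    by (rule finite_subset[of _ "{..<r} \<rightarrow>\<^sub>E carrier G"]) (use G(1) in \<open>auto intro!: finite_PiE\<close>)
  have im: "x ` {..<Suc r} = insert (x r) (x ` {..<r})" for x :: "nat \<Rightarrow> 'a"
    by (auto simp: lessThan_Suc)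
  have "bij_betw (\<lambda>(g, x). x(r := g)) (SIGMA g:carrier G. ?S r (insert g H)) (?S (Suc r) H)"
  proof (rule bij_betwI')
    fix a b assume "a \<in> (SIGMA g:carrier G. ?S r (insert g H))" "b \<in> (SIGMA g:carrier G. ?S r (insert g H))"
    then obtain g x g' x' where ab: "a = (g, x)" "b = (g', x')"
      "x \<in> {..<r} \<rightarrow>\<^sub>E carrier G" "x' \<in> {..<r} \<rightarrow>\<^sub>E carrier G" by auto
    have "x = x'" if "x(r := g) = x'(r := g')"
    proof
      fix i show "x i = x' i"
        using fun_cong[OF that, of i] ab(3,4) by (cases "i = r") (auto simp: PiE_def extensional_def)
    qed
    then have "x(r := g) = x'(r := g') \<longleftrightarrow> g = g' \<and> x = x'" by (metis fun_upd_same)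
    then show "((\<lambda>(g, x). x(r := g)) a = (\<lambda>(g, x). x(r := g)) b) = (a = b)"
      using ab(1,2) by simp
  next
    fix a assume "a \<in> (SIGMA g:carrier G. ?S r (insert g H))"
    then obtain g x where ab: "a = (g, x)" "g \<in> carrier G" "x \<in> ?S r (insert g H)" by auto
    have "(x(r := g)) ` {..<r} = x ` {..<r}" by auto
    then have "H \<union> (x(r := g)) ` {..<Suc r} = insert g H \<union> x ` {..<r}" unfolding im by simp
    then show "(\<lambda>(g, x). x(r := g)) a \<in> ?S (Suc r) H"
      using ab by (auto simp: PiE_def extensional_def Pi_def less_Suc_eq)
  next
    fix y assume y: "y \<in> ?S (Suc r) H"
    let ?x = "restrict y {..<r}"
    have "?x ` {..<r} = y ` {..<r}" by auto
    then have "insert (y r) H \<union> ?x ` {..<r} = H \<union> y ` {..<Suc r}" unfolding im by simp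
    then have "(y r, ?x) \<in> (SIGMA g:carrier G. ?S r (insert g H))" using y by auto
    moreover have "y = ?x(r := y r)" using y by (auto simp: PiE_def extensional_def less_Suc_eq)
    ultimately show "\<exists>a\<in>(SIGMA g:carrier G. ?S r (insert g H)). y = (\<lambda>(g, x). x(r := g)) a"
      by (intro bexI[of _ "(y r, ?x)"]) auto
  qed
  then have "card (?S (Suc r) H) = card (SIGMA g:carrier G. ?S r (insert g H))"
    by (rule bij_betw_same_card[symmetric])
  also have "\<dots> = (\<Sum>g\<in>carrier G. card (?S r (insert g H)))"
    by (rule card_SigmaI[OF G(1)]) (use finS in blast)
  finally have "real (card (?S (Suc r) H)) = real (\<Sum>g\<in>carrier G. card (?S r (insert g H)))"
    by (rule arg_cong)
  also have "\<dots> = (\<Sum>g\<in>H. real (card (?S r (insert g H)))) +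
      (\<Sum>g\<in>carrier G - H. real (card (?S r (insert g H))))"
    using G(1) HG by (simp add: sum.subset_diff[of H "carrier G"] add.commute)
  also have "(\<Sum>g\<in>H. real (card (?S r (insert g H)))) = real (card H) * (real (order G) ^ r * ?Q r k)"
  proof -
    have "real (card (?S r (insert g H))) = real (order G) ^ r * ?Q r k" if "g \<in> H" for g
      using Suc.IH[OF Suc.prems] that by (simp add: insert_absorb)
    then show ?thesis by simp
  qed
  also have "(\<Sum>g\<in>carrier G - H. real (card (?S r (insert g H)))) =
      (real (order G) - real (card H)) * (real (order G) ^ r * ?Q r (k - 1))"
  proof -
    have "real (card (?S r (insert g H))) = real (order G) ^ r * ?Q r (k - 1)" if g: "g \<in> carrier G - H" for g
    proof -
      let ?H = "generate G (insert g H)"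
      have sub: "insert g H \<subseteq> carrier G" using g HG by auto
      have cH: "card ?H = p * card H"
        using g Suc.prems by (intro card_generate_insert[OF p G]) auto
      \<comment> \<open>So the truncated difference \<open>k - 1\<close> is a true one.\<close>
      have "k \<noteq> 0"
      proof
        assume "k = 0"
        then have "H = carrier G" using Suc.prems(3) HG G by (intro card_subset_eq) (auto simp: order_def)
        then show False using g by simp
      qed
      then have "order G = p ^ (k - 1) * card ?H"
        using Suc.prems(3) cH by (cases k) (auto simp: ac_simps)
      moreover have "subgroup ?H G" using sub by (rule generate_is_subgroup)
      moreover have "x [^] p \<in> ?H" if "x \<in> carrier G" for x
        using Suc.prems(2)[OF that] subset_generate[of "insert g H"] by auto
      ultimately have "real (card (?S r ?H)) = real (order G) ^ r * ?Q r (k - 1)"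
        by (intro Suc.IH) auto
      moreover have "?S r ?H = ?S r (insert g H)"
      proof (intro Collect_cong conj_cong refl)
        fix x assume "x \<in> {..<r} \<rightarrow>\<^sub>E carrier G"
        then have "x ` {..<r} \<subseteq> carrier G" by auto
        then show "(generate G (?H \<union> x ` {..<r}) = carrier G) = (generate G (insert g H \<union> x ` {..<r}) = carrier G)"
          by (simp only: generate_Un_generate[OF sub])
      qed
      ultimately show ?thesis by simp
    qed
    moreover have "real (card (carrier G - H)) = real (order G) - real (card H)"
      using HG G finH card_mono[OF G(1) HG] by (simp add: card_Diff_subset order_def of_nat_diff)
    ultimately show ?thesis by simp
  qed
  also have "real (card H) * (real (order G) ^ r * ?Q r k) +
      (real (order G) - real (card H)) * (real (order G) ^ r * ?Q r (k - 1)) =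
      real (order G) ^ Suc r * ?Q (Suc r) k"
  proof (cases k)
    case 0
    then show ?thesis using Suc.prems(3) by simp
  next
    case (Suc k')
    have p0: "real p > 0" using prime_gt_0_nat[OF p] by simp
    have "?Q (Suc r) (Suc k') = (1 - 1 / real p ^ Suc r) * (\<Prod>i<k'. 1 - real p ^ Suc i / real p ^ Suc r)"
      by (subst prod.lessThan_Suc_shift) simp
    also have "(\<Prod>i<k'. 1 - real p ^ Suc i / real p ^ Suc r) = ?Q r k'" using p0 by simp
    finally have Q: "?Q (Suc r) (Suc k') = (1 - 1 / real p ^ Suc r) * ?Q r k'" .
    have oG: "real (order G) = real p ^ Suc k' * real (card H)" using Suc.prems(3) Suc by simp
    have "card H * (real (order G) ^ r * (?Q r k' * (1 - real p ^ k' / real p ^ r))) +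
        (real (order G) - card H) * (real (order G) ^ r * ?Q r k') =
       real (order G) ^ r * ?Q r k' * (real (order G) - card H * (real p ^ k' / real p ^ r))"
      by (simp add: algebra_simps)
    also have "real (order G) - card H * (real p ^ k' / real p ^ r) = real (order G) * (1 - 1 / real p ^ Suc r)"
      unfolding oG using p0 by (simp add: field_simps)
    finally show ?thesis unfolding Suc Q by simp
  qed
  finally show ?case .
qed

lemma pow_hom: "(\<lambda>x. x [^] (n::nat)) \<in> hom G G"
  by (auto simp: hom_def nat_pow_distrib)

lemma pow_image_subgroup: "subgroup ((\<lambda>x. x [^] (n::nat)) ` carrier G) G"
proof -
  interpret h: group_hom G G "\<lambda>x. x [^] n" by unfold_locales (rule pow_hom)
  show ?thesis by (rule h.img_is_subgroup)
qed

text \<open>Nakayama's argument: if the subgroup T generated by X and the p-th powers together give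
  G, then iteration gives G from T and the p^j-th powers for all j, and those with j = n are
  trivial.\<close>

lemma generate_pow_image_Un:
  assumes G: "finite (carrier G)" "order G = p ^ n" and X: "X \<subseteq> carrier G"
  shows "generate G ((\<lambda>x. x [^] (p::nat)) ` carrier G \<union> X) = carrier G \<longleftrightarrow> generate G X = carrier G"
    (is "generate G (?P \<union> X) = _ \<longleftrightarrow> _")
proof
  assume a: "generate G X = carrier G"
  have "?P \<union> X \<subseteq> carrier G" using X by auto
  then show "generate G (?P \<union> X) = carrier G"
    using a mono_generate[of X "?P \<union> X"] generate_incl by blast
next
  assume a: "generate G (?P \<union> X) = carrier G"
  let ?T = "generate G X"
  have T: "subgroup ?T G" using X by (rule generate_is_subgroup)
  then have TG: "?T \<subseteq> carrier G" by (rule subgroup.subset)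
  have "subgroup (?T <#> ?P) G" by (rule mult_subgroups[OF T pow_image_subgroup])
  moreover have "?P \<union> X \<subseteq> ?T <#> ?P"
  proof -
    have "y \<in> ?T <#> ?P" if "y \<in> ?P" for y
      using that subgroup.one_closed[OF T] by (force simp: set_mult_def)
    moreover have "y \<in> ?T <#> ?P" if "y \<in> X" for y
      using that subgroup.one_closed[OF pow_image_subgroup[of p]] generate.incl[OF that, of G] X
      by (force simp: set_mult_def)
    ultimately show ?thesis by blast
  qed
  ultimately have sub: "carrier G \<subseteq> ?T <#> ?P" using generate_subgroup_incl a by blast
  have "\<exists>t\<in>?T. \<exists>y\<in>carrier G. x = t \<otimes> y [^] (p ^ j)" if x: "x \<in> carrier G" for x j
  proof (induction j)
    case 0
    show ?case using x subgroup.one_closed[OF T] by (intro bexI[of _ \<one>] bexI[of _ x]) auto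
  next
    case (Suc j)
    then obtain t y where ty: "t \<in> ?T" "y \<in> carrier G" "x = t \<otimes> y [^] (p ^ j)" by blast
    then obtain t' z where tz: "t' \<in> ?T" "z \<in> carrier G" "y = t' \<otimes> z [^] p"
      using sub by (auto simp: set_mult_def)
    have "t \<in> carrier G" "t' \<in> carrier G" using ty(1) tz(1) TG by auto
    then have "x = (t \<otimes> t' [^] (p ^ j)) \<otimes> z [^] (p ^ Suc j)"
      using ty(3) tz by (simp add: nat_pow_distrib nat_pow_pow m_assoc)
    moreover have "t \<otimes> t' [^] (p ^ j) \<in> ?T"
      using subgroup_int_pow_closed[OF T tz(1), of "int (p ^ j)"] ty(1)
      unfolding int_pow_int by (rule subgroup.m_closed[OF T, rotated])
    ultimately show ?case using tz(2) by blast
  qed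
  then have "x \<in> ?T" if "x \<in> carrier G" for x
    using that pow_order_eq_1 TG G(2) by (metis r_one subsetD)
  then show "?T = carrier G" using TG by blast
qed

text \<open>The fibres of the power map on S are cosets of the torsion subgroup. A general S is
  allowed because the lemma serves both for G and for a torsion subgroup of G.\<close>

lemma card_eq_image_times_torsion:
  assumes fin: "finite (carrier G)" and S: "S \<subseteq> carrier G"
    and cl: "\<And>x t. x \<in> S \<Longrightarrow> t \<in> torsion G n \<Longrightarrow> x \<otimes> t \<in> S"
  shows "card S = card ((\<lambda>x. x [^] (n::nat)) ` S) * card (torsion G n)"
proof -
  let ?f = "\<lambda>x. x [^] n"
  have finS: "finite S" using S fin finite_subset by blast
  have fib: "card {x \<in> S. ?f x = y} = card (torsion G n)" if "y \<in> ?f ` S" for y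
  proof -
    obtain x0 where x0: "x0 \<in> S" "y = ?f x0" using \<open>y \<in> ?f ` S\<close> by blast
    then have c: "x0 \<in> carrier G" using S by auto
    have "bij_betw (\<lambda>t. x0 \<otimes> t) (torsion G n) {x \<in> S. ?f x = y}"
    proof (rule bij_betwI')
      fix a b assume "a \<in> torsion G n" "b \<in> torsion G n"
      then show "(x0 \<otimes> a = x0 \<otimes> b) = (a = b)" using c by (auto simp: torsion_def)
    next
      fix a assume "a \<in> torsion G n"
      then show "x0 \<otimes> a \<in> {x \<in> S. ?f x = y}"
        using cl x0 c by (auto simp: torsion_def nat_pow_distrib)
    next
      fix x assume "x \<in> {x \<in> S. ?f x = y}"
      then have x: "x \<in> carrier G" "?f x = ?f x0" using S x0 by auto
      then have "inv x0 \<otimes> x \<in> torsion G n"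
        using c by (simp add: torsion_def nat_pow_distrib nat_pow_inv)
      moreover have "x = x0 \<otimes> (inv x0 \<otimes> x)" using x c by (simp add: m_assoc[symmetric])
      ultimately show "\<exists>t\<in>torsion G n. x = x0 \<otimes> t" by blast
    qed
    then show ?thesis by (simp add: bij_betw_same_card)
  qed
  have "card S = (\<Sum>y\<in>?f ` S. card {x \<in> S. ?f x = y})"
    using sum.group[of S "?f ` S" ?f "\<lambda>_. 1::nat"] finS by simp
  then show ?thesis using fib by simp
qed

lemma order_eq_image_times_torsion:
  assumes "finite (carrier G)"
  shows "order G = card ((\<lambda>x. x [^] (n::nat)) ` carrier G) * card (torsion G n)"
  unfolding order_def by (rule card_eq_image_times_torsion[OF assms]) (auto simp: torsion_def)

text \<open>The relative count with H the group of p-th powers, whose index equals |G[p]|.\<close>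

lemma card_gens:
  assumes p: "prime (p::nat)" and G: "finite (carrier G)" "order G = p ^ n"
    and k: "card (torsion G p) = p ^ k"
  shows "real (card (gens r G)) = real (order G) ^ r * (\<Prod>i<k. 1 - real p ^ i / real p ^ r)"
proof -
  let ?P = "(\<lambda>x. x [^] p) ` carrier G"
  have "gens r G = {x \<in> {..<r} \<rightarrow>\<^sub>E carrier G. generate G (?P \<union> x ` {..<r}) = carrier G}"
    unfolding gens_def
    by (intro Collect_cong conj_cong refl generate_pow_image_Un[OF G, symmetric]) auto
  moreover have "order G = p ^ k * card ?P"
    using order_eq_image_times_torsion[OF G(1), of p] k by simp
  ultimately show ?thesis
    using card_relative_gens[OF p G pow_image_subgroup[of p], of k r] by simp
qed

text \<open>Cauchy's theorem, drawn from Sylow's with exponent 1: a prime divisor of the order is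
  the order of an element.\<close>

lemma order_prime_power_if_exponent:
  assumes p: "prime (p::nat)" and fin: "finite (carrier G)"
    and ex: "\<And>x. x \<in> carrier G \<Longrightarrow> x [^] (p ^ N) = \<one>"
  shows "\<exists>n. order G = p ^ n"
proof -
  have pos: "order G \<noteq> 0" using fin order_gt_0_iff_finite by simp
  have "q = p" if q: "prime q" "q dvd order G" for q
  proof -
    obtain m where "order G = q ^ 1 * m" using q(2) by (auto elim: dvdE)
    from sylow_thm[OF q(1) is_group this fin] obtain H where H: "subgroup H G" "card H = q"
      by auto
    have "H \<noteq> {\<one>}" using H(2) prime_gt_1_nat[OF q(1)] by auto
    then obtain x where x: "x \<in> H" "x \<noteq> \<one>" using subgroup.one_closed[OF H(1)] by blast
    then have xc: "x \<in> carrier G" using subgroup.subset[OF H(1)] by auto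
    interpret HG: group "G\<lparr>carrier := H\<rparr>" by (rule subgroup.subgroup_is_group[OF H(1) is_group])
    have "x [^] q = \<one>"
      using HG.pow_order_eq_1[of x] x H(2) by (simp add: order_def nat_pow_consistent[symmetric])
    then have "ord x dvd q" using xc pow_eq_id by simp
    moreover have "ord x dvd p ^ N" using ex[OF xc] xc pow_eq_id by simp
    moreover have "ord x \<noteq> 1" using x(2) xc by (metis ord_eq_1)
    ultimately have "q dvd p ^ N" using q(1) by (metis prime_nat_iff)
    then show "q = p" using q(1) p by (metis prime_dvd_power primes_dvd_imp_eq)
  qed
  then have "prime_factors (order G) \<subseteq> {p}" by (auto simp: prime_factors_dvd)
  then have "order G = p ^ multiplicity p (order G)"
    using prime_factorization_nat[of "order G"] pos
    by (cases "prime_factors (order G) = {}") (auto simp: subset_singleton_iff prod.empty)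
  then show ?thesis by blast
qed

end

section \<open>Realising matrices, and the pairing on the multiples of p\<close>

lemma framedD:
  assumes "framed d r G x b"
  shows "x \<in> gens r G" "\<And>i j. i < j \<Longrightarrow> j < r \<Longrightarrow> pairing G (x i) (x j) = frac_qz d (b (i, j))"
  using assms by (auto simp: framed_def)

definition mats :: "nat \<Rightarrow> nat \<Rightarrow> (nat \<times> nat \<Rightarrow> int) set"
  where "mats r d = {(i, j). i < j \<and> j < r} \<rightarrow>\<^sub>E {0..<int d}"

lemma finite_index_pairs: "finite {(i, j). i < j \<and> j < (r::nat)}"
  by (rule finite_subset[of _ "{..<r} \<times> {..<r}"]) auto

lemma finite_mats: "finite (mats r d)"
  unfolding mats_def by (intro finite_PiE finite_index_pairs) auto

lemma card_index_pairs: "card {(i, j). i < j \<and> j < (r::nat)} = r choose 2"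
proof (induction r)
  case (Suc r)
  have "{(i, j). i < j \<and> j < Suc r} = {(i, j). i < j \<and> j < r} \<union> (\<lambda>i. (i, r)) ` {..<r}" by auto
  moreover have "{(i, j). i < j \<and> j < r} \<inter> (\<lambda>i. (i, r)) ` {..<r} = {}" by auto
  ultimately have "card {(i, j). i < j \<and> j < Suc r} = (r choose 2) + card ((\<lambda>i. (i, r)) ` {..<r})"
    using Suc finite_index_pairs by (simp add: card_Un_disjoint)
  then show ?case by (simp add: card_image inj_on_def numeral_2_eq_2)
qed simp

context p_group_type_S
begin

text \<open>p^N is a multiple of the group order and kills all values of the pairing, so these lie
  in (1 / p^N) Z / Z; entries between 0 and p^N make the matrix unique.\<close>

lemma exists_framed_matrix:
  assumes p: "prime p" and n: "order G = p ^ n" "n \<le> N" and x: "x \<in> gens r G"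
  shows "\<exists>!b. b \<in> mats r (p ^ N) \<and> framed (p ^ N) r G x b"
proof -
  have d: "p ^ N > 0" using prime_gt_0_nat[OF p] by simp
  have pow: "y [^] (p ^ N) = \<one>" if "y \<in> carrier G" for y
  proof -
    have "p ^ N = p ^ n * p ^ (N - n)" using n(2) by (simp flip: power_add)
    then show ?thesis using that pow_order_eq_1[of y] n(1) by (simp add: nat_pow_pow[symmetric])
  qed
  have "\<exists>z. 0 \<le> z \<and> z < int (p ^ N) \<and> pairing G (x i) (x j) = frac_qz (p ^ N) z" if "i < j" "j < r" for i j
  proof -
    have c: "x i \<in> carrier G" "x j \<in> carrier G" using that gensD[OF x] by auto
    then have "pairing G (x i) (x j) [^]\<^bsub>rat_mod_int\<^esub> (p ^ N) = \<one>\<^bsub>rat_mod_int\<^esub>"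
      by (simp add: pairing_pow_left[symmetric] pow)
    from pow_one_imp_frac_qz[OF pairing_closed[OF c] this d] show ?thesis by metis
  qed
  then obtain z where z: "\<And>i j. i < j \<Longrightarrow> j < r \<Longrightarrow> 0 \<le> z i j \<and> z i j < int (p ^ N) \<and>
    pairing G (x i) (x j) = frac_qz (p ^ N) (z i j)" by metis
  show ?thesis
  proof (rule ex1I)
    let ?b = "restrict (\<lambda>(i, j). z i j) {(i, j). i < j \<and> j < r}"
    have "?b \<in> mats r (p ^ N)"
      unfolding mats_def restrict_PiE_iff using z by auto
    moreover have "framed (p ^ N) r G x ?b"
      unfolding framed_def using x z by auto
    ultimately show "?b \<in> mats r (p ^ N) \<and> framed (p ^ N) r G x ?b" ..
    fix b assume b: "b \<in> mats r (p ^ N) \<and> framed (p ^ N) r G x b"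
    show "b = ?b"
    proof
      fix ij show "b ij = ?b ij"
      proof (cases "ij \<in> {(i, j). i < j \<and> j < r}")
        case True
        then obtain i j where ij: "ij = (i, j)" "i < j" "j < r" by auto
        have "frac_qz (p ^ N) (b ij) = frac_qz (p ^ N) (z i j)"
          using framedD(2)[of "p ^ N" r G x b i j] b z[OF ij(2,3)] ij by simp
        then have "int (p ^ N) dvd b ij - z i j" using d by (simp add: frac_qz_eq_iff)
        then have "b ij mod int (p ^ N) = z i j mod int (p ^ N)" by (simp only: mod_eq_dvd_iff)
        moreover have "b ij \<in> {0..<int (p ^ N)}" using b True unfolding mats_def by blast
        then have "b ij mod int (p ^ N) = b ij" by (intro mod_pos_pos_trivial) simp_all
        moreover have "z i j mod int (p ^ N) = z i j"
          using z[OF ij(2,3)] by (intro mod_pos_pos_trivial) simp_all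
        ultimately have "b ij = z i j" by (simp only:)
        then show ?thesis using ij by simp
      next
        case False
        then show ?thesis using b by (auto simp: mats_def PiE_def extensional_def)
      qed
    qed
  qed
qed

end

text \<open>The matrix defines an alternating form \<open>om\<close> on Z^r with values modulo d.
  Dividing by its radical gives a nondegenerate form on a finite group, and the unit vectors
  generate.\<close>

lemma exists_framed:
  assumes p: "prime p"
  shows "\<exists>(G :: nat type_S) x. p_group_type_S p G \<and> framed (p ^ N) r G x b"
proof -
  define d where "d = p ^ N"
  have d: "d > 0" using prime_gt_0_nat[OF p] by (simp add: d_def)
  define om :: "(nat \<Rightarrow> int) \<Rightarrow> (nat \<Rightarrow> int) \<Rightarrow> int"
    where "om a c = (\<Sum>j<r. \<Sum>i<j. b (i, j) * (a i * c j - a j * c i))" for a c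
  have om_add: "om (\<lambda>i. a i + a' i) c = om a c + om a' c" for a a' c
    by (simp add: om_def sum.distrib[symmetric] algebra_simps)
  have om_swap: "om a c = - om c a" for a c
    by (simp add: om_def sum_negf[symmetric] algebra_simps)
  have om_alt: "om a a = 0" for a by (simp add: om_def mult.commute)
  have om_scale: "om (\<lambda>i. k * a i) c = k * om a c" for k a c
    by (simp add: om_def sum_distrib_left algebra_simps)
  have om_zero: "om (\<lambda>_. 0) c = 0" for c by (simp add: om_def)
  \<comment> \<open>The functional given by a; two vectors are congruent modulo the radical exactly
    if their functionals agree, so the range of \<open>key\<close> is the quotient.\<close>
  define key where "key a = (\<lambda>c. om a c mod int d)" for a
  have key_iff: "key a = key a' \<longleftrightarrow> (\<forall>c. int d dvd om a c - om a' c)" for a a'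
    by (auto simp: key_def fun_eq_iff mod_eq_dvd_iff)
  have key_cong: "key a = key a'" if "\<And>i. i < r \<Longrightarrow> int d dvd a i - a' i" for a a'
    unfolding key_iff
  proof
    fix c
    have "om a c - om a' c = (\<Sum>j<r. \<Sum>i<j. b (i, j) * ((a i - a' i) * c j - (a j - a' j) * c i))"
      unfolding om_def sum_subtractf[symmetric] by (intro sum.cong refl) (simp add: algebra_simps)
    also have "int d dvd \<dots>"
    proof (intro dvd_sum)
      fix j i assume "j \<in> {..<r}" "i \<in> {..<j}"
      then have "int d dvd a i - a' i" "int d dvd a j - a' j" using that by auto
      then show "int d dvd b (i, j) * ((a i - a' i) * c j - (a j - a' j) * c i)"
        by (rule dvd_mult[OF dvd_diff[OF dvd_mult2 dvd_mult2]])
    qed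
    finally show "int d dvd om a c - om a' c" .
  qed
  have "key a \<in> key ` ({..<r} \<rightarrow>\<^sub>E {0..<int d})" for a
  proof
    show "key a = key (\<lambda>i\<in>{..<r}. a i mod int d)"
      by (rule key_cong) (simp add: mod_eq_dvd_iff[symmetric])
    show "(\<lambda>i\<in>{..<r}. a i mod int d) \<in> {..<r} \<rightarrow>\<^sub>E {0..<int d}" using d by auto
  qed
  then have "range key \<subseteq> key ` ({..<r} \<rightarrow>\<^sub>E {0..<int d})" by (rule image_subsetI)
  moreover have "finite ({..<r} \<rightarrow>\<^sub>E {0..<int d})" by (rule finite_PiE) simp_all
  ultimately have "finite (range key)" by (metis finite_imageI finite_subset)
  from finite_imp_inj_to_nat_seg[OF this]
  \<comment> \<open>The quotient is transported into the natural numbers, where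
    \<open>groups_S\<close> lives.\<close>
  obtain h :: "((nat \<Rightarrow> int) \<Rightarrow> int) \<Rightarrow> nat" where h: "inj_on h (range key)" by metis
  define \<pi> where "\<pi> a = h (key a)" for a
  have \<pi>_iff: "\<pi> a = \<pi> a' \<longleftrightarrow> key a = key a'" for a a'
    using h by (auto simp: \<pi>_def inj_on_def)
  define \<rho> where "\<rho> n = (SOME a. \<pi> a = n)" for n
  have \<rho>: "key (\<rho> (\<pi> a)) = key a" for a
    unfolding \<pi>_iff[symmetric] \<rho>_def by (rule someI[of "\<lambda>a'. \<pi> a' = \<pi> a"]) (rule refl)
  have key_add: "key (\<lambda>i. a i + c i) = key (\<lambda>i. a' i + c' i)" if "key a = key a'" "key c = key c'" for a a' c c'
    using that unfolding key_iff om_add by (simp add: add_diff_add)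
  define G :: "nat type_S" where "G = \<lparr>carrier = range \<pi>, monoid.mult = (\<lambda>x y. \<pi> (\<lambda>i. \<rho> x i + \<rho> y i)),
    one = \<pi> (\<lambda>_. 0), pairing = (\<lambda>x y. frac_qz d (om (\<rho> x) (\<rho> y)))\<rparr>"
  have cG: "carrier G = range \<pi>" and oG: "\<one>\<^bsub>G\<^esub> = \<pi> (\<lambda>_. 0)" by (simp_all add: G_def)
  have mG: "\<pi> a \<otimes>\<^bsub>G\<^esub> \<pi> c = \<pi> (\<lambda>i. a i + c i)" for a c
    by (simp add: G_def \<pi>_iff) (rule key_add; rule \<rho>)
  have pG: "pairing G (\<pi> a) (\<pi> c) = frac_qz d (om a c)" for a c
  proof -
    have "int d dvd om (\<rho> (\<pi> a)) (\<rho> (\<pi> c)) - om a (\<rho> (\<pi> c))"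
      using \<rho>[of a] unfolding key_iff by blast
    moreover have "int d dvd om a (\<rho> (\<pi> c)) - om a c"
      using \<rho>[of c] unfolding key_iff om_swap[of a] by (simp add: dvd_diff_commute)
    ultimately have "int d dvd om (\<rho> (\<pi> a)) (\<rho> (\<pi> c)) - om a c"
      using dvd_add by fastforce
    then show ?thesis using d by (simp add: G_def frac_qz_eq_iff)
  qed
  interpret comm_group G
  proof (rule comm_groupI)
    fix x assume "x \<in> carrier G"
    then obtain a where "x = \<pi> a" by (auto simp: cG)
    then have "\<pi> (\<lambda>i. - a i) \<otimes>\<^bsub>G\<^esub> x = \<one>\<^bsub>G\<^esub>" by (simp add: mG oG)
    then show "\<exists>y\<in>carrier G. y \<otimes>\<^bsub>G\<^esub> x = \<one>\<^bsub>G\<^esub>" by (auto simp: cG)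
  qed (auto simp: cG mG oG add_ac)
  have fin: "finite (carrier G)"
    using \<open>finite (range key)\<close> unfolding cG \<pi>_def by (simp add: image_image[of h key, symmetric])
  have pw: "\<pi> a [^]\<^bsub>G\<^esub> (n::nat) = \<pi> (\<lambda>i. int n * a i)" for a n
    by (induction n) (simp_all add: oG mG distrib_right add.commute)
  have "\<exists>n. order G = p ^ n"
  proof (rule order_prime_power_if_exponent[OF p fin])
    fix x assume "x \<in> carrier G"
    then obtain a where "x = \<pi> a" by (auto simp: cG)
    then show "x [^]\<^bsub>G\<^esub> (p ^ N) = \<one>\<^bsub>G\<^esub>"
      unfolding d_def[symmetric] by (simp add: pw oG \<pi>_iff key_iff om_scale om_zero)
  qed
  then have type_S: "p_group_type_S p G"
  proof unfold_locales
    fix x assume "x \<in> carrier G"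
    then obtain a where x: "x = \<pi> a" by (auto simp: cG)
    show "(\<lambda>y. pairing G x y) \<in> hom G rat_mod_int"
      by (rule homI) (auto simp: cG x mG pG om_swap[of a] om_add frac_qz_add[symmetric])
    show "(\<lambda>y. pairing G y x) \<in> hom G rat_mod_int"
      by (rule homI) (auto simp: cG x mG pG om_add frac_qz_add)
    show "pairing G x x = \<one>\<^bsub>rat_mod_int\<^esub>"
      by (simp add: x pG om_alt frac_qz_0)
    assume nd: "\<And>y. y \<in> carrier G \<Longrightarrow> pairing G x y = \<one>\<^bsub>rat_mod_int\<^esub>"
    have "int d dvd om a c" for c
      using nd[of "\<pi> c"] d by (simp add: cG x pG frac_qz_eq_one_iff)
    then show "x = \<one>\<^bsub>G\<^esub>" by (simp add: x oG \<pi>_iff key_iff om_zero)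
  qed (rule fin)
  define e :: "nat \<Rightarrow> nat \<Rightarrow> int" where "e i = (\<lambda>j. if j = i then 1 else 0)" for i
  define x where "x = (\<lambda>i\<in>{..<r}. \<pi> (e i))"
  have xim: "x ` {..<r} \<subseteq> carrier G" by (auto simp: x_def cG)
  let ?T = "generate G (x ` {..<r})"
  have T: "subgroup ?T G" by (rule generate_is_subgroup[OF xim])
  have "\<pi> a \<in> ?T" for a
  proof -
    \<comment> \<open>Entries reduced modulo d are nonnegative, so natural powers of the generators
      build the vector coordinate by coordinate.\<close>
    define a' where "a' m = (\<lambda>i. if i < m then a i mod int d else 0)" for m
    have "\<pi> (a' m) \<in> ?T" if "m \<le> r" for m
      using that
    proof (induction m)
      case 0
      show ?case using subgroup.one_closed[OF T] by (simp add: a'_def oG)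
    next
      case (Suc m)
      have "\<pi> (e m) \<in> ?T" using Suc.prems by (intro generate.incl) (auto simp: x_def)
      then have "\<pi> (e m) [^]\<^bsub>G\<^esub> nat (a m mod int d) \<in> ?T"
        using subgroup_int_pow_closed[OF T, of _ "int (nat (a m mod int d))"] unfolding int_pow_int by blast
      then have "\<pi> (a' m) \<otimes>\<^bsub>G\<^esub> \<pi> (e m) [^]\<^bsub>G\<^esub> nat (a m mod int d) \<in> ?T"
        using Suc by (intro subgroup.m_closed[OF T]) auto
      moreover have "(\<lambda>i. a' m i + int (nat (a m mod int d)) * e m i) = a' (Suc m)"
        using d by (auto simp: a'_def e_def fun_eq_iff less_Suc_eq)
      ultimately show ?case by (simp add: pw mG)
    qed
    moreover have "\<pi> a = \<pi> (a' r)"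
      unfolding \<pi>_iff by (rule key_cong) (simp add: a'_def mod_eq_dvd_iff[symmetric])
    ultimately show ?thesis by simp
  qed
  then have "?T = carrier G" using subgroup.subset[OF T] by (auto simp: cG)
  then have gens: "x \<in> gens r G" by (auto simp: gens_def x_def cG)
  have "pairing G (x i) (x j) = frac_qz d (b (i, j))" if "i < j" "j < r" for i j
  proof -
    have "om (e i) (e j) = (\<Sum>j'<r. \<Sum>i'<j'. if j' = j \<and> i' = i then b (i, j) else 0)"
      unfolding om_def by (intro sum.cong refl) (use that in \<open>auto simp: e_def\<close>)
    also have "\<dots> = (\<Sum>j'<r. if j' = j then b (i, j) else 0)"
    proof (intro sum.cong refl)
      fix j'
      show "(\<Sum>i'<j'. if j' = j \<and> i' = i then b (i, j) else 0) = (if j' = j then b (i, j) else 0)"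
        using that by (cases "j' = j") auto
    qed
    also have "\<dots> = b (i, j)" using that by simp
    finally show ?thesis using that by (simp add: x_def pG)
  qed
  then have "framed d r G x b" using gens by (simp add: framed_def)
  with type_S show ?thesis unfolding d_def by blast
qed

text \<open>The choice of a p-th root of v does not matter: u is itself a p-th power, and p moves
  across the pairing (\<open>peel_pairing\<close>).\<close>

definition peel :: "nat \<Rightarrow> ('a, 'b) type_S_scheme \<Rightarrow> 'a type_S"
  where "peel p G = \<lparr>carrier = (\<lambda>x. x [^]\<^bsub>G\<^esub> p) ` carrier G, monoid.mult = monoid.mult G,
    one = one G, pairing = (\<lambda>u v. pairing G u (SOME y. y \<in> carrier G \<and> y [^]\<^bsub>G\<^esub> p = v))\<rparr>"

lemma peel_simps [simp]:
  "carrier (peel p G) = (\<lambda>x. x [^]\<^bsub>G\<^esub> p) ` carrier G"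
  "x \<otimes>\<^bsub>peel p G\<^esub> y = x \<otimes>\<^bsub>G\<^esub> y"
  "\<one>\<^bsub>peel p G\<^esub> = \<one>\<^bsub>G\<^esub>"
  by (simp_all add: peel_def)

lemma peel_pow: "x [^]\<^bsub>peel p G\<^esub> (n::nat) = x [^]\<^bsub>G\<^esub> n"
  by (induction n) simp_all

context p_group_type_S
begin

lemma peel_pairing:
  assumes "x \<in> carrier G" "y \<in> carrier G"
  shows "pairing (peel p G) (x [^] p) (y [^] p) = pairing G (x [^] p) y"
proof -
  define y' where "y' = (SOME z. z \<in> carrier G \<and> z [^] p = y [^] p)"
  have y': "y' \<in> carrier G \<and> y' [^] p = y [^] p"
    unfolding y'_def by (rule someI[of _ y]) (use assms in auto)
  then have "pairing G (x [^] p) y' = pairing G x (y [^] p)"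
    using assms by (metis pairing_pow_left pairing_pow_right)
  also have "\<dots> = pairing G (x [^] p) y" using assms by (simp add: pairing_pow_left pairing_pow_right)
  finally show ?thesis by (simp add: peel_def y'_def)
qed

lemma order_peel: "order G = order (peel p G) * card (torsion G p)"
  using order_eq_image_times_torsion[OF finite_carrier, of p] by (simp add: order_def)

lemma peel_type_S:
  assumes p: "prime p"
  shows "p_group_type_S p (peel p G)"
proof -
  interpret P: comm_group "peel p G"
  proof (rule comm_groupI)
    fix x assume "x \<in> carrier (peel p G)"
    then obtain a where a: "a \<in> carrier G" "x = a [^] p" by auto
    then have "(inv a) [^] p \<otimes> x = \<one>" by (simp add: nat_pow_inv)
    then show "\<exists>y\<in>carrier (peel p G). y \<otimes>\<^bsub>peel p G\<^esub> x = \<one>\<^bsub>peel p G\<^esub>" using a by auto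
  next
    fix x y assume "x \<in> carrier (peel p G)" "y \<in> carrier (peel p G)"
    then obtain a b where "a \<in> carrier G" "x = a [^] p" "b \<in> carrier G" "y = b [^] p" by auto
    then have "x \<otimes> y = (a \<otimes> b) [^] p" "a \<otimes> b \<in> carrier G" by (auto simp: nat_pow_distrib)
    then show "x \<otimes>\<^bsub>peel p G\<^esub> y \<in> carrier (peel p G)" by auto
  next
    show "\<one>\<^bsub>peel p G\<^esub> \<in> carrier (peel p G)" by (auto intro!: image_eqI[of _ _ \<one>])
  qed (auto simp: m_ac)
  show ?thesis
  proof unfold_locales
    show "finite (carrier (peel p G))" using finite_carrier by simp
    obtain n where "order G = p ^ n" using order_power by blast
    then have "order (peel p G) dvd p ^ n" using order_peel by (metis dvd_triv_left)
    then show "\<exists>n. order (peel p G) = p ^ n" using divides_primepow_nat[OF p] by blast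
  next
    fix x assume "x \<in> carrier (peel p G)"
    then obtain a where a: "a \<in> carrier G" "x = a [^] p" by auto
    show "(\<lambda>y. pairing (peel p G) x y) \<in> hom (peel p G) rat_mod_int"
    proof (rule homI)
      fix u v assume "u \<in> carrier (peel p G)" "v \<in> carrier (peel p G)"
      then obtain b c where bc: "b \<in> carrier G" "u = b [^] p" "c \<in> carrier G" "v = c [^] p" by auto
      then have "u \<otimes> v = (b \<otimes> c) [^] p" by (simp add: nat_pow_distrib)
      then show "pairing (peel p G) x (u \<otimes>\<^bsub>peel p G\<^esub> v) =
        pairing (peel p G) x u \<otimes>\<^bsub>rat_mod_int\<^esub> pairing (peel p G) x v"
        using a bc by (simp add: peel_pairing pairing_mult_right)
    qed (use a in \<open>auto simp: peel_pairing\<close>)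
    show "(\<lambda>y. pairing (peel p G) y x) \<in> hom (peel p G) rat_mod_int"
    proof (rule homI)
      fix u v assume "u \<in> carrier (peel p G)" "v \<in> carrier (peel p G)"
      then obtain b c where bc: "b \<in> carrier G" "u = b [^] p" "c \<in> carrier G" "v = c [^] p" by auto
      then have uv: "u \<otimes> v = (b \<otimes> c) [^] p" by (simp add: nat_pow_distrib)
      have "pairing (peel p G) ((b \<otimes> c) [^] p) (a [^] p) = pairing G ((b \<otimes> c) [^] p) a"
        using a bc by (simp add: peel_pairing)
      also have "\<dots> = pairing G (b [^] p) a \<otimes>\<^bsub>rat_mod_int\<^esub> pairing G (c [^] p) a"
        using a bc by (simp add: pairing_mult_left nat_pow_distrib)
      finally show "pairing (peel p G) (u \<otimes>\<^bsub>peel p G\<^esub> v) x =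
        pairing (peel p G) u x \<otimes>\<^bsub>rat_mod_int\<^esub> pairing (peel p G) v x"
        using a bc uv by (simp add: peel_pairing)
    qed (use a in \<open>auto simp: peel_pairing\<close>)
    show "pairing (peel p G) x x = \<one>\<^bsub>rat_mod_int\<^esub>"
      using a by (simp add: peel_pairing pairing_pow_left pairing_alternating)
    assume nd: "\<And>y. y \<in> carrier (peel p G) \<Longrightarrow> pairing (peel p G) x y = \<one>\<^bsub>rat_mod_int\<^esub>"
    have "x = \<one>"
    proof (rule pairing_nondegenerate)
      fix y assume "y \<in> carrier G"
      then show "pairing G x y = \<one>\<^bsub>rat_mod_int\<^esub>"
        using nd[of "y [^] p"] a by (simp add: peel_pairing)
    qed (use a in auto)
    then show "x = \<one>\<^bsub>peel p G\<^esub>" by simp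
  qed
qed

text \<open>The p-th power map sends G[p^(i+1)] onto the p^i-torsion of the group of p-th powers,
  with kernel G[p].\<close>

lemma card_torsion_Suc:
  "card (torsion G (p ^ Suc i)) = card (torsion (peel p G) (p ^ i)) * card (torsion G p)"
proof -
  have "torsion (peel p G) (p ^ i) = (\<lambda>x. x [^] p) ` torsion G (p ^ Suc i)"
    by (auto simp: torsion_def peel_pow nat_pow_pow)
  moreover have "card (torsion G (p ^ Suc i)) =
      card ((\<lambda>x. x [^] p) ` torsion G (p ^ Suc i)) * card (torsion G p)"
  proof (rule card_eq_image_times_torsion[OF finite_carrier])
    fix x t assume "x \<in> torsion G (p ^ Suc i)" "t \<in> torsion G p"
    then show "x \<otimes> t \<in> torsion G (p ^ Suc i)"
      by (auto simp: torsion_def nat_pow_distrib nat_pow_pow[symmetric])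
  qed (auto simp: torsion_def)
  ultimately show ?thesis by simp
qed

text \<open>The pairing values get multiplied by p, and p b / p^(N+1) = b / p^N: the integer entries
  stay and are only reduced modulo p^N.\<close>

lemma framed_peel:
  assumes p: "prime p" and x: "framed (p ^ Suc N) r G x b"
    and b': "\<And>i j. i < j \<Longrightarrow> j < r \<Longrightarrow> b' (i, j) = b (i, j) mod int (p ^ N)"
  shows "framed (p ^ N) r (peel p G) (\<lambda>i\<in>{..<r}. x i [^] p) b'"
proof -
  interpret P: p_group_type_S p "peel p G" by (rule peel_type_S[OF p])
  have xg: "x \<in> gens r G" using x by (simp add: framed_def)
  have p0: "p > 0" using prime_gt_0_nat[OF p] .
  have "(\<lambda>i\<in>{..<r}. x i [^] p) \<in> gens r (peel p G)"
    using xg by (intro gens_image[OF is_group P.is_group]) (auto simp: hom_def nat_pow_distrib)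
  moreover have "pairing (peel p G) (x i [^] p) (x j [^] p) = frac_qz (p ^ N) (b' (i, j))"
    if "i < j" "j < r" for i j
  proof -
    have c: "x i \<in> carrier G" "x j \<in> carrier G" using that gensD[OF xg] by auto
    then have "pairing (peel p G) (x i [^] p) (x j [^] p) = frac_qz (p ^ Suc N) (b (i, j)) [^]\<^bsub>rat_mod_int\<^esub> p"
      using framedD(2)[OF x that] by (simp add: peel_pairing pairing_pow_left)
    also have "\<dots> = frac_qz (p ^ N) (b (i, j))"
      using p0 by (simp add: frac_qz_def qz_pow)
    finally show ?thesis
      using p0 frac_qz_mod[of "p ^ N" "b (i, j)"] unfolding b'[OF that] by simp
  qed
  ultimately show ?thesis by (simp add: framed_def)
qed

end

lemma iso_S_card:
  assumes G: "p_group_type_S p G" and H: "p_group_type_S p H" and \<phi>: "\<phi> \<in> iso_S G H"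
  shows "order G = order H" "card (torsion G n) = card (torsion H n)"
proof -
  interpret G: p_group_type_S p G by fact
  interpret H: p_group_type_S p H by fact
  have iso: "\<phi> \<in> hom G H" "bij_betw \<phi> (carrier G) (carrier H)" using \<phi> by (auto simp: iso_S_def iso_def)
  interpret \<phi>: group_hom G H \<phi> by unfold_locales (rule iso)
  show "order G = order H" using bij_betw_same_card[OF iso(2)] by (simp add: order_def)
  have inj: "inj_on \<phi> (carrier G)" and im: "\<phi> ` carrier G = carrier H"
    using iso(2) by (auto simp: bij_betw_def)
  have one: "\<phi> x = \<one>\<^bsub>H\<^esub> \<longleftrightarrow> x = \<one>\<^bsub>G\<^esub>" if "x \<in> carrier G" for x
    using inj that inj_onD[OF inj, of x "\<one>\<^bsub>G\<^esub>"] by auto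
  have "\<phi> ` torsion G n = torsion H n"
  proof (intro equalityI subsetI)
    fix y assume "y \<in> torsion H n"
    then have y: "y \<in> carrier H" "y [^]\<^bsub>H\<^esub> n = \<one>\<^bsub>H\<^esub>" by (auto simp: torsion_def)
    then obtain x where x: "x \<in> carrier G" "y = \<phi> x" using im by (metis imageE)
    then have "\<phi> (x [^]\<^bsub>G\<^esub> n) = \<one>\<^bsub>H\<^esub>" using y by (simp add: \<phi>.hom_nat_pow)
    then have "x \<in> torsion G n" using one x by (simp add: torsion_def)
    then show "y \<in> \<phi> ` torsion G n" using x by blast
  qed (auto simp: torsion_def \<phi>.hom_nat_pow[symmetric])
  then show "card (torsion G n) = card (torsion H n)"
    using card_image[OF inj_on_subset[OF inj, of "torsion G n"]] by (auto simp: torsion_def)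
qed

lemma iso_S_peel:
  assumes G: "p_group_type_S p G" and H: "p_group_type_S p H" and \<phi>: "\<phi> \<in> iso_S G H"
  shows "\<phi> \<in> iso_S (peel p G) (peel p H)"
proof -
  interpret G: p_group_type_S p G by fact
  interpret H: p_group_type_S p H by fact
  have iso: "\<phi> \<in> hom G H" "bij_betw \<phi> (carrier G) (carrier H)" using \<phi> by (auto simp: iso_S_def iso_def)
  interpret \<phi>: group_hom G H \<phi> by unfold_locales (rule iso)
  have inj: "inj_on \<phi> (carrier G)" and im: "\<phi> ` carrier G = carrier H"
    using iso(2) by (auto simp: bij_betw_def)
  have "\<phi> ` carrier (peel p G) = (\<lambda>x. x [^]\<^bsub>H\<^esub> p) ` (\<phi> ` carrier G)"
    by (force simp: \<phi>.hom_nat_pow image_iff)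
  then have im': "\<phi> ` carrier (peel p G) = carrier (peel p H)" by (simp add: im)
  moreover have "inj_on \<phi> (carrier (peel p G))" by (rule inj_on_subset[OF inj]) auto
  moreover have "\<phi> \<in> hom (peel p G) (peel p H)"
    using im' by (auto simp: hom_def Pi_iff)
  moreover have "pairing (peel p H) (\<phi> u) (\<phi> v) = pairing (peel p G) u v"
    if uv: "u \<in> carrier (peel p G)" "v \<in> carrier (peel p G)" for u v
  proof -
    obtain a where a: "a \<in> carrier G" "u = a [^]\<^bsub>G\<^esub> p" using uv(1) by auto
    obtain b where b: "b \<in> carrier G" "v = b [^]\<^bsub>G\<^esub> p" using uv(2) by auto
    note ab = a b
    from ab have "pairing (peel p H) (\<phi> u) (\<phi> v) = pairing H (\<phi> (a [^]\<^bsub>G\<^esub> p)) (\<phi> b)"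
      by (simp add: \<phi>.hom_nat_pow H.peel_pairing)
    also have "\<dots> = pairing G (a [^]\<^bsub>G\<^esub> p) b" using \<phi> ab by (simp add: iso_S_def)
    finally show ?thesis using ab by (simp add: G.peel_pairing)
  qed
  ultimately show ?thesis by (simp add: iso_S_def iso_def bij_betw_def)
qed

section \<open>Sums over isomorphism classes\<close>

definition class_rep :: "nat type_S set \<Rightarrow> nat type_S"
  where "class_rep C = (SOME G. G \<in> C)"

definition class_sum :: "nat \<Rightarrow> nat \<Rightarrow> (nat type_S \<Rightarrow> real) \<Rightarrow> real"
  where "class_sum p n f = (\<Sum>C\<in>iso_classes_S p n. f (class_rep C) / real (card (auto_S (class_rep C))))"

definition iso_invariant :: "nat \<Rightarrow> (nat type_S \<Rightarrow> real) \<Rightarrow> bool"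
  where "iso_invariant p f \<longleftrightarrow> (\<forall>G H. p_group_type_S p G \<longrightarrow> p_group_type_S p H \<longrightarrow>
    iso_S G H \<noteq> {} \<longrightarrow> f G = f H)"

definition realize :: "nat \<Rightarrow> nat \<Rightarrow> nat \<Rightarrow> (nat \<times> nat \<Rightarrow> int) \<Rightarrow> nat type_S"
  where "realize p r N b = (SOME G. p_group_type_S p G \<and> (\<exists>x. framed (p ^ N) r G x b))"

lemma iso_invariantD:
  "iso_invariant p f \<Longrightarrow> p_group_type_S p G \<Longrightarrow> p_group_type_S p H \<Longrightarrow> iso_S G H \<noteq> {} \<Longrightarrow> f G = f H"
  by (auto simp: iso_invariant_def)

lemma class_rep_in_class:
  assumes "C \<in> iso_classes_S p n"
  shows "class_rep C \<in> groups_S p n" "C = iso_rel_S p n `` {class_rep C}"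
proof -
  obtain G where G: "G \<in> groups_S p n" "C = iso_rel_S p n `` {G}"
    using assms by (auto simp: iso_classes_S_def quotient_def)
  have "G \<in> C" using G equiv_class_self[OF equiv_iso_rel_S] by blast
  then have r: "class_rep C \<in> C" unfolding class_rep_def by (rule someI)
  then have "(G, class_rep C) \<in> iso_rel_S p n" using G by blast
  then show "C = iso_rel_S p n `` {class_rep C}" using G(2) equiv_class_eq[OF equiv_iso_rel_S] by blast
  show "class_rep C \<in> groups_S p n" using r G(2) by (auto simp: iso_rel_S_def)
qed

lemma class_rep_type_S: "C \<in> iso_classes_S p n \<Longrightarrow> p_group_type_S p (class_rep C)"
  and class_rep_order: "C \<in> iso_classes_S p n \<Longrightarrow> order (class_rep C) = p ^ n"
  using class_rep_in_class(1) by (auto simp: groups_S_def)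

lemma class_sum_cong:
  assumes "\<And>G. p_group_type_S p G \<Longrightarrow> order G = p ^ n \<Longrightarrow> f G = g G"
  shows "class_sum p n f = class_sum p n g"
  unfolding class_sum_def
  by (rule sum.cong[OF refl]) (simp add: assms class_rep_type_S class_rep_order)

lemma class_sum_scale: "class_sum p n (\<lambda>G. c * f G) = c * class_sum p n f"
  by (simp add: class_sum_def sum_distrib_left)

lemma class_sum_sum: "class_sum p n (\<lambda>G. \<Sum>j\<in>J. f j G) = (\<Sum>j\<in>J. class_sum p n (f j))"
  unfolding class_sum_def by (subst sum.swap) (simp add: sum_divide_distrib)

lemma class_sum_zero: "class_sum p n (\<lambda>_. 0) = 0"
  by (simp add: class_sum_def)

lemma class_sum_nonneg: "(\<And>G. f G \<ge> 0) \<Longrightarrow> class_sum p n f \<ge> 0"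
  unfolding class_sum_def by (intro sum_nonneg divide_nonneg_nonneg) auto

lemma framed_iso:
  assumes G: "p_group_type_S p G" and H: "p_group_type_S p H" and \<phi>: "\<phi> \<in> iso_S G H"
    and x: "framed d r G x b"
  shows "framed d r H (\<lambda>i\<in>{..<r}. \<phi> (x i)) b"
proof -
  interpret G: p_group_type_S p G by fact
  interpret H: p_group_type_S p H by fact
  have xg: "x \<in> gens r G" by (rule framedD(1)[OF x])
  have "\<phi> \<in> hom G H" "\<phi> ` carrier G = carrier H"
    using \<phi> by (auto simp: iso_S_def iso_def bij_betw_def)
  from gens_image[OF G.is_group H.is_group this xg]
  show ?thesis using \<phi> framedD(2)[OF x] gensD[OF xg] by (auto simp: framed_def iso_S_def)
qed

lemma iso_of_framed:
  assumes "p_group_type_S p G" "p_group_type_S p H" "framed d r G x b" "framed d r H y b"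
  shows "iso_S G H \<noteq> {}"
  using iso_S_of_gens[OF assms(1,2) framedD(1)[OF assms(3)] framedD(1)[OF assms(4)]
    framed_pairing_eq[OF assms]] by blast

lemma finite_framed:
  assumes "p_group_type_S p G"
  shows "finite (gens r G)" "finite {x. framed d r G x b}"
proof -
  interpret p_group_type_S p G by fact
  show "finite (gens r G)"
    by (rule finite_subset[of _ "{..<r} \<rightarrow>\<^sub>E carrier G"])
      (use finite_carrier in \<open>auto simp: gens_def intro!: finite_PiE\<close>)
  then show "finite {x. framed d r G x b}"
    by (rule rev_finite_subset) (auto simp: framed_def)
qed

lemma (in comm_group) gens_order_nonempty:
  assumes "finite (carrier G)"
  shows "gens (order G) G \<noteq> {}"
proof -
  obtain h where h: "bij_betw h {..<order G} (carrier G)"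
    using ex_bij_betw_nat_finite[OF assms] by (auto simp: order_def atLeast0LessThan)
  have "(restrict h {..<order G}) ` {..<order G} = carrier G"
    using h by (simp add: bij_betw_def)
  moreover have "generate G (carrier G) = carrier G" by (simp add: generate_subgroup_eq subgroup_self)
  ultimately have "restrict h {..<order G} \<in> gens (order G) G" by (auto simp: gens_def)
  then show ?thesis by blast
qed

locale prime_p =
  fixes p :: nat
  assumes prime: "prime p"
begin

lemma p_gt_1: "p > 1" using prime by (rule prime_gt_1_nat)

lemma realize:
  "p_group_type_S p (realize p r N b)" "\<exists>x. framed (p ^ N) r (realize p r N b) x b"
proof -
  have "p_group_type_S p (realize p r N b) \<and> (\<exists>x. framed (p ^ N) r (realize p r N b) x b)"
    unfolding realize_def by (rule someI_ex) (use exists_framed[OF prime] in blast)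
  then show "p_group_type_S p (realize p r N b)" "\<exists>x. framed (p ^ N) r (realize p r N b) x b"
    by blast+
qed

lemma class_eq_iff:
  assumes "C \<in> iso_classes_S p n"
  shows "iso_rel_S p n `` {G} = C \<and> G \<in> groups_S p n \<longleftrightarrow> G \<in> groups_S p n \<and> iso_S G (class_rep C) \<noteq> {}"
proof -
  note r = class_rep_in_class[OF assms]
  have "iso_rel_S p n `` {G} = C \<longleftrightarrow> (G, class_rep C) \<in> iso_rel_S p n" if "G \<in> groups_S p n"
    using r that eq_equiv_class_iff[OF equiv_iso_rel_S that r(1)] by metis
  then show ?thesis using r(1) by (auto simp: iso_rel_S_def)
qed

text \<open>The generating tuples are sorted by their matrix; a matrix occurs exactly if its
  realisation lies in the class C, and then its tuples number |Aut| by
  \<open>card_framed\<close>.\<close>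

lemma card_class_matrices:
  assumes C: "C \<in> iso_classes_S p n" and nN: "n \<le> N"
  shows "card (gens r (class_rep C)) = card {b \<in> mats r (p ^ N). realize p r N b \<in> groups_S p n
    \<and> iso_rel_S p n `` {realize p r N b} = C} * card (auto_S (class_rep C))"
proof -
  note S = class_rep_type_S[OF C] and o = class_rep_order[OF C]
  interpret p_group_type_S p "class_rep C" by (rule S)
  let ?B = "{b \<in> mats r (p ^ N). realize p r N b \<in> groups_S p n \<and> iso_rel_S p n `` {realize p r N b} = C}"
  have fin: "finite ?B" using finite_mats by auto
  have gens_eq: "gens r (class_rep C) = (\<Union>b\<in>?B. {x. framed (p ^ N) r (class_rep C) x b})"
  proof (intro equalityI subsetI)
    fix x assume "x \<in> gens r (class_rep C)"
    from exists_framed_matrix[OF prime o nN this]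
    obtain b where b: "b \<in> mats r (p ^ N)" "framed (p ^ N) r (class_rep C) x b" by blast
    obtain y where y: "framed (p ^ N) r (realize p r N b) y b" using realize(2) by blast
    have iso: "iso_S (realize p r N b) (class_rep C) \<noteq> {}"
      by (rule iso_of_framed[OF realize(1) S y b(2)])
    then have "realize p r N b \<in> groups_S p n"
      using realize(1) iso_S_card(1)[OF realize(1) S] o by (auto simp: groups_S_def)
    then show "x \<in> (\<Union>b\<in>?B. {x. framed (p ^ N) r (class_rep C) x b})"
      using b iso class_eq_iff[OF C] by blast
  qed (auto simp: framed_def)
  have "card (gens r (class_rep C)) = (\<Sum>b\<in>?B. card {x. framed (p ^ N) r (class_rep C) x b})"
    unfolding gens_eq
  proof (rule card_UN_disjoint[OF fin])
    show "\<forall>b\<in>?B. finite {x. framed (p ^ N) r (class_rep C) x b}" using finite_framed[OF S] by blast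
    show "\<forall>b\<in>?B. \<forall>b'\<in>?B. b \<noteq> b' \<longrightarrow>
      {x. framed (p ^ N) r (class_rep C) x b} \<inter> {x. framed (p ^ N) r (class_rep C) x b'} = {}"
    proof (intro ballI impI)
      fix b b' assume bb: "b \<in> ?B" "b' \<in> ?B" "b \<noteq> b'"
      show "{x. framed (p ^ N) r (class_rep C) x b} \<inter> {x. framed (p ^ N) r (class_rep C) x b'} = {}"
        using exists_framed_matrix[OF prime o nN, of _ r] bb by (auto dest: framedD(1))
    qed
  qed
  also have "\<dots> = (\<Sum>b\<in>?B. card (auto_S (class_rep C)))"
  proof (rule sum.cong[OF refl])
    fix b assume "b \<in> ?B"
    then have "iso_rel_S p n `` {realize p r N b} = C \<and> realize p r N b \<in> groups_S p n"
      by (simp only: mem_Collect_eq)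
    then have "iso_S (realize p r N b) (class_rep C) \<noteq> {}"
      by (rule iffD1[OF class_eq_iff[OF C], THEN conjunct2])
    then obtain \<phi> where \<phi>: "\<phi> \<in> iso_S (realize p r N b) (class_rep C)" by (meson all_not_in_conv)
    obtain y where y: "framed (p ^ N) r (realize p r N b) y b" using realize(2) by blast
    show "card {x. framed (p ^ N) r (class_rep C) x b} = card (auto_S (class_rep C))"
      by (rule card_framed[OF S framed_iso[OF realize(1) S \<phi> y]])
  qed
  finally show ?thesis by simp
qed

lemma card_auto_S_pos:
  assumes "p_group_type_S p (G :: nat type_S)"
  shows "card (auto_S G) > 0"
proof -
  interpret p_group_type_S p G by fact
  obtain x where x: "x \<in> gens (order G) G" using gens_order_nonempty[OF finite_carrier] by blast
  obtain n where n: "order G = p ^ n" using order_power by blast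
  obtain b where b: "framed (p ^ n) (order G) G x b"
    using exists_framed_matrix[OF prime n order_refl x] by blast
  have "card {y. framed (p ^ n) (order G) G y b} > 0"
    using finite_framed(2)[OF assms] b by (auto simp: card_gt_0_iff)
  then show ?thesis using card_framed[OF assms b] by simp
qed

text \<open>A group of order p^n is generated by its p^n elements, so every class is realised by one
  of finitely many matrices of that size.\<close>

lemma finite_iso_classes: "finite (iso_classes_S p n)"
proof -
  let ?r = "p ^ n"
  have "C \<in> (\<lambda>b. iso_rel_S p n `` {realize p ?r n b}) ` mats ?r (p ^ n)" if C: "C \<in> iso_classes_S p n" for C
  proof -
    interpret p_group_type_S p "class_rep C" by (rule class_rep_type_S[OF C])
    have "card (gens ?r (class_rep C)) \<noteq> 0"
      using gens_order_nonempty[OF finite_carrier] finite_framed(1)[OF class_rep_type_S[OF C]]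
      by (simp add: class_rep_order[OF C])
    then have "{b \<in> mats ?r (p ^ n). realize p ?r n b \<in> groups_S p n
      \<and> iso_rel_S p n `` {realize p ?r n b} = C} \<noteq> {}"
      using card_class_matrices[OF C order_refl, of ?r] by force
    then show ?thesis by blast
  qed
  then show ?thesis using finite_mats[of ?r "p ^ n"] by (meson finite_imageI finite_subset subsetI)
qed

text \<open>The passage from classes to matrices: the number of generating tuples divided by |Aut|
  is the number of matrices that realise the class.\<close>

lemma frame_sum:
  assumes f: "iso_invariant p f" and nN: "n \<le> N"
  shows "class_sum p n (\<lambda>G. real (card (gens r G)) * f G) =
    (\<Sum>b | b \<in> mats r (p ^ N) \<and> order (realize p r N b) = p ^ n. f (realize p r N b))"
proof -
  let ?R = "realize p r N"
  let ?B = "{b. b \<in> mats r (p ^ N) \<and> order (?R b) = p ^ n}"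
  have fin: "finite ?B" using finite_mats by auto
  have g: "?R b \<in> groups_S p n \<longleftrightarrow> order (?R b) = p ^ n" for b
    using realize(1) by (simp add: groups_S_def)
  let ?c = "\<lambda>b. iso_rel_S p n `` {?R b}"
  have "(\<Sum>b\<in>?B. f (?R b)) = (\<Sum>C\<in>iso_classes_S p n. \<Sum>b\<in>{b \<in> ?B. ?c b = C}. f (?R b))"
    by (rule sum.group[symmetric, OF fin finite_iso_classes])
      (auto simp: iso_classes_S_def g intro!: quotientI)
  also have "\<dots> = (\<Sum>C\<in>iso_classes_S p n. real (card (gens r (class_rep C))) * f (class_rep C) / real (card (auto_S (class_rep C))))"
  proof (rule sum.cong[OF refl])
    fix C assume C: "C \<in> iso_classes_S p n"
    have "(\<Sum>b\<in>{b \<in> ?B. ?c b = C}. f (?R b)) = (\<Sum>b\<in>{b \<in> ?B. ?c b = C}. f (class_rep C))"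
    proof (rule sum.cong[OF refl])
      fix b assume "b \<in> {b \<in> ?B. ?c b = C}"
      then have "?c b = C \<and> ?R b \<in> groups_S p n" by (simp only: mem_Collect_eq g)
      then have "iso_S (?R b) (class_rep C) \<noteq> {}"
        by (rule iffD1[OF class_eq_iff[OF C], THEN conjunct2])
      then show "f (?R b) = f (class_rep C)"
        by (rule iso_invariantD[OF f realize(1) class_rep_type_S[OF C]])
    qed
    also have "\<dots> = real (card {b \<in> ?B. ?c b = C}) * f (class_rep C)" by simp
    also have "real (card {b \<in> ?B. ?c b = C}) = real (card (gens r (class_rep C))) / real (card (auto_S (class_rep C)))"
    proof -
      have "{b \<in> ?B. ?c b = C} = {b \<in> mats r (p ^ N). ?R b \<in> groups_S p n \<and> ?c b = C}"
        using g by auto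
      then show ?thesis
        using card_auto_S_pos[OF class_rep_type_S[OF C]] by (simp only: card_class_matrices[OF C nN]) simp
    qed
    finally show "(\<Sum>b\<in>{b \<in> ?B. ?c b = C}. f (?R b)) =
      real (card (gens r (class_rep C))) * f (class_rep C) / real (card (auto_S (class_rep C)))" by simp
  qed
  finally show ?thesis by (simp add: class_sum_def)
qed

section \<open>Reduction of matrices and the step to p-th powers\<close>

definition reduce :: "nat \<Rightarrow> nat \<Rightarrow> (nat \<times> nat \<Rightarrow> int) \<Rightarrow> nat \<times> nat \<Rightarrow> int"
  where "reduce r N b = (\<lambda>ij\<in>{(i, j). i < j \<and> j < r}. b ij mod int (p ^ N))"

lemma reduce_in_mats: "reduce r N b \<in> mats r (p ^ N)"
  using p_gt_1 by (auto simp: reduce_def mats_def)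

lemma card_lifts: "0 \<le> w \<Longrightarrow> w < int d \<Longrightarrow> card {z \<in> {0..<int (p * d)}. z mod int d = w} = p"
proof -
  assume w: "0 \<le> w" "w < int d"
  have "bij_betw (\<lambda>k. w + int d * int k) {..<p} {z \<in> {0..<int (p * d)}. z mod int d = w}"
  proof (rule bij_betwI')
    fix k assume "k \<in> {..<p}"
    then have "w + int d * int k < int d + int d * int k" "int d * (int k + 1) \<le> int d * int p"
      using w by (auto intro!: mult_left_mono)
    then show "w + int d * int k \<in> {z \<in> {0..<int (p * d)}. z mod int d = w}"
      using w by (auto simp: algebra_simps)
  next
    fix z assume z: "z \<in> {z \<in> {0..<int (p * d)}. z mod int d = w}"
    then have "z = w + int d * (z div int d)" using div_mult_mod_eq[of z "int d"] by (simp add: algebra_simps)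
    moreover have "0 \<le> z div int d" using z w by (simp add: pos_imp_zdiv_nonneg_iff)
    moreover have "z div int d < int p"
    proof -
      have "int d * (z div int d) \<le> z" using calculation(1) w by linarith
      also have "z < int d * int p" using z by (simp add: mult.commute)
      finally show ?thesis using w by (simp add: mult_less_cancel_left)
    qed
    ultimately show "\<exists>k\<in>{..<p}. z = w + int d * int k"
      by (intro bexI[of _ "nat (z div int d)"]) (auto simp: nat_less_iff)
  qed (use w in auto)
  then show ?thesis using bij_betw_same_card by fastforce
qed

text \<open>Each of the r (r - 1) / 2 entries has p lifts from modulus p^N to modulus
  p^(N+1).\<close>

lemma sum_reduce:
  "(\<Sum>b\<in>mats r (p ^ Suc N). F (reduce r N b)) = real p ^ (r choose 2) * (\<Sum>b\<in>mats r (p ^ N). F b)"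
  for F :: "(nat \<times> nat \<Rightarrow> int) \<Rightarrow> real"
proof -
  let ?I = "{(i, j). i < j \<and> j < r}"
  have "(\<Sum>b\<in>mats r (p ^ Suc N). F (reduce r N b)) =
    (\<Sum>b'\<in>mats r (p ^ N). \<Sum>b\<in>{b \<in> mats r (p ^ Suc N). reduce r N b = b'}. F (reduce r N b))"
    by (rule sum.group[symmetric]) (auto simp: finite_mats reduce_in_mats)
  also have "\<dots> = (\<Sum>b'\<in>mats r (p ^ N). real p ^ (r choose 2) * F b')"
  proof (rule sum.cong[OF refl])
    fix b' assume b': "b' \<in> mats r (p ^ N)"
    have "{b \<in> mats r (p ^ Suc N). reduce r N b = b'} =
      (\<Pi>\<^sub>E ij\<in>?I. {z \<in> {0..<int (p * p ^ N)}. z mod int (p ^ N) = b' ij})"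
    proof (intro equalityI subsetI)
      fix b assume "b \<in> {b \<in> mats r (p ^ Suc N). reduce r N b = b'}"
      then show "b \<in> (\<Pi>\<^sub>E ij\<in>?I. {z \<in> {0..<int (p * p ^ N)}. z mod int (p ^ N) = b' ij})"
        by (auto simp: mats_def reduce_def PiE_def Pi_def)
    next
      fix b assume b: "b \<in> (\<Pi>\<^sub>E ij\<in>?I. {z \<in> {0..<int (p * p ^ N)}. z mod int (p ^ N) = b' ij})"
      have "reduce r N b ij = b' ij" for ij
      proof (cases "ij \<in> ?I")
        case True
        then have "b ij mod int (p ^ N) = b' ij" using PiE_mem[OF b True] by simp
        then show ?thesis using True by (simp add: reduce_def)
      next
        case False
        then have "b' ij = undefined" using b' unfolding mats_def by (rule PiE_arb[rotated])
        then show ?thesis using False by (simp add: reduce_def)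
      qed
      moreover have "b \<in> mats r (p ^ Suc N)" using b by (auto simp: mats_def PiE_def Pi_def)
      ultimately show "b \<in> {b \<in> mats r (p ^ Suc N). reduce r N b = b'}" by auto
    qed
    then have "card {b \<in> mats r (p ^ Suc N). reduce r N b = b'} =
      (\<Prod>ij\<in>?I. card {z \<in> {0..<int (p * p ^ N)}. z mod int (p ^ N) = b' ij})"
      by (simp only: card_PiE[OF finite_index_pairs])
    also have "\<dots> = (\<Prod>ij\<in>?I. p)"
      by (intro prod.cong refl card_lifts) (use b' in \<open>auto simp: mats_def PiE_def Pi_def\<close>)
    also have "\<dots> = p ^ (r choose 2)" by (simp add: card_index_pairs)
    finally have "real (card {b \<in> mats r (p ^ Suc N). reduce r N b = b'}) = real p ^ (r choose 2)" by simp
    moreover have "(\<Sum>b\<in>{b \<in> mats r (p ^ Suc N). reduce r N b = b'}. F (reduce r N b)) =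
      (\<Sum>b\<in>{b \<in> mats r (p ^ Suc N). reduce r N b = b'}. F b')"
      by (rule sum.cong) auto
    ultimately show "(\<Sum>b\<in>{b \<in> mats r (p ^ Suc N). reduce r N b = b'}. F (reduce r N b)) =
      real p ^ (r choose 2) * F b'" by simp
  qed
  finally show ?thesis by (simp add: sum_distrib_left)
qed

lemma iso_S_peel_realize:
  "iso_S (peel p (realize p r (Suc N) b)) (realize p r N (reduce r N b)) \<noteq> {}"
proof -
  let ?G = "realize p r (Suc N) b"
  interpret p_group_type_S p ?G by (rule realize(1))
  obtain x where x: "framed (p ^ Suc N) r ?G x b" using realize(2) by blast
  obtain y where y: "framed (p ^ N) r (realize p r N (reduce r N b)) y (reduce r N b)" using realize(2) by blast
  have "framed (p ^ N) r (peel p ?G) (\<lambda>i\<in>{..<r}. x i [^]\<^bsub>?G\<^esub> p) (reduce r N b)"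
    by (rule framed_peel[OF prime x]) (simp add: reduce_def)
  from iso_of_framed[OF peel_type_S[OF prime] realize(1) this y] show ?thesis .
qed

abbreviation rank_is :: "nat \<Rightarrow> nat type_S \<Rightarrow> bool"
  where "rank_is k G \<equiv> card (torsion G p) = p ^ k"

lemma rank_exists:
  assumes "p_group_type_S p G" "order G = p ^ n"
  shows "\<exists>k\<le>n. rank_is k G"
proof -
  interpret p_group_type_S p G by fact
  have "card (torsion G p) dvd p ^ n" using order_peel assms(2) by (metis dvd_triv_right)
  then show ?thesis using divides_primepow_nat[OF prime] by blast
qed

lemma p_power_eq_iff: "p ^ i = p ^ j \<longleftrightarrow> i = j"
  using p_gt_1 by simp

lemma card_gens_rank:
  assumes "p_group_type_S p G" "order G = p ^ n" "rank_is k G"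
  shows "real (card (gens r G)) = real p ^ (n * r) * (\<Prod>i<k. 1 - real p ^ i / real p ^ r)"
proof -
  interpret p_group_type_S p G by fact
  show ?thesis using card_gens[OF prime finite_carrier assms(2,3), of r] assms(2)
    by (simp add: power_mult)
qed

text \<open>For k > r the formula for the number of generating tuples contains the zero factor i =
  r.\<close>

lemma rank_le_gens:
  assumes "p_group_type_S p G" "rank_is k G" "gens r G \<noteq> {}"
  shows "k \<le> r"
proof (rule ccontr)
  assume "\<not> k \<le> r"
  then have "(\<Prod>i<k. 1 - real p ^ i / real p ^ r) = 0" using p_gt_1 by (intro prod_zero bexI[of _ r]) auto
  moreover obtain n where "order G = p ^ n" using assms(1) p_group_type_S.order_power by blast
  ultimately have "real (card (gens r G)) = 0"
    by (simp only: card_gens_rank[OF assms(1) _ assms(2)] mult_zero_right)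
  then have "card (gens r G) = 0" by simp
  then show False using finite_framed(1)[OF assms(1)] assms(3) by simp
qed

text \<open>Both sides are sums over matrices: the groups on the left come from matrices modulo
  p^(N+1), their groups of p-th powers from the reductions modulo p^N.\<close>

lemma peel_sum:
  assumes F: "iso_invariant p F"
  shows "(\<Sum>k\<le>r. class_sum p (n + k)
      (\<lambda>G. real (card (gens r G)) * (if rank_is k G then F (peel p G) else 0))) =
    real p ^ (r choose 2) * class_sum p n (\<lambda>G. real (card (gens r G)) * F G)"
proof -
  \<comment> \<open>Large enough for all orders p^(n+k) with k <= r.\<close>
  define N where "N = n + r"
  have inv: "iso_invariant p (\<lambda>G. if rank_is k G then F (peel p G) else 0)" for k
    unfolding iso_invariant_def
  proof (intro allI impI)
    fix G H :: "nat type_S"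
    assume G: "p_group_type_S p G" and H: "p_group_type_S p H" and ne: "iso_S G H \<noteq> {}"
    then obtain \<phi> where \<phi>: "\<phi> \<in> iso_S G H" by blast
    have "F (peel p G) = F (peel p H)"
      using iso_S_peel[OF G H \<phi>] G H by (intro iso_invariantD[OF F])
        (auto intro: p_group_type_S.peel_type_S[OF _ prime])
    then show "(if rank_is k G then F (peel p G) else 0) = (if rank_is k H then F (peel p H) else 0)"
      using iso_S_card(2)[OF G H \<phi>] by simp
  qed
  let ?R = "realize p r (Suc N)" and ?R' = "realize p r N"
  let ?f = "\<lambda>b. if order (?R' b) = p ^ n then F (?R' b) else 0"
  have "(\<Sum>k\<le>r. class_sum p (n + k)
      (\<lambda>G. real (card (gens r G)) * (if rank_is k G then F (peel p G) else 0))) =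
    (\<Sum>k\<le>r. \<Sum>b\<in>mats r (p ^ Suc N). if order (?R b) = p ^ (n + k) \<and> rank_is k (?R b) then F (peel p (?R b)) else 0)"
  proof (rule sum.cong[OF refl])
    fix k assume "k \<in> {..r}"
    then have "n + k \<le> Suc N" by (simp add: N_def)
    from frame_sum[OF inv this]
    have "class_sum p (n + k) (\<lambda>G. real (card (gens r G)) * (if rank_is k G then F (peel p G) else 0)) =
      (\<Sum>b | b \<in> mats r (p ^ Suc N) \<and> order (?R b) = p ^ (n + k). if rank_is k (?R b) then F (peel p (?R b)) else 0)" .
    also have "\<dots> = (\<Sum>b\<in>mats r (p ^ Suc N). if order (?R b) = p ^ (n + k) then
        (if rank_is k (?R b) then F (peel p (?R b)) else 0) else 0)"
      by (rule sum.inter_filter[OF finite_mats])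
    finally show "class_sum p (n + k) (\<lambda>G. real (card (gens r G)) * (if rank_is k G then F (peel p G) else 0)) =
      (\<Sum>b\<in>mats r (p ^ Suc N). if order (?R b) = p ^ (n + k) \<and> rank_is k (?R b) then F (peel p (?R b)) else 0)"
      by (simp only: if_if_eq_conj)
  qed
  also have "\<dots> = (\<Sum>b\<in>mats r (p ^ Suc N). \<Sum>k\<le>r. if order (?R b) = p ^ (n + k) \<and> rank_is k (?R b) then F (peel p (?R b)) else 0)"
    by (rule sum.swap)
  also have "\<dots> = (\<Sum>b\<in>mats r (p ^ Suc N). ?f (reduce r N b))"
  proof (rule sum.cong[OF refl])
    fix b
    interpret p_group_type_S p "?R b" by (rule realize(1))
    note P = peel_type_S[OF prime]
    obtain n0 where "order (?R b) = p ^ n0" using order_power by blast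
    then obtain k0 where k0: "rank_is k0 (?R b)" using rank_exists[OF realize(1)] by blast
    obtain x where "framed (p ^ Suc N) r (?R b) x b" using realize(2) by blast
    then have "k0 \<le> r" using rank_le_gens[OF realize(1) k0] framedD(1) by blast
    have o: "order (?R b) = order (peel p (?R b)) * p ^ k0" using order_peel k0 by simp
    obtain \<phi> where \<phi>: "\<phi> \<in> iso_S (peel p (?R b)) (?R' (reduce r N b))" using iso_S_peel_realize by blast
    \<comment> \<open>Each group has exactly one rank \<open>k0\<close>, and its order is p^(n + k0)
      exactly if its p-th powers form a group of order p^n.\<close>
    have "(\<Sum>k\<le>r. if order (?R b) = p ^ (n + k) \<and> rank_is k (?R b) then F (peel p (?R b)) else 0) =
      (\<Sum>k\<le>r. if k = k0 then (if order (?R b) = p ^ (n + k0) then F (peel p (?R b)) else 0) else 0)"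
      by (rule sum.cong) (auto simp: k0 p_power_eq_iff)
    also have "\<dots> = (if order (?R b) = p ^ (n + k0) then F (peel p (?R b)) else 0)"
      using \<open>k0 \<le> r\<close> by simp
    also have "\<dots> = (if order (peel p (?R b)) = p ^ n then F (peel p (?R b)) else 0)"
      using o p_gt_1 by (simp add: power_add)
    also have "\<dots> = ?f (reduce r N b)"
      using iso_S_card(1)[OF P realize(1) \<phi>] iso_invariantD[OF F P realize(1)] \<phi> by auto
    finally show "(\<Sum>k\<le>r. if order (?R b) = p ^ (n + k) \<and> rank_is k (?R b) then F (peel p (?R b)) else 0) =
      ?f (reduce r N b)" .
  qed
  also have "\<dots> = real p ^ (r choose 2) * (\<Sum>b\<in>mats r (p ^ N). ?f b)" by (rule sum_reduce)
  also have "(\<Sum>b\<in>mats r (p ^ N). ?f b) = class_sum p n (\<lambda>G. real (card (gens r G)) * F G)"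
    by (subst frame_sum[OF F, of n N r]) (simp_all add: N_def sum.inter_filter[OF finite_mats, symmetric])
  finally show ?thesis .
qed

section \<open>Sums over groups of fixed rank\<close>

definition rank_sum :: "nat \<Rightarrow> nat \<Rightarrow> (nat type_S \<Rightarrow> real) \<Rightarrow> real"
  where "rank_sum n k F = class_sum p n (\<lambda>G. if rank_is k G then F G else 0)"

lemma rank_sum_large: "n < k \<Longrightarrow> rank_sum n k F = 0"
proof -
  assume "n < k"
  have "rank_sum n k F = class_sum p n (\<lambda>_. 0)"
    unfolding rank_sum_def
  proof (rule class_sum_cong)
    fix G :: "nat type_S" assume "p_group_type_S p G" "order G = p ^ n"
    from rank_exists[OF this] \<open>n < k\<close> show "(if rank_is k G then F G else 0) = 0"
      by (auto simp: p_power_eq_iff)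
  qed
  then show ?thesis by (simp add: class_sum_zero)
qed

lemma class_sum_rank_sum: "class_sum p n F = (\<Sum>k\<le>n. rank_sum n k F)"
  unfolding rank_sum_def class_sum_sum[symmetric]
proof (rule class_sum_cong)
  fix G :: "nat type_S" assume "p_group_type_S p G" "order G = p ^ n"
  from rank_exists[OF this] obtain k where "k \<le> n" "rank_is k G" by blast
  then have "(\<Sum>j\<le>n. if rank_is j G then F G else 0) = (\<Sum>j\<le>n. if j = k then F G else 0)"
    by (intro sum.cong) (auto simp: p_power_eq_iff)
  with \<open>k \<le> n\<close> show "F G = (\<Sum>j\<le>n. if rank_is j G then F G else 0)" by simp
qed

lemma class_sum_gens_rank:
  "class_sum p n (\<lambda>G. real (card (gens r G)) * (if rank_is k G then F G else 0)) =
    real p ^ (n * r) * (\<Prod>i<k. 1 - real p ^ i / real p ^ r) * rank_sum n k F"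
  unfolding rank_sum_def class_sum_scale[symmetric]
  by (rule class_sum_cong) (simp add: card_gens_rank)

lemma q_param: "q_param (inverse (real p))"
  using p_gt_1 by unfold_locales (auto simp: field_simps)

interpretation Q: q_param "inverse (real p)" by (rule q_param)

lemma prod_eq_qfac:
  "(\<Prod>i<k. 1 - real p ^ i / real p ^ r) =
    (if k \<le> r then qfac (inverse (real p)) r / qfac (inverse (real p)) (r - k) else 0)"
proof (induction k)
  case 0 then show ?case by simp
next
  case (Suc k)
  show ?case
  proof (cases "Suc k \<le> r")
    case True
    then have r: "r - k = Suc (r - Suc k)" by simp
    have "real p ^ k / real p ^ r = inverse (real p) ^ Suc (r - Suc k)"
      unfolding r[symmetric] using True p_gt_1 by (simp add: power_diff power_inverse field_simps)
    then have "1 - real p ^ k / real p ^ r = 1 - inverse (real p) ^ Suc (r - Suc k)" by simp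
    moreover have "1 - inverse (real p) ^ Suc (r - Suc k) \<noteq> 0"
      using Q.pow_less_1[of "Suc (r - Suc k)"] by simp
    ultimately show ?thesis
      using Suc True r qfac_Suc[of "inverse (real p)" "r - Suc k"] by (simp del: power_Suc)
  next
    case False
    then have "k = r \<or> \<not> k \<le> r" by auto
    then show ?thesis using Suc False p_gt_1 by auto
  qed
qed

text \<open>For each r, \<open>peel_sum\<close> and the count of generating tuples give one
  equation; the common factor \<open>?c\<close> cancels and leaves the system of
  \<open>triangular_solve\<close>.\<close>

theorem rank_sum_peel:
  assumes F: "iso_invariant p F"
  shows "rank_sum (n + k) k (\<lambda>G. F (peel p G)) =
    inverse (real p) ^ (Suc k choose 2) * parity_sum (inverse (real p)) (\<lambda>j. rank_sum n j F) k"
proof (rule Q.triangular_solve)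
  fix r
  let ?q = "inverse (real p)" and ?Y = "\<lambda>k. rank_sum (n + k) k (\<lambda>G. F (peel p G))"
  let ?c = "real p ^ (n * r) * qfac ?q r"
  have cpos: "?c > 0" using p_gt_1 Q.qfac_pos by simp
  have "(\<Sum>k\<le>r. class_sum p (n + k)
      (\<lambda>G. real (card (gens r G)) * (if rank_is k G then F (peel p G) else 0))) =
     (\<Sum>k\<le>r. ?c * (real p ^ (k * r) * ?Y k / qfac ?q (r - k)))"
    by (rule sum.cong[OF refl])
      (simp add: class_sum_gens_rank[where F = "\<lambda>G. F (peel p G)"] prod_eq_qfac add_mult_distrib power_add)
  moreover have "class_sum p n (\<lambda>G. real (card (gens r G)) * F G) = ?c * (\<Sum>j\<le>r. rank_sum n j F / qfac ?q (r - j))"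
  proof -
    have "class_sum p n (\<lambda>G. real (card (gens r G)) * F G) =
      (\<Sum>j\<le>n. rank_sum n j (\<lambda>G. real (card (gens r G)) * F G))"
      by (rule class_sum_rank_sum)
    \<comment> \<open>A common range for j <= n and j <= r: ranks above n do not occur, and ranks
      above r admit no generating r-tuple.\<close>
    also have "\<dots> = (\<Sum>j\<le>n + r. rank_sum n j (\<lambda>G. real (card (gens r G)) * F G))"
      by (rule sum.mono_neutral_left) (auto simp: rank_sum_large)
    also have "\<dots> = (\<Sum>j\<le>n + r. real p ^ (n * r) * (\<Prod>i<j. 1 - real p ^ i / real p ^ r) * rank_sum n j F)"
      unfolding class_sum_gens_rank[symmetric] unfolding rank_sum_def
      by (intro sum.cong refl class_sum_cong) simp
    also have "\<dots> = (\<Sum>j\<le>r. real p ^ (n * r) * (\<Prod>i<j. 1 - real p ^ i / real p ^ r) * rank_sum n j F)"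
      by (rule sum.mono_neutral_right) (auto simp: prod_eq_qfac)
    also have "\<dots> = ?c * (\<Sum>j\<le>r. rank_sum n j F / qfac ?q (r - j))"
      unfolding sum_distrib_left by (rule sum.cong[OF refl]) (simp add: prod_eq_qfac)
    finally show ?thesis .
  qed
  ultimately have "(\<Sum>k\<le>r. ?c * (real p ^ (k * r) * ?Y k / qfac ?q (r - k))) =
      real p ^ (r choose 2) * (?c * (\<Sum>j\<le>r. rank_sum n j F / qfac ?q (r - j)))"
    using peel_sum[OF F, where r = r and n = n] by (simp only:)
  then have "?c * (\<Sum>k\<le>r. real p ^ (k * r) * ?Y k / qfac ?q (r - k)) =
      ?c * (real p ^ (r choose 2) * (\<Sum>j\<le>r. rank_sum n j F / qfac ?q (r - j)))"
    by (simp only: sum_distrib_left[symmetric] mult.left_commute[of ?c])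
  then show "(\<Sum>k\<le>r. inverse ?q ^ (k * r) * ?Y k / qfac ?q (r - k)) =
      inverse ?q ^ (r choose 2) * (\<Sum>j\<le>r. rank_sum n j F / qfac ?q (r - j))"
    unfolding mult_left_cancel[OF less_imp_neq[OF cpos, symmetric]] inverse_inverse_eq .
qed

lemma gens_zero:
  assumes "p_group_type_S p G" "gens 0 G \<noteq> {}"
  shows "order G = 1"
proof -
  interpret p_group_type_S p G by fact
  have "carrier G = {\<one>\<^bsub>G\<^esub>}" using assms(2) generate_empty by (auto simp: gens_def)
  then show ?thesis by (simp add: order_def)
qed

text \<open>Rank 0 means generated by the empty tuple, hence trivial. For n = 0 the mass is counted
  with r = 0, where there is just the empty matrix.\<close>

lemma rank_sum_zero:
  assumes "iso_invariant p F" and one: "\<And>G. p_group_type_S p G \<Longrightarrow> order G = 1 \<Longrightarrow> F G = 1"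
  shows "rank_sum n 0 F = (if n = 0 then 1 else 0)"
proof (cases "n = 0")
  case False
  have "rank_sum n 0 F = class_sum p n (\<lambda>_. 0)"
    unfolding rank_sum_def
  proof (rule class_sum_cong)
    fix G :: "nat type_S" assume G: "p_group_type_S p G" "order G = p ^ n"
    have "\<not> rank_is 0 G"
    proof
      assume "rank_is 0 G"
      from card_gens_rank[OF G this, of 0] have "gens 0 G \<noteq> {}" by auto
      with gens_zero[OF G(1)] G(2) False p_gt_1 show False by simp
    qed
    then show "(if rank_is 0 G then F G else 0) = 0" by simp
  qed
  then show ?thesis using False by (simp add: class_sum_zero)
next
  case True
  have r0: "rank_is 0 G" if "p_group_type_S p G" "order G = 1" for G
    using rank_exists[OF that(1), of 0] that(2) by simp
  have "rank_sum 0 0 F = class_sum p 0 (\<lambda>G. real (card (gens 0 G)) * F G)"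
    unfolding rank_sum_def
    by (rule class_sum_cong) (use r0 in \<open>simp add: card_gens_rank[where n = 0 and k = 0]\<close>)
  also have "\<dots> = (\<Sum>b | b \<in> mats 0 (p ^ 0) \<and> order (realize p 0 0 b) = p ^ 0. F (realize p 0 0 b))"
    by (rule frame_sum[OF assms(1)]) simp
  also have "\<dots> = (\<Sum>b\<in>mats 0 (p ^ 0). 1)"
  proof (rule sum.cong)
    have o: "order (realize p 0 0 b) = 1" for b
      using realize(2)[of 0 0 b] framedD(1) by (intro gens_zero[OF realize(1)]) blast
    show "F (realize p 0 0 b) = 1" for b by (rule one[OF realize(1) o])
    from o show "{b. b \<in> mats 0 (p ^ 0) \<and> order (realize p 0 0 b) = p ^ 0} = mats 0 (p ^ 0)" by simp
  qed
  also have "\<dots> = 1" by (simp add: mats_def)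
  finally show ?thesis using True by simp
qed

end

section \<open>The averages\<close>

definition torsion_weight :: "nat \<Rightarrow> (nat \<Rightarrow> nat) \<Rightarrow> nat \<Rightarrow> nat \<Rightarrow> nat type_S \<Rightarrow> real"
  where "torsion_weight p m l i G = (\<Prod>j\<in>{Suc i..l}. real (card (torsion G (p ^ (j - i)))) ^ m j)"

definition tail_sum :: "(nat \<Rightarrow> nat) \<Rightarrow> nat \<Rightarrow> nat \<Rightarrow> nat"
  where "tail_sum m l i = (\<Sum>j\<in>{Suc i..l}. m j)"

text \<open>Double counting: m j occurs in the tails for i = 0, ..., j - 1. This produces the
  exponent in the theorem.\<close>

lemma sum_tail_sum: "(\<Sum>i<l. tail_sum m l i) = (\<Sum>i=1..l. i * m i)"
proof (induction l)
  case (Suc l)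
  have "tail_sum m (Suc l) i = tail_sum m l i + m (Suc l)" if "i \<le> l" for i
    using that by (simp add: tail_sum_def)
  then have "(\<Sum>i<Suc l. tail_sum m (Suc l) i) = (\<Sum>i<Suc l. tail_sum m l i + m (Suc l))"
    by (intro sum.cong) auto
  also have "\<dots> = (\<Sum>i<l. tail_sum m l i) + Suc l * m (Suc l)"
    by (simp add: sum.distrib tail_sum_def)
  finally show ?case using Suc by simp
qed simp

context prime_p
begin

lemma torsion_weight_invariant: "iso_invariant p (torsion_weight p m l i)"
  unfolding iso_invariant_def
proof (intro allI impI)
  fix G H :: "nat type_S"
  assume G: "p_group_type_S p G" and H: "p_group_type_S p H" and "iso_S G H \<noteq> {}"
  then obtain \<phi> where "\<phi> \<in> iso_S G H" by blast
  then show "torsion_weight p m l i G = torsion_weight p m l i H"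
    by (simp add: torsion_weight_def iso_S_card(2)[OF G H])
qed

text \<open>By \<open>card_torsion_Suc\<close> each factor |G[p^(j-i)]| splits off p^k, in total
  p^(k M i); the factor j = i + 1 becomes trivial.\<close>

lemma torsion_weight_peel:
  assumes G: "p_group_type_S p G" and k: "rank_is k G"
  shows "torsion_weight p m l i G = real p ^ (tail_sum m l i * k) * torsion_weight p m l (Suc i) (peel p G)"
proof -
  interpret p_group_type_S p G by (rule G)
  interpret P: p_group_type_S p "peel p G" by (rule peel_type_S[OF prime])
  let ?t = "\<lambda>j. real (card (torsion (peel p G) (p ^ (j - Suc i))))"
  have "torsion_weight p m l i G = (\<Prod>j\<in>{Suc i..l}. real p ^ (k * m j) * ?t j ^ m j)"
    unfolding torsion_weight_def
  proof (rule prod.cong[OF refl])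
    fix j assume "j \<in> {Suc i..l}"
    then have "j - i = Suc (j - Suc i)" by auto
    then show "real (card (torsion G (p ^ (j - i)))) ^ m j = real p ^ (k * m j) * ?t j ^ m j"
      using k by (simp only: card_torsion_Suc) (simp add: power_mult power_mult_distrib)
  qed
  also have "\<dots> = real p ^ (tail_sum m l i * k) * (\<Prod>j\<in>{Suc i..l}. ?t j ^ m j)"
    by (simp add: prod.distrib power_sum tail_sum_def sum_distrib_left mult.commute)
  also have "(\<Prod>j\<in>{Suc i..l}. ?t j ^ m j) = (\<Prod>j\<in>{Suc (Suc i)..l}. ?t j ^ m j)"
  proof (cases "Suc i \<le> l")
    case True
    have "torsion (peel p G) 1 = {\<one>\<^bsub>peel p G\<^esub>}"
      unfolding torsion_def by (auto simp del: peel_simps)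
    then show ?thesis using True by (simp add: atLeastAtMost_insertL[symmetric, of "Suc i" l])
  qed simp
  finally show ?thesis by (simp add: torsion_weight_def)
qed

lemma rank_sum_cong:
  assumes "\<And>G. p_group_type_S p G \<Longrightarrow> rank_is k G \<Longrightarrow> F G = F' G"
  shows "rank_sum n k F = rank_sum n k F'"
  unfolding rank_sum_def by (rule class_sum_cong) (use assms in auto)

lemma rank_recursion:
  "rank_recursion (inverse (real p)) (\<lambda>i n k. rank_sum n k (torsion_weight p m l i)) (tail_sum m l) l"
proof -
  interpret Q: q_param "inverse (real p)" by (rule q_param)
  show ?thesis
  proof unfold_locales
    fix i n k
    show "rank_sum n k (torsion_weight p m l i) \<ge> 0"
      unfolding rank_sum_def by (rule class_sum_nonneg) (auto simp: torsion_weight_def intro: prod_nonneg)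
    show "rank_sum (n + k) k (torsion_weight p m l i) = inverse (inverse (real p)) ^ (tail_sum m l i * k)
      * inverse (real p) ^ (Suc k choose 2)
      * parity_sum (inverse (real p)) (\<lambda>j. rank_sum n j (torsion_weight p m l (Suc i))) k"
    proof -
      have "rank_sum (n + k) k (torsion_weight p m l i) =
        rank_sum (n + k) k (\<lambda>G. real p ^ (tail_sum m l i * k) * torsion_weight p m l (Suc i) (peel p G))"
        by (rule rank_sum_cong) (rule torsion_weight_peel)
      also have "\<dots> = real p ^ (tail_sum m l i * k) *
        rank_sum (n + k) k (\<lambda>G. torsion_weight p m l (Suc i) (peel p G))"
        unfolding rank_sum_def class_sum_scale[symmetric] by (rule class_sum_cong) simp
      finally show ?thesis
        by (simp add: rank_sum_peel[OF torsion_weight_invariant])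
    qed
    show "n < k \<Longrightarrow> rank_sum n k (torsion_weight p m l i) = 0" by (rule rank_sum_large)
    show "rank_sum n 0 (torsion_weight p m l i) = (if n = 0 then 1 else 0)"
    proof (rule rank_sum_zero[OF torsion_weight_invariant])
      fix G :: "nat type_S" assume G: "p_group_type_S p G" "order G = 1"
      interpret p_group_type_S p G by (rule G(1))
      have "carrier G = {\<one>\<^bsub>G\<^esub>}" using G(2) order_one_triv_iff by simp
      then have "torsion G n = {\<one>\<^bsub>G\<^esub>}" for n by (auto simp: torsion_def)
      then show "torsion_weight p m l i G = 1" by (simp add: torsion_weight_def)
    qed
    show "tail_sum m l (Suc i) \<le> tail_sum m l i" unfolding tail_sum_def by (rule sum_mono2) auto
    show "l \<le> i \<Longrightarrow> tail_sum m l i = 0" by (simp add: tail_sum_def)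
    show "l \<le> i \<Longrightarrow> (\<lambda>n k. rank_sum n k (torsion_weight p m l i)) = (\<lambda>n k. rank_sum n k (torsion_weight p m l l))"
      by (simp add: torsion_weight_def[abs_def])
  qed
qed

text \<open>Replacing u = 0 by u = 1 shifts the index of the product by one, so the two products
  differ by the factor at i = 0, which is 1 / (1 - 1/p).\<close>

lemma average_product:
  defines "f \<equiv> \<lambda>u i. inverse (1 - real p powr (- 2 * u - 2 * real (Suc i) + 1))"
  shows "prodinf (f 0) = prodinf (f 1) / (1 - inverse (real p))" "prodinf (f 1) \<noteq> 0"
proof -
  define a where "a i = inverse (real p) * ((inverse (real p))\<^sup>2) ^ i" for i
  have p0: "real p > 1" using p_gt_1 by simp
  have pw: "real p powr (- real n) = inverse (real p) ^ n" for n
    using p0 by (simp add: powr_minus powr_realpow power_inverse)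
  have f0: "f 0 i = inverse (1 - a i)" for i
  proof -
    have "- 2 * 0 - 2 * real (Suc i) + 1 = - real (Suc (2 * i))" by simp
    then show ?thesis unfolding f_def using pw[of "Suc (2 * i)"] by (simp only:) (simp add: a_def power_mult)
  qed
  have f1: "f 1 i = f 0 (Suc i)" for i by (simp add: f_def)
  have a: "0 \<le> a i" "a i < 1" for i
  proof -
    interpret Q: q_param "inverse (real p)" by (rule q_param)
    have "a i = inverse (real p) ^ Suc (2 * i)" by (simp add: a_def power_mult)
    then show "0 \<le> a i" "a i < 1" using Q.pow_less_1[of "Suc (2 * i)"] Q.q_pos by simp_all
  qed
  have "(inverse (real p))\<^sup>2 < 1" using p0 by (simp add: power_less_one_iff field_simps)
  then have "summable a" unfolding a_def by (intro summable_mult summable_geometric) simp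
  then have "abs_convergent_prod (\<lambda>i. 1 - a i)"
    using a by (intro summable_imp_abs_convergent_prod) simp
  then have "convergent_prod (\<lambda>i. 1 - a i)" by (rule abs_convergent_prod_imp_convergent_prod)
  then have conv: "convergent_prod (f 0)" unfolding f0 by simp
  have nz: "f 0 i \<noteq> 0" for i using a(2)[of i] by (simp add: f0)
  have "f 1 = (\<lambda>i. f 0 (Suc i))" using f1 by blast
  then have e: "prodinf (f 1) = prodinf (f 0) / f 0 0" using prodinf_split_head[OF conv nz] by simp
  then show "prodinf (f 1) \<noteq> 0" using prodinf_nonzero[OF conv nz] nz by simp
  show "prodinf (f 0) = prodinf (f 1) / (1 - inverse (real p))"
    using e nz[of 0] by (simp add: f0 a_def field_simps)
qed

end

lemma avg_term_S_eq:
  assumes "prime p" and g: "\<And>G. p_group_type_S p G \<Longrightarrow> g G = complex_of_real (f G)"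
  shows "avg_term_S p u g n = complex_of_real (real p powr (real n * (1 - u)) * class_sum p n f)"
proof -
  have p0: "real p > 0" using assms(1) by (simp add: prime_gt_0_nat)
  have "(\<Sum>C\<in>iso_classes_S p n. let G = SOME G. G \<in> C in of_nat (order G) * g G / of_nat (card (auto_S G)))
    = (\<Sum>C\<in>iso_classes_S p n. complex_of_real (real p powr real n * (f (class_rep C) / real (card (auto_S (class_rep C))))))"
  proof (rule sum.cong[OF refl])
    fix C assume C: "C \<in> iso_classes_S p n"
    have "complex_of_real (real p powr real n) = of_nat (order (class_rep C))"
      using p0 class_rep_order[OF C] by (simp add: powr_realpow)
    then show "(let G = SOME G. G \<in> C in of_nat (order G) * g G / of_nat (card (auto_S G))) =
      complex_of_real (real p powr real n * (f (class_rep C) / real (card (auto_S (class_rep C)))))"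
      using g[OF class_rep_type_S[OF C]] by (simp add: Let_def flip: class_rep_def)
  qed
  also have "\<dots> = complex_of_real (real p powr real n * class_sum p n f)"
    by (simp add: class_sum_def sum_distrib_left)
  finally have "avg_term_S p u g n = complex_of_real (real p powr (- (real n * u)) * real p powr real n * class_sum p n f)"
    by (simp add: avg_term_S_def)
  also have "real p powr (- (real n * u)) * real p powr real n = real p powr (real n * (1 - u))"
    by (simp add: powr_add[symmetric] right_diff_distrib)
  finally show ?thesis .
qed

theorem theorem1:
  fixes p l :: nat and m :: "nat \<Rightarrow> nat" and g :: "nat type_S \<Rightarrow> complex"
  assumes "prime p"
    and "l \<ge> 1"
    and "\<And>G. p_group_type_S p G \<Longrightarrow>
      g G = (\<Prod>i=1..l. of_nat (card (torsion G (p ^ i))) ^ m i)"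
  shows "summable (avg_term_S p 0 g) \<and> summable (avg_term_S p 1 g) \<and>
    M_S p 0 g = M_S p 1 g * of_nat (p ^ (\<Sum>i=1..l. i * m i))"
proof -
  interpret prime_p p by unfold_locales (rule assms(1))
  interpret rank_recursion "inverse (real p)" "\<lambda>i n k. rank_sum n k (torsion_weight p m l i)" "tail_sum m l" l
    by (rule rank_recursion)
  let ?F = "torsion_weight p m l 0" and ?s = "\<Sum>i=1..l. i * m i"
  have p0: "real p > 0" using p_gt_1 by simp
  have avg: "avg_term_S p u g n = complex_of_real (real p powr (real n * (1 - u)) * class_sum p n ?F)" for u n
    by (rule avg_term_S_eq[OF assms(1)]) (simp add: assms(3) torsion_weight_def)
  obtain E where E: "(\<lambda>n. real p ^ n * class_sum p n ?F) sums E"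
    "(\<lambda>n. class_sum p n ?F) sums ((1 - inverse (real p)) * inverse (real p) ^ ?s * E)"
    using average_sums by (auto simp: class_sum_rank_sum[symmetric] sum_tail_sum)
  have s0: "avg_term_S p 0 g sums complex_of_real E"
    using sums_of_real[OF E(1), where 'a = complex] p0 by (simp add: avg[abs_def] powr_realpow)
  have s1: "avg_term_S p 1 g sums complex_of_real ((1 - inverse (real p)) * inverse (real p) ^ ?s * E)"
    using sums_of_real[OF E(2), where 'a = complex] p0 by (simp add: avg[abs_def])
  define P where "P u = (\<Prod>i. inverse (1 - real p powr (- 2 * u - 2 * real (Suc i) + 1)))" for u
  have P: "P 0 = P 1 / (1 - inverse (real p))" "P 1 \<noteq> 0"
    unfolding P_def by (rule average_product)+
  have M: "M_S p 0 g = complex_of_real (E / P 0)"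
    "M_S p 1 g = complex_of_real ((1 - inverse (real p)) * inverse (real p) ^ ?s * E / P 1)"
    using sums_unique[OF s0] sums_unique[OF s1] by (simp_all only: M_S_def P_def[symmetric] of_real_divide)
  have "inverse (real p) ^ ?s * real (p ^ ?s) = 1"
    using p0 by (simp flip: power_mult_distrib)
  then have "E / P 0 = (inverse (real p) ^ ?s * real (p ^ ?s)) * ((1 - inverse (real p)) * E / P 1)"
    by (simp add: P(1))
  then have "E / P 0 = (1 - inverse (real p)) * inverse (real p) ^ ?s * E / P 1 * real (p ^ ?s)"
    by (simp only: ac_simps times_divide_eq_right times_divide_eq_left)
  then have "M_S p 0 g = M_S p 1 g * of_nat (p ^ ?s)"
    unfolding M by (simp only: of_real_mult of_real_of_nat_eq)
  then show ?thesis using s0 s1 by (auto simp: sums_iff)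
qed

end
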